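(* If \textsc{2RangeDisjointQuery} with $q=n$ queries can be solved offline in $T(n)$ time, then the $(\min,\max)$-product of two $n\times n$ matrices can be computed in $\tilde O(T(n^2))$ time.
   Context: The $(\min,\max)$-product of matrices $A,B$ is the matrix $C$ with $C[i][j]=\min_k\max(A[i][k],B[k][j])$. \textsc{2RangeDisjointQuery}: given an array of integers $A[1..n]$ and a sequence of $q$ pairs of nonoverlapping ranges $([l',r'],[l'',r''])$ with $r'<l''$, determine for each pair whether there are no $i,j$ with $l'\le i\le r'<l''\le j\le r''$ and $A[i]=A[j]$. Offline means all queries are known in advance. $\tilde O$ hides polylogarithmic factors. *)

theory Defs
  imports "HOL-Library.Landau_Symbols" "Jordan_Normal_Form.Matrix"
begin

section \<open>The word RAM\<close>

text \<open>
  The model of computation is the unit-cost word RAM: finitely many registers, a word-addressable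
  memory with indirect addressing, and the usual word operations, each taking one time step.
  Control flow is structured; a program with jumps becomes a single loop that dispatches on a
  program counter held in a register, which costs a constant factor.

  Words are signed integers of absolute value at most \<open>W\<close>. Every value written by an instruction
  must be a word: there is no rule for an overflowing instruction, so a program that overflows
  has no execution at all.
\<close>

datatype binop = Add | Sub | Mul | Div | Mod | And | Or | Xor | Shl | Shr

fun apply_binop :: "binop \<Rightarrow> int \<Rightarrow> int \<Rightarrow> int" where
  "apply_binop Add a b = a + b"
| "apply_binop Sub a b = a - b"
| "apply_binop Mul a b = a * b"
| "apply_binop Div a b = a div b"
| "apply_binop Mod a b = a mod b"
| "apply_binop And a b = semiring_bit_operations_class.and a b"
| "apply_binop Or a b = semiring_bit_operations_class.or a b"
| "apply_binop Xor a b = semiring_bit_operations_class.xor a b"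
| "apply_binop Shl a b = push_bit (nat b) a"
| "apply_binop Shr a b = drop_bit (nat b) a"

type_synonym reg = nat

datatype instr =
    Const reg int
  | Op reg binop reg reg
  | Load reg reg
  | Store reg reg

datatype test = Less reg reg | Equal reg reg

datatype prog =
    Skip
  | Instr instr
  | Seq prog prog
  | If test prog prog
  | While test prog

record state =
  regs :: "reg \<Rightarrow> int"
  mem :: "int \<Rightarrow> int"

definition set_reg :: "reg \<Rightarrow> int \<Rightarrow> state \<Rightarrow> state" where
  "set_reg r v s = s\<lparr>regs := (regs s)(r := v)\<rparr>"

text \<open>\<open>Load r a\<close> reads the cell whose address is in register \<open>a\<close>;
  \<open>Store a r\<close> writes register \<open>r\<close> to the cell whose address is in register \<open>a\<close>.\<close>

fun run_instr :: "instr \<Rightarrow> state \<Rightarrow> state" where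
  "run_instr (Const r v) s = set_reg r v s"
| "run_instr (Op r f a b) s = set_reg r (apply_binop f (regs s a) (regs s b)) s"
| "run_instr (Load r a) s = set_reg r (mem s (regs s a)) s"
| "run_instr (Store a r) s = s\<lparr>mem := (mem s)(regs s a := regs s r)\<rparr>"

definition fits :: "int \<Rightarrow> state \<Rightarrow> bool" where
  "fits W s \<longleftrightarrow> (\<forall>r. \<bar>regs s r\<bar> \<le> W) \<and> (\<forall>a. \<bar>mem s a\<bar> \<le> W)"

fun holds :: "test \<Rightarrow> state \<Rightarrow> bool" where
  "holds (Less a b) s \<longleftrightarrow> regs s a < regs s b"
| "holds (Equal a b) s \<longleftrightarrow> regs s a = regs s b"

text \<open>\<open>exec W p s t s'\<close>: on a machine with word bound \<open>W\<close>, program \<open>p\<close> started in state \<open>s\<close> halts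
  in state \<open>s'\<close> after exactly \<open>t\<close> time steps.\<close>

inductive exec :: "int \<Rightarrow> prog \<Rightarrow> state \<Rightarrow> nat \<Rightarrow> state \<Rightarrow> bool" for W where
  Skip: "exec W Skip s 1 s"
| Instr: "fits W (run_instr i s) \<Longrightarrow> exec W (Instr i) s 1 (run_instr i s)"
| Seq: "exec W p s t s' \<Longrightarrow> exec W q s' t' s'' \<Longrightarrow> exec W (Seq p q) s (t + t') s''"
| IfTrue: "holds b s \<Longrightarrow> exec W p s t s' \<Longrightarrow> exec W (If b p q) s (Suc t) s'"
| IfFalse: "\<not> holds b s \<Longrightarrow> exec W q s t s' \<Longrightarrow> exec W (If b p q) s (Suc t) s'"
| WhileFalse: "\<not> holds b s \<Longrightarrow> exec W (While b p) s 1 s"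
| WhileTrue: "holds b s \<Longrightarrow> exec W p s t s' \<Longrightarrow> exec W (While b p) s' t' s''
    \<Longrightarrow> exec W (While b p) s (Suc (t + t')) s''"

inductive_cases SkipE: "exec W Skip s t s'"
inductive_cases InstrE: "exec W (Instr i) s t s'"
inductive_cases SeqE: "exec W (Seq p q) s t s'"
inductive_cases IfE: "exec W (If b p q) s t s'"
inductive_cases WhileE: "exec W (While b p) s t s'"

lemma exec_deterministic:
  "exec W p s t s' \<Longrightarrow> exec W p s u s'' \<Longrightarrow> u = t \<and> s'' = s'"
proof (induction arbitrary: u s'' rule: exec.induct)
  case (Skip s)
  from Skip.prems show ?case by (rule SkipE) simp
next
  case (Instr i s)
  from Instr.prems show ?case by (rule InstrE) simp
next
  case (Seq p s t s' q t' s2)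
  from Seq.prems show ?case
  proof (rule SeqE)
    fix t1 s1 t2
    assume u: "u = t1 + t2" and p: "exec W p s t1 s1" and q: "exec W q s1 t2 s''"
    have "t1 = t \<and> s1 = s'" by (rule Seq.IH(1)[OF p])
    with q have "exec W q s' t2 s''" by simp
    then have "t2 = t' \<and> s'' = s2" by (rule Seq.IH(2))
    with u \<open>t1 = t \<and> s1 = s'\<close> show ?thesis by simp
  qed
next
  case (IfTrue b s p t s' q)
  from IfTrue.prems show ?case
  proof (rule IfE)
    fix t1
    assume u: "u = Suc t1" and p: "exec W p s t1 s''"
    from IfTrue.IH[OF p] u show ?thesis by simp
  qed (use IfTrue.hyps(1) in simp)
next
  case (IfFalse b s q t s' p)
  from IfFalse.prems show ?case
  proof (rule IfE)
    fix t1
    assume u: "u = Suc t1" and q: "exec W q s t1 s''"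
    from IfFalse.IH[OF q] u show ?thesis by simp
  qed (use IfFalse.hyps(1) in simp)
next
  case (WhileFalse b s p)
  from WhileFalse.prems show ?case
    by (rule WhileE) (use WhileFalse.hyps in simp_all)
next
  case (WhileTrue b s p t s' t' s2)
  from WhileTrue.prems show ?case
  proof (rule WhileE)
    fix t1 s1 t2
    assume u: "u = Suc (t1 + t2)" and p: "exec W p s t1 s1"
      and q: "exec W (While b p) s1 t2 s''"
    have "t1 = t \<and> s1 = s'" by (rule WhileTrue.IH(1)[OF p])
    with q have "exec W (While b p) s' t2 s''" by simp
    then have "t2 = t' \<and> s'' = s2" by (rule WhileTrue.IH(2))
    with u \<open>t1 = t \<and> s1 = s'\<close> show ?thesis by simp
  qed (use WhileTrue.hyps(1) in simp)
qed

section \<open>Problems and running times\<close>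

text \<open>A problem is a set of triples (size parameter, input words, required output words).\<close>

type_synonym problem = "(nat \<times> int list \<times> int list) set"

definition initial_state :: "int list \<Rightarrow> state" where
  "initial_state xs =
    \<lparr>regs = (\<lambda>_. 0), mem = (\<lambda>a. if 0 \<le> a \<and> a < int (length xs) then xs ! nat a else 0)\<rparr>"

definition has_output :: "state \<Rightarrow> int list \<Rightarrow> bool" where
  "has_output s ys \<longleftrightarrow> (\<forall>i < length ys. mem s (int i) = ys ! i)"

text \<open>Words have \<open>O(log (N + M))\<close> bits, where \<open>N\<close> is the number of input words and \<open>M\<close> is their
  largest absolute value; \<open>d\<close> is the constant hidden in the \<open>O\<close>.\<close>

definition word_bound :: "nat \<Rightarrow> int list \<Rightarrow> int" where
  "word_bound d xs = (2 + int (length xs) + Max (insert 0 (abs ` set xs))) ^ d"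

text \<open>The problem is solved by one program, correct on all instances, whose worst-case running
  time as a function of the size parameter is bounded by some function in the class \<open>F\<close>.\<close>

definition solvable_in_time :: "problem \<Rightarrow> (nat \<Rightarrow> real) set \<Rightarrow> bool" where
  "solvable_in_time P F \<longleftrightarrow>
    (\<exists>p d. \<exists>f \<in> F. \<forall>(n, xs, ys) \<in> P. \<exists>t s.
      exec (word_bound d xs) p (initial_state xs) t s \<and> has_output s ys \<and> real t \<le> f n)"

definition soft_O :: "(nat \<Rightarrow> real) \<Rightarrow> (nat \<Rightarrow> real) set" where
  "soft_O g = (\<Union>k. O(\<lambda>n. g n * ln (real n) ^ k))"

section \<open>Offline 2RangeDisjointQuery\<close>

text \<open>A query \<open>((l', r'), (l'', r''))\<close> refers to array positions counted from 1.\<close>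

type_synonym query = "(nat \<times> nat) \<times> (nat \<times> nat)"

fun valid_query :: "nat \<Rightarrow> query \<Rightarrow> bool" where
  "valid_query n ((l', r'), (l'', r'')) \<longleftrightarrow> 1 \<le> l' \<and> l' \<le> r' \<and> r' < l'' \<and> l'' \<le> r'' \<and> r'' \<le> n"

fun ranges_disjoint :: "int list \<Rightarrow> query \<Rightarrow> bool" where
  "ranges_disjoint A ((l', r'), (l'', r'')) \<longleftrightarrow>
    \<not> (\<exists>i j. l' \<le> i \<and> i \<le> r' \<and> r' < l'' \<and> l'' \<le> j \<and> j \<le> r'' \<and> A ! (i - 1) = A ! (j - 1))"

fun query_words :: "query \<Rightarrow> int list" where
  "query_words ((l', r'), (l'', r'')) = [int l', int r', int l'', int r'']"

text \<open>The number \<open>q\<close> of queries is a function of the array length. The problem is offline: all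
  queries are part of the input.\<close>

definition two_range_disjoint_query :: "(nat \<Rightarrow> nat) \<Rightarrow> problem" where
  "two_range_disjoint_query q =
    {(n, [int n, int (q n)] @ A @ concat (map query_words Q),
      map (\<lambda>x. of_bool (ranges_disjoint A x)) Q) | n A Q.
      length A = n \<and> length Q = q n \<and> (\<forall>x \<in> set Q. valid_query n x)}"

section \<open>The (min,max)-product\<close>

definition min_max_prod :: "'a::linorder mat \<Rightarrow> 'a mat \<Rightarrow> 'a mat" where
  "min_max_prod A B =
    mat (dim_row A) (dim_col B) (\<lambda>(i, j). Min ((\<lambda>k. max (A $$ (i, k)) (B $$ (k, j))) ` {..<dim_col A}))"

text \<open>Matrices are stored in row-major order.\<close>

definition min_max_product :: problem where
  "min_max_product =
    {(n, [int n] @ concat (mat_to_list A) @ concat (mat_to_list B),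
      concat (mat_to_list (min_max_prod A B))) | n A B.
      0 < n \<and> A \<in> carrier_mat n n \<and> B \<in> carrier_mat n n}"

end

theory Submission
  imports Defs
begin

text \<open>Parallel binary search.  The lines (the \<open>n\<close> rows of \<open>A\<close> and the \<open>n\<close> columns of \<open>B\<close>) hold
  \<open>2 * n\<^sup>2\<close> entries; sort them and list every line by increasing rank.  For a rank \<open>w\<close>, the entries
  of rank below \<open>w\<close> in row \<open>i\<close> and in column \<open>j\<close> form prefixes of two lines, and the entry \<open>(i, j)\<close> of
  the product has rank below \<open>w\<close> iff these prefixes share an index \<open>k\<close>.  So all \<open>n\<^sup>2\<close> ranks are found in
  \<open>O(log n)\<close> rounds of disjointness queries on the array of the indices along the lines.

  Nothing is assumed about how \<open>T\<close> grows, so every call must be on an array of length exactly \<open>n\<^sup>2\<close>,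
  whereas the lines have total length \<open>2 * n\<^sup>2\<close>: a round takes nine calls, one for each pair of a block of
  \<open>h = n div 2\<close> rows and a block of \<open>h\<close> columns, where three blocks cover all rows (columns).  Each call
  gets its own window of untouched, hence zero, memory.  The \<open>n\<^sup>2\<close> polylog overhead is absorbed because any
  solver has to overwrite almost all of its output cells on some instance.\<close>

section \<open>Structured programs on registers and arrays\<close>

text \<open>Searching over ranks rather than values keeps the number of rounds logarithmic in n
  however large the integers are, and it breaks ties. Keys increase weakly with rank, so the min-max
  of the ranks points at the min-max of the values. The solver may touch any address up to its word
  bound \<open>V\<close> in absolute value, and \<open>V\<close> is a polynomial in n of unknown
  degree. Wiping a used window could take far longer than the call itself; this is why windows are
  never reused. All windows together still have polynomial size, so longer words are enough to
  address them: a solver with word exponent \<open>d\<close> yields a program with exponent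
  \<open>2 * Suc d + 6\<close>. The windows are laid out upwards from the end of the input, and the
  program's own arrays sit in the negative addresses, out of the solver's reach. Apart from the case
  n = 1 the program has no branches outside loop control. Conditions become factors 0 and 1, so that
  straight-line code is a list of assignments whose weakest precondition can be evaluated by
  rewriting. The price is that a cell is read even when its value is masked, hence the index bounds
  have to hold there as well.\<close>

datatype exp = Num int | Var nat | Bin binop exp exp | Lt exp exp | Arr nat exp

abbreviation Plus (infixl "\<boxplus>" 65) where "a \<boxplus> b \<equiv> Bin Add a b"
abbreviation Minus (infixl "\<boxminus>" 65) where "a \<boxminus> b \<equiv> Bin Sub a b"
abbreviation Times (infixl "\<boxtimes>" 70) where "a \<boxtimes> b \<equiv> Bin Mul a b"
abbreviation Divide (infixl "\<boxslash>" 70) where "a \<boxslash> b \<equiv> Bin Div a b"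
abbreviation Modulo (infixl "\<box>%" 70) where "a \<box>% b \<equiv> Bin Mod a b"

text \<open>Array 0 occupies the addresses \<open>0, 1, \<dots>\<close>, which hold the input and the output; the arrays
  \<open>1, \<dots>, 15\<close> are interleaved in the negative addresses.  Registers from 50 on are scratch space.\<close>

definition addr :: "nat \<Rightarrow> int \<Rightarrow> int" where
  "addr c i = (if c = 0 then i else - (16 * i + int c))"

text \<open>Among the arrays 1 to 15 the array number is the remainder modulo 16. Their cells have
  negative addresses even at index 0, since the array number is at least 1, so array 0 is never
  met.\<close>

lemma addr_inj:
  assumes "c < 16" "c' < 16" "0 \<le> i" "0 \<le> i'"
  shows "addr c i = addr c' i' \<longleftrightarrow> c = c' \<and> i = i'"
proof -
  have "\<And>x y a b :: int. 16 * x + a = 16 * y + b \<Longrightarrow> 0 \<le> a \<Longrightarrow> a < 16 \<Longrightarrow> 0 \<le> b \<Longrightarrow> b < 16 \<Longrightarrow> x = y \<and> a = b"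
    by presburger
  from this[of i "int c" i' "int c'"] show ?thesis using assms unfolding addr_def by auto
qed

text \<open>Scratch registers read as 0 in this view, and \<open>av\<close> blanks everything that
  is not a cell of an array. Evaluating an expression therefore leaves both views literally
  equal.\<close>

definition rv :: "state \<Rightarrow> nat \<Rightarrow> int" where
  "rv s r = (if r < 50 then regs s r else 0)"

definition av :: "state \<Rightarrow> nat \<Rightarrow> int \<Rightarrow> int" where
  "av s c i = (if c < 16 \<and> 0 \<le> i then mem s (addr c i) else 0)"

fun ev :: "(nat \<Rightarrow> int) \<Rightarrow> (nat \<Rightarrow> int \<Rightarrow> int) \<Rightarrow> exp \<Rightarrow> int" where
  "ev \<rho> \<mu> (Num c) = c"
| "ev \<rho> \<mu> (Var v) = \<rho> v"
| "ev \<rho> \<mu> (Bin f a b) = apply_binop f (ev \<rho> \<mu> a) (ev \<rho> \<mu> b)"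
| "ev \<rho> \<mu> (Lt a b) = of_bool (ev \<rho> \<mu> a < ev \<rho> \<mu> b)"
| "ev \<rho> \<mu> (Arr c a) = \<mu> c (ev \<rho> \<mu> a)"

text \<open>A variable needs no bound, since a register of a fitting state holds a word. For a cell,
  the bound on \<open>16 * index + 16\<close> covers the computation of the interleaved address;
  asking it of array 0 too costs a constant factor in \<open>W\<close>.\<close>

fun safe :: "int \<Rightarrow> (nat \<Rightarrow> int) \<Rightarrow> (nat \<Rightarrow> int \<Rightarrow> int) \<Rightarrow> exp \<Rightarrow> bool" where
  "safe W \<rho> \<mu> (Num c) \<longleftrightarrow> \<bar>c\<bar> \<le> W"
| "safe W \<rho> \<mu> (Var v) \<longleftrightarrow> v < 50"
| "safe W \<rho> \<mu> (Bin f a b) \<longleftrightarrow> safe W \<rho> \<mu> a \<and> safe W \<rho> \<mu> b \<and>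
     \<bar>apply_binop f (ev \<rho> \<mu> a) (ev \<rho> \<mu> b)\<bar> \<le> W"
| "safe W \<rho> \<mu> (Lt a b) \<longleftrightarrow> safe W \<rho> \<mu> a \<and> safe W \<rho> \<mu> b"
| "safe W \<rho> \<mu> (Arr c a) \<longleftrightarrow> safe W \<rho> \<mu> a \<and> c < 16 \<and> 0 \<le> ev \<rho> \<mu> a \<and> 16 * ev \<rho> \<mu> a + 16 \<le> W"

fun cost :: "exp \<Rightarrow> nat" where
  "cost (Num c) = 1"
| "cost (Var v) = 1"
| "cost (Bin f a b) = cost a + cost b + 1"
| "cost (Lt a b) = cost a + cost b + 2"
| "cost (Arr c a) = cost a + 5"

definition to_addr :: "nat \<Rightarrow> reg \<Rightarrow> prog" where
  "to_addr c t = (if c = 0 then Skip else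
     Seq (Seq (Instr (Const (Suc t) (- 16))) (Instr (Op t Mul t (Suc t))))
         (Seq (Instr (Const (Suc t) (- int c))) (Instr (Op t Add t (Suc t)))))"

text \<open>There is no move instruction; a register is copied by taking \<open>Or\<close> with
  itself, which cannot overflow.\<close>

fun compile :: "exp \<Rightarrow> reg \<Rightarrow> prog" where
  "compile (Num c) t = Instr (Const t c)"
| "compile (Var v) t = Instr (Op t Or v v)"
| "compile (Bin f a b) t = Seq (compile a t) (Seq (compile b (Suc t)) (Instr (Op t f t (Suc t))))"
| "compile (Lt a b) t = Seq (compile a t) (Seq (compile b (Suc t))
     (If (Less t (Suc t)) (Instr (Const t 1)) (Instr (Const t 0))))"
| "compile (Arr c a) t = Seq (compile a t) (Seq (to_addr c t) (Instr (Load t t)))"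

text \<open>Stack discipline: code compiled for target \<open>t\<close> writes only registers from
  \<open>t\<close> on, so an operand held in \<open>t\<close> survives the evaluation of the next
  one in \<open>Suc t\<close>.\<close>

definition keeps :: "reg \<Rightarrow> state \<Rightarrow> state \<Rightarrow> bool" where
  "keeps t s s' \<longleftrightarrow> mem s' = mem s \<and> (\<forall>r < t. regs s' r = regs s r)"

lemma keeps_views:
  assumes "keeps t s s'" "50 \<le> t"
  shows "rv s' = rv s" "av s' = av s"
  using assms by (auto simp: keeps_def rv_def av_def fun_eq_iff)

lemma keeps_trans: "keeps t s s' \<Longrightarrow> keeps t' s' s'' \<Longrightarrow> t \<le> t' \<Longrightarrow> keeps t s s''"
  by (auto simp: keeps_def)

lemma fits_set_reg: "fits W s \<Longrightarrow> \<bar>v\<bar> \<le> W \<Longrightarrow> fits W (set_reg r v s)"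
  by (auto simp: fits_def set_reg_def)

lemma exec_set:
  assumes "fits W s" "run_instr i s = set_reg r v s" "\<bar>v\<bar> \<le> W"
  shows "exec W (Instr i) s 1 (set_reg r v s)"
  using exec.Instr[of W i s] fits_set_reg[of W s v r] assms by simp

lemma to_addr_correct:
  assumes "fits W s" "c < 16" "0 \<le> regs s t" "16 * regs s t + 16 \<le> W"
  shows "\<exists>n s'. exec W (to_addr c t) s n s' \<and> n \<le> 4 \<and> fits W s' \<and> keeps t s s' \<and>
    regs s' t = addr c (regs s t)"
proof (cases "c = 0")
  case True
  then show ?thesis using assms exec.Skip[of W s]
    by (intro exI[of _ 1] exI[of _ s]) (auto simp: to_addr_def addr_def keeps_def)
next
  case False
  let ?x = "regs s t"
  define s1 where "s1 = set_reg (Suc t) (- 16) s"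
  define s2 where "s2 = set_reg t (- 16 * ?x) s1"
  define s3 where "s3 = set_reg (Suc t) (- int c) s2"
  define s4 where "s4 = set_reg t (- (16 * ?x + int c)) s3"
  have f1: "fits W s1" unfolding s1_def using assms by (intro fits_set_reg) auto
  have f2: "fits W s2" unfolding s2_def using assms f1 by (intro fits_set_reg) auto
  have f3: "fits W s3" unfolding s3_def using assms f2 by (intro fits_set_reg) auto
  have f4: "fits W s4" unfolding s4_def using assms f3 by (intro fits_set_reg) auto
  have e1: "exec W (Instr (Const (Suc t) (- 16))) s 1 s1"
    unfolding s1_def using assms by (intro exec_set) auto
  have e2: "exec W (Instr (Op t Mul t (Suc t))) s1 1 s2"
    unfolding s2_def using assms f1 by (intro exec_set) (auto simp: s1_def set_reg_def mult.commute)
  have e3: "exec W (Instr (Const (Suc t) (- int c))) s2 1 s3"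
    unfolding s3_def using assms f2 by (intro exec_set) auto
  have e4: "exec W (Instr (Op t Add t (Suc t))) s3 1 s4"
    unfolding s4_def using assms f3
    by (intro exec_set) (auto simp: s1_def s2_def s3_def set_reg_def)
  have "exec W (to_addr c t) s 4 s4"
    using exec.Seq[OF exec.Seq[OF e1 e2] exec.Seq[OF e3 e4]] False unfolding to_addr_def by (simp add: numeral_eq_Suc)
  then show ?thesis using False f4
    by (intro exI[of _ 4] exI[of _ s4])
      (auto simp: s1_def s2_def s3_def s4_def set_reg_def keeps_def addr_def)
qed

lemma fits_nonneg: "fits W s \<Longrightarrow> 0 \<le> W"
  using abs_ge_zero order_trans unfolding fits_def by blast

lemma compile_correct:
  assumes "fits W s" "safe W (rv s) (av s) e" "50 \<le> t" "1 \<le> W"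
  shows "\<exists>n s'. exec W (compile e t) s n s' \<and> n \<le> cost e \<and> fits W s' \<and> keeps t s s' \<and>
    regs s' t = ev (rv s) (av s) e"
  using assms
proof (induction e arbitrary: s t)
  case (Num c)
  then show ?case
    using exec_set[of W s "Const t c" t c] fits_set_reg[of W s c t]
    by (intro exI[of _ 1] exI[of _ "set_reg t c s"]) (auto simp: keeps_def set_reg_def)
next
  case (Var v)
  then have "\<bar>regs s v\<bar> \<le> W" by (simp add: fits_def)
  with Var show ?case
    using exec_set[of W s "Op t Or v v" t "regs s v"] fits_set_reg[of W s "regs s v" t]
    by (intro exI[of _ 1] exI[of _ "set_reg t (regs s v) s"]) (auto simp: keeps_def set_reg_def rv_def)
next
  case (Bin f a b)
  let ?\<rho> = "rv s" and ?\<mu> = "av s"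
  from Bin.IH(1)[of s t] Bin.prems obtain n1 s1 where 1: "exec W (compile a t) s n1 s1" "n1 \<le> cost a"
    "fits W s1" "keeps t s s1" "regs s1 t = ev ?\<rho> ?\<mu> a" by auto
  note v1 = keeps_views[OF 1(4) Bin.prems(3)]
  from Bin.IH(2)[of s1 "Suc t"] Bin.prems 1(3) v1 obtain n2 s2 where
    2: "exec W (compile b (Suc t)) s1 n2 s2" "n2 \<le> cost b"
    "fits W s2" "keeps (Suc t) s1 s2" "regs s2 (Suc t) = ev ?\<rho> ?\<mu> b" by auto
  let ?v = "apply_binop f (ev ?\<rho> ?\<mu> a) (ev ?\<rho> ?\<mu> b)"
  have t: "regs s2 t = ev ?\<rho> ?\<mu> a" using 1(5) 2(4) by (simp add: keeps_def)
  have e: "exec W (Instr (Op t f t (Suc t))) s2 1 (set_reg t ?v s2)"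
    using Bin.prems 2(3,5) t by (intro exec_set) auto
  show ?case
    using exec.Seq[OF 1(1) exec.Seq[OF 2(1) e]] 1(2,4) 2(2,3,4) Bin.prems
    by (intro exI[of _ "n1 + (n2 + 1)"] exI[of _ "set_reg t ?v s2"])
      (auto simp: keeps_def set_reg_def intro: fits_set_reg[unfolded set_reg_def])
next
  case (Lt a b)
  let ?\<rho> = "rv s" and ?\<mu> = "av s"
  from Lt.IH(1)[of s t] Lt.prems obtain n1 s1 where 1: "exec W (compile a t) s n1 s1" "n1 \<le> cost a"
    "fits W s1" "keeps t s s1" "regs s1 t = ev ?\<rho> ?\<mu> a" by auto
  note v1 = keeps_views[OF 1(4) Lt.prems(3)]
  from Lt.IH(2)[of s1 "Suc t"] Lt.prems 1(3) v1 obtain n2 s2 where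
    2: "exec W (compile b (Suc t)) s1 n2 s2" "n2 \<le> cost b"
    "fits W s2" "keeps (Suc t) s1 s2" "regs s2 (Suc t) = ev ?\<rho> ?\<mu> b" by auto
  let ?v = "of_bool (ev ?\<rho> ?\<mu> a < ev ?\<rho> ?\<mu> b) :: int"
  have t: "regs s2 t = ev ?\<rho> ?\<mu> a" using 1(5) 2(4) by (simp add: keeps_def)
  have e: "exec W (If (Less t (Suc t)) (Instr (Const t 1)) (Instr (Const t 0))) s2 2 (set_reg t ?v s2)"
  proof (cases "ev ?\<rho> ?\<mu> a < ev ?\<rho> ?\<mu> b")
    case True
    have "exec W (Instr (Const t 1)) s2 1 (set_reg t 1 s2)"
      using Lt.prems 2(3) by (intro exec_set) auto
    from exec.IfTrue[OF _ this, of "Less t (Suc t)"] True show ?thesis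
      using 2(5) t by (simp add: numeral_2_eq_2)
  next
    case False
    have "exec W (Instr (Const t 0)) s2 1 (set_reg t 0 s2)"
      using Lt.prems 2(3) by (intro exec_set) auto
    from exec.IfFalse[OF _ this, of "Less t (Suc t)"] False show ?thesis
      using 2(5) t by (simp add: numeral_2_eq_2)
  qed
  have "\<bar>?v\<bar> \<le> W" using Lt.prems by simp
  then show ?case
    using exec.Seq[OF 1(1) exec.Seq[OF 2(1) e]] 1(2,4) 2(2,3,4) Lt.prems
    by (intro exI[of _ "n1 + (n2 + 2)"] exI[of _ "set_reg t ?v s2"])
      (auto simp: keeps_def set_reg_def intro: fits_set_reg[unfolded set_reg_def])
next
  case (Arr c a)
  let ?\<rho> = "rv s" and ?\<mu> = "av s"
  from Arr.IH(1)[of s t] Arr.prems obtain n1 s1 where 1: "exec W (compile a t) s n1 s1" "n1 \<le> cost a"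
    "fits W s1" "keeps t s s1" "regs s1 t = ev ?\<rho> ?\<mu> a" by auto
  from to_addr_correct[of W s1 c t] 1 Arr.prems obtain n2 s2 where
    2: "exec W (to_addr c t) s1 n2 s2" "n2 \<le> 4" "fits W s2" "keeps t s1 s2"
    "regs s2 t = addr c (ev ?\<rho> ?\<mu> a)" by auto
  let ?v = "mem s2 (addr c (ev ?\<rho> ?\<mu> a))"
  have b: "\<bar>?v\<bar> \<le> W" using 2(3) by (simp add: fits_def)
  have e: "exec W (Instr (Load t t)) s2 1 (set_reg t ?v s2)"
    using 2(3,5) b by (intro exec_set) auto
  have "?v = ev ?\<rho> ?\<mu> (Arr c a)"
  proof -
    have "mem s2 = mem s" using 1(4) 2(4) by (simp add: keeps_def)
    then show ?thesis using Arr.prems by (simp add: av_def[of s c])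
  qed
  then show ?case
    using exec.Seq[OF 1(1) exec.Seq[OF 2(1) e]] 1(2,4) 2(2,3,4) b
    by (intro exI[of _ "n1 + (n2 + 1)"] exI[of _ "set_reg t ?v s2"])
      (auto simp: keeps_def set_reg_def intro: fits_set_reg[unfolded set_reg_def])
qed

text \<open>Total correctness with a time bound. The precondition is a concrete pair of views
  instead of a predicate, which lets \<open>wp\<close> run symbolically on the store.\<close>

definition triple ::
  "int \<Rightarrow> prog \<Rightarrow> nat \<Rightarrow> (nat \<Rightarrow> int) \<Rightarrow> (nat \<Rightarrow> int \<Rightarrow> int) \<Rightarrow>
    ((nat \<Rightarrow> int) \<Rightarrow> (nat \<Rightarrow> int \<Rightarrow> int) \<Rightarrow> bool) \<Rightarrow> bool" where
  "triple W p k \<rho> \<mu> Q \<longleftrightarrow>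
    (\<forall>s. fits W s \<and> rv s = \<rho> \<and> av s = \<mu> \<longrightarrow>
      (\<exists>t s'. exec W p s t s' \<and> t \<le> k \<and> fits W s' \<and> Q (rv s') (av s')))"

lemma rv_set_reg: "v < 50 \<Longrightarrow> rv (set_reg v x s) = (rv s)(v := x)"
  by (auto simp: rv_def set_reg_def)

lemma av_set_reg: "av (set_reg v x s) = av s"
  by (simp add: av_def set_reg_def fun_eq_iff)

lemma rv_store: "rv (s\<lparr>mem := m\<rparr>) = rv s"
  by (auto simp: rv_def)

lemma av_store:
  assumes "c < 16" "0 \<le> i"
  shows "av (s\<lparr>mem := (mem s)(addr c i := x)\<rparr>) = (av s)(c := (av s c)(i := x))"
  using assms by (auto simp: av_def fun_eq_iff addr_inj)

lemma tripleI:
  assumes "\<And>s. fits W s \<Longrightarrow> rv s = \<rho> \<Longrightarrow> av s = \<mu> \<Longrightarrow>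
    \<exists>t s'. exec W p s t s' \<and> t \<le> k \<and> fits W s' \<and> Q (rv s') (av s')"
  shows "triple W p k \<rho> \<mu> Q"
  using assms unfolding triple_def by blast

lemma tripleD:
  assumes "triple W p k \<rho> \<mu> Q" "fits W s" "rv s = \<rho>" "av s = \<mu>"
  obtains t s' where "exec W p s t s'" "t \<le> k" "fits W s'" "Q (rv s') (av s')"
  using assms unfolding triple_def by blast

lemma triple_conseq:
  assumes "triple W p k \<rho> \<mu> Q" "\<And>\<rho>' \<mu>'. Q \<rho>' \<mu>' \<Longrightarrow> Q' \<rho>' \<mu>'" "k \<le> k'"
  shows "triple W p k' \<rho> \<mu> Q'"
proof (rule tripleI)
  fix s assume "fits W s" "rv s = \<rho>" "av s = \<mu>"
  with assms(1) obtain t s' where "exec W p s t s'" "t \<le> k" "fits W s'" "Q (rv s') (av s')"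
    by (rule tripleD)
  then show "\<exists>t s'. exec W p s t s' \<and> t \<le> k' \<and> fits W s' \<and> Q' (rv s') (av s')"
    using assms(2,3) le_trans by blast
qed

lemma triple_Seq:
  assumes "triple W p k \<rho> \<mu> R" "\<And>\<rho>' \<mu>'. R \<rho>' \<mu>' \<Longrightarrow> triple W q k' \<rho>' \<mu>' Q" "k + k' \<le> c"
  shows "triple W (Seq p q) c \<rho> \<mu> Q"
proof (rule tripleI)
  fix s assume "fits W s" "rv s = \<rho>" "av s = \<mu>"
  with assms(1) obtain t s1 where 1: "exec W p s t s1" "t \<le> k" "fits W s1" "R (rv s1) (av s1)"
    by (rule tripleD)
  from assms(2)[OF 1(4)] 1(3) refl refl obtain t' s2 where
    2: "exec W q s1 t' s2" "t' \<le> k'" "fits W s2" "Q (rv s2) (av s2)" by (rule tripleD)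
  have "t + t' \<le> c" using add_mono[OF 1(2) 2(2)] assms(3) by linarith
  then show "\<exists>t s'. exec W (Seq p q) s t s' \<and> t \<le> c \<and> fits W s' \<and> Q (rv s') (av s')"
    using exec.Seq[OF 1(1) 2(1)] 2(3,4) by blast
qed

section \<open>Assignments, branching and counting loops\<close>

datatype assign = Set nat exp | Put nat exp exp

fun compile_assign :: "assign \<Rightarrow> prog" where
  "compile_assign (Set v e) = Seq (compile e 50) (Instr (Op v Or 50 50))"
| "compile_assign (Put c a e) = Seq (compile a 50) (Seq (to_addr c 50)
     (Seq (compile e 51) (Instr (Store 50 51))))"

fun cost_assign :: "assign \<Rightarrow> nat" where
  "cost_assign (Set v e) = cost e + 1"
| "cost_assign (Put c a e) = cost a + cost e + 5"

definition block :: "assign list \<Rightarrow> prog" where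
  "block cs = foldr (\<lambda>c p. Seq (compile_assign c) p) cs Skip"

fun block_cost :: "assign list \<Rightarrow> nat" where
  "block_cost [] = 1"
| "block_cost (c # cs) = cost_assign c + block_cost cs"

fun wp :: "int \<Rightarrow> assign list \<Rightarrow> (nat \<Rightarrow> int) \<Rightarrow> (nat \<Rightarrow> int \<Rightarrow> int) \<Rightarrow>
    ((nat \<Rightarrow> int) \<Rightarrow> (nat \<Rightarrow> int \<Rightarrow> int) \<Rightarrow> bool) \<Rightarrow> bool" where
  "wp W [] \<rho> \<mu> Q \<longleftrightarrow> Q \<rho> \<mu>"
| "wp W (Set v e # cs) \<rho> \<mu> Q \<longleftrightarrow> v < 50 \<and> safe W \<rho> \<mu> e \<and> wp W cs (\<rho>(v := ev \<rho> \<mu> e)) \<mu> Q"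
| "wp W (Put c a e # cs) \<rho> \<mu> Q \<longleftrightarrow> safe W \<rho> \<mu> (Arr c a) \<and> safe W \<rho> \<mu> e \<and>
     wp W cs \<rho> (\<mu>(c := (\<mu> c)(ev \<rho> \<mu> a := ev \<rho> \<mu> e))) Q"

lemma triple_Set:
  assumes "v < 50" "safe W \<rho> \<mu> e" "1 \<le> W"
  shows "triple W (compile_assign (Set v e)) (cost_assign (Set v e)) \<rho> \<mu>
    (\<lambda>\<rho>' \<mu>'. \<rho>' = \<rho>(v := ev \<rho> \<mu> e) \<and> \<mu>' = \<mu>)"
  proof (rule tripleI)
  fix s assume s: "fits W s" "rv s = \<rho>" "av s = \<mu>"
  from compile_correct[of W s e 50] s assms obtain n s1 where 1: "exec W (compile e 50) s n s1"
    "n \<le> cost e" "fits W s1" "keeps 50 s s1" "regs s1 50 = ev \<rho> \<mu> e" by auto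
  have b: "\<bar>ev \<rho> \<mu> e\<bar> \<le> W" using 1(3) unfolding 1(5)[symmetric] by (simp add: fits_def)
  have e: "exec W (Instr (Op v Or 50 50)) s1 1 (set_reg v (ev \<rho> \<mu> e) s1)"
    using 1(3,5) b by (intro exec_set) auto
  note v = keeps_views[OF 1(4)]
  have "rv (set_reg v (ev \<rho> \<mu> e) s1) = \<rho>(v := ev \<rho> \<mu> e)"
    using v(1) s(2) assms(1) by (simp add: rv_set_reg)
  moreover have "av (set_reg v (ev \<rho> \<mu> e) s1) = \<mu>"
    using v(2) s(3) by (simp add: av_set_reg)
  ultimately show "\<exists>t s'. exec W (compile_assign (Set v e)) s t s' \<and> t \<le> cost_assign (Set v e) \<and>
      fits W s' \<and> rv s' = \<rho>(v := ev \<rho> \<mu> e) \<and> av s' = \<mu>"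
    using exec.Seq[OF 1(1) e] fits_set_reg[OF 1(3) b, of v] 1(2)
    by (intro exI[of _ "n + 1"] exI[of _ "set_reg v (ev \<rho> \<mu> e) s1"]) auto
qed

lemma triple_Put:
  assumes "safe W \<rho> \<mu> (Arr c a)" "safe W \<rho> \<mu> e" "1 \<le> W"
  shows "triple W (compile_assign (Put c a e)) (cost_assign (Put c a e)) \<rho> \<mu>
    (\<lambda>\<rho>' \<mu>'. \<rho>' = \<rho> \<and> \<mu>' = \<mu>(c := (\<mu> c)(ev \<rho> \<mu> a := ev \<rho> \<mu> e)))"
  proof (rule tripleI)
  fix s assume s: "fits W s" "rv s = \<rho>" "av s = \<mu>"
  let ?i = "ev \<rho> \<mu> a" and ?v = "ev \<rho> \<mu> e"
  from compile_correct[of W s a 50] s assms obtain n1 s1 where 1: "exec W (compile a 50) s n1 s1"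
    "n1 \<le> cost a" "fits W s1" "keeps 50 s s1" "regs s1 50 = ?i" by auto
  from to_addr_correct[of W s1 c 50] 1 assms obtain n2 s2 where
    2: "exec W (to_addr c 50) s1 n2 s2" "n2 \<le> 4" "fits W s2" "keeps 50 s1 s2"
    "regs s2 50 = addr c ?i" by auto
  note k2 = keeps_trans[OF 1(4) 2(4) order_refl]
  note v2 = keeps_views[OF k2 order_refl]
  \<comment> \<open>Register 50 keeps the address while the value is computed in registers from 51
    on.\<close>
  from compile_correct[of W s2 e 51] 2(3) v2 s assms obtain n3 s3 where 3: "exec W (compile e 51) s2 n3 s3"
    "n3 \<le> cost e" "fits W s3" "keeps 51 s2 s3" "regs s3 51 = ?v" by auto
  have k3: "keeps 50 s s3" using k2 3(4) by (rule keeps_trans) simp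
  note v3 = keeps_views[OF k3 order_refl]
  have a: "regs s3 50 = addr c ?i" using 3(4) 2(5) by (simp add: keeps_def)
  have b: "\<bar>?v\<bar> \<le> W" using 3(3) unfolding 3(5)[symmetric] by (simp add: fits_def)
  define s4 where "s4 = s3\<lparr>mem := (mem s3)(addr c ?i := ?v)\<rparr>"
  have f4: "fits W s4" using 3(3) b by (auto simp: s4_def fits_def)
  have r: "run_instr (Store 50 51) s3 = s4" by (simp add: s4_def a 3(5))
  have e: "exec W (Instr (Store 50 51)) s3 1 s4"
    using exec.Instr[of W "Store 50 51" s3] f4 unfolding r by blast
  have "rv s4 = \<rho>" using v3(1) s(2) by (simp add: s4_def rv_store)
  moreover have "av s4 = \<mu>(c := (\<mu> c)(?i := ?v))"
    using assms(1) v3(2) s(3) by (simp add: s4_def av_store)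
  ultimately show "\<exists>t s'. exec W (compile_assign (Put c a e)) s t s' \<and> t \<le> cost_assign (Put c a e) \<and>
      fits W s' \<and> rv s' = \<rho> \<and> av s' = \<mu>(c := (\<mu> c)(?i := ?v))"
    using exec.Seq[OF 1(1) exec.Seq[OF 2(1) exec.Seq[OF 3(1) e]]] f4 1(2) 2(2) 3(2)
    by (intro exI[of _ "n1 + (n2 + (n3 + 1))"] exI[of _ s4]) auto
qed

lemma triple_block:
  assumes "wp W cs \<rho> \<mu> Q" "1 \<le> W" "block_cost cs \<le> k"
  shows "triple W (block cs) k \<rho> \<mu> Q"
  using assms
proof (induction cs arbitrary: \<rho> \<mu> k)
  case Nil
  then show ?case
    unfolding block_def triple_def by (auto intro!: exI[of _ 1] exec.Skip)
next
  case (Cons c cs)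
  have k: "cost_assign c + (k - cost_assign c) \<le> k" "block_cost cs \<le> k - cost_assign c"
    using Cons.prems(3) by simp_all
  show ?case
  proof (cases c)
    case (Set v e)
    have "triple W (Seq (compile_assign (Set v e)) (block cs)) k \<rho> \<mu> Q"
      by (rule triple_Seq, rule triple_Set) (use Cons Set k in auto)
    then show ?thesis by (simp add: Set block_def)
  next
    case (Put d a e)
    have "triple W (Seq (compile_assign (Put d a e)) (block cs)) k \<rho> \<mu> Q"
      by (rule triple_Seq, rule triple_Put) (use Cons Put k in auto)
    then show ?thesis by (simp add: Put block_def)
  qed
qed

definition IfLt :: "exp \<Rightarrow> exp \<Rightarrow> prog \<Rightarrow> prog \<Rightarrow> prog" where
  "IfLt a b p q = Seq (compile a 50) (Seq (compile b 51) (If (Less 50 51) p q))"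

lemma triple_IfLt:
  assumes "safe W \<rho> \<mu> a" "safe W \<rho> \<mu> b" "1 \<le> W"
    and "ev \<rho> \<mu> a < ev \<rho> \<mu> b \<Longrightarrow> triple W p k \<rho> \<mu> Q"
    and "\<not> ev \<rho> \<mu> a < ev \<rho> \<mu> b \<Longrightarrow> triple W q k \<rho> \<mu> Q"
  shows "triple W (IfLt a b p q) (k + cost a + cost b + 1) \<rho> \<mu> Q"
  proof (rule tripleI)
  fix s assume s: "fits W s" "rv s = \<rho>" "av s = \<mu>"
  from compile_correct[of W s a 50] s assms obtain n1 s1 where 1: "exec W (compile a 50) s n1 s1"
    "n1 \<le> cost a" "fits W s1" "keeps 50 s s1" "regs s1 50 = ev \<rho> \<mu> a" by auto
  note v1 = keeps_views[OF 1(4) order_refl]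
  from compile_correct[of W s1 b 51] 1(3) v1 s assms obtain n2 s2 where 2: "exec W (compile b 51) s1 n2 s2"
    "n2 \<le> cost b" "fits W s2" "keeps 51 s1 s2" "regs s2 51 = ev \<rho> \<mu> b" by auto
  have k: "keeps 50 s s2" using 1(4) 2(4) by (rule keeps_trans) simp
  note v2 = keeps_views[OF k order_refl]
  have r: "regs s2 50 = ev \<rho> \<mu> a" using 1(5) 2(4) by (simp add: keeps_def)
  have "\<exists>t s'. exec W (If (Less 50 51) p q) s2 (Suc t) s' \<and> t \<le> k \<and> fits W s' \<and> Q (rv s') (av s')"
  proof (cases "ev \<rho> \<mu> a < ev \<rho> \<mu> b")
    case True
    from assms(4)[OF True] 2(3) obtain t s' where "exec W p s2 t s'" "t \<le> k" "fits W s'" "Q (rv s') (av s')"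
      by (rule tripleD) (use v2 s in auto)
    with exec.IfTrue[of "Less 50 51" s2 W p t s' q] True r 2(5) show ?thesis by auto
  next
    case False
    from assms(5)[OF False] 2(3) obtain t s' where "exec W q s2 t s'" "t \<le> k" "fits W s'" "Q (rv s') (av s')"
      by (rule tripleD) (use v2 s in auto)
    with exec.IfFalse[of "Less 50 51" s2 W q t s' p] False r 2(5) show ?thesis by auto
  qed
  then obtain t s' where t: "exec W (If (Less 50 51) p q) s2 (Suc t) s'" "t \<le> k" "fits W s'"
    "Q (rv s') (av s')" by blast
  from exec.Seq[OF 1(1) exec.Seq[OF 2(1) t(1)]] t(2-4) 1(2) 2(2)
  show "\<exists>t s'. exec W (IfLt a b p q) s t s' \<and> t \<le> k + cost a + cost b + 1 \<and> fits W s' \<and> Q (rv s') (av s')"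
    unfolding IfLt_def by (intro exI[of _ "n1 + (n2 + Suc t)"] exI[of _ s']) auto
qed

abbreviation (input) agree :: "nat set \<Rightarrow> (nat \<Rightarrow> int) \<Rightarrow> (nat \<Rightarrow> int) \<Rightarrow> bool" where
  "agree R \<rho>' \<rho> \<equiv> \<forall>r. r \<notin> R \<longrightarrow> \<rho>' r = \<rho> r"

text \<open>The loop advances the counter only after the body. The body thus owes the invariant for
  \<open>k + 1\<close> in the store where the counter already has that value, and it must leave
  counter and limit alone.\<close>

abbreviation (input) step_post ::
  "nat \<Rightarrow> nat \<Rightarrow> int \<Rightarrow> int \<Rightarrow> (int \<Rightarrow> (nat \<Rightarrow> int) \<Rightarrow> (nat \<Rightarrow> int \<Rightarrow> int) \<Rightarrow> bool) \<Rightarrow>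
    (nat \<Rightarrow> int) \<Rightarrow> (nat \<Rightarrow> int \<Rightarrow> int) \<Rightarrow> bool" where
  "step_post v u k N I \<equiv> \<lambda>\<rho> \<mu>. \<rho> v = k \<and> \<rho> u = N \<and> I (k + 1) (\<rho>(v := k + 1)) \<mu>"

definition For :: "nat \<Rightarrow> nat \<Rightarrow> exp \<Rightarrow> prog \<Rightarrow> prog" where
  "For v u e p = Seq (block [Set u e, Set v (Num 0)])
     (While (Less v u) (Seq p (block [Set v (Var v \<boxplus> Num 1)])))"

lemma triple_While_counter:
  assumes v: "v < 50" "u < 50" and W: "1 \<le> W"
    and body: "\<And>k \<rho> \<mu>. 0 \<le> k \<Longrightarrow> k < N \<Longrightarrow> \<rho> v = k \<Longrightarrow> \<rho> u = N \<Longrightarrow> I k \<rho> \<mu> \<Longrightarrow>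
      triple W p c \<rho> \<mu> (step_post v u k N I)"
    and uv: "u \<noteq> v"
    and s: "fits W s" "I k (rv s) (av s)" "0 \<le> k" "k \<le> N" "rv s v = k" "rv s u = N"
  shows "\<exists>t s'. exec W (While (Less v u) (Seq p (block [Set v (Var v \<boxplus> Num 1)]))) s t s' \<and>
      t \<le> nat (N - k) * (c + 6) + 1 \<and> fits W s' \<and> I N (rv s') (av s') \<and> rv s' v = N \<and> rv s' u = N"
  using s
proof (induction "nat (N - k)" arbitrary: s k)
  case 0
  then have "\<not> holds (Less v u) s" using v by (simp add: rv_def)
  from exec.WhileFalse[OF this] 0 show ?case
    by (intro exI[of _ 1] exI[of _ s]) auto
next
  case (Suc x)
  then have h: "holds (Less v u) s" using v by (simp add: rv_def)
  have kN: "k < N" using Suc by simp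
  have "triple W p c (rv s) (av s)
      (step_post v u k N I)"
    by (rule body) (use Suc.prems kN in auto)
  from this Suc.prems(1) refl refl obtain t1 s1 where 1: "exec W p s t1 s1" "t1 \<le> c" "fits W s1"
    "rv s1 v = k" "rv s1 u = N" "I (k + 1) ((rv s1)(v := k + 1)) (av s1)"
    by (rule tripleD) blast
  \<comment> \<open>The limit is the content of a register, hence a word, and \<open>k + 1\<close>
    does not exceed it: the increment cannot overflow.\<close>
  have NW: "N \<le> W" using 1(3,5) v unfolding fits_def rv_def by (metis abs_le_D1)
  have "triple W (block [Set v (Var v \<boxplus> Num 1)]) 5 (rv s1) (av s1)
      (\<lambda>\<rho>' \<mu>'. \<rho>' = (rv s1)(v := k + 1) \<and> \<mu>' = av s1)"
    by (rule triple_block) (use v W 1(4) Suc.prems kN NW in auto)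
  from this 1(3) refl refl obtain t2 s2 where 2: "exec W (block [Set v (Var v \<boxplus> Num 1)]) s1 t2 s2" "t2 \<le> 5" "fits W s2"
    "rv s2 = (rv s1)(v := k + 1)" "av s2 = av s1"
    by (rule tripleD) blast
  have "\<exists>t s'. exec W (While (Less v u) (Seq p (block [Set v (Var v \<boxplus> Num 1)]))) s2 t s' \<and>
      t \<le> nat (N - (k + 1)) * (c + 6) + 1 \<and> fits W s' \<and> I N (rv s') (av s') \<and> rv s' v = N \<and> rv s' u = N"
    by (rule Suc.hyps(1)) (use Suc.hyps(2) Suc.prems 1 2 kN uv in auto)
  then obtain t3 s3 where 3: "exec W (While (Less v u) (Seq p (block [Set v (Var v \<boxplus> Num 1)]))) s2 t3 s3"
    "t3 \<le> nat (N - (k + 1)) * (c + 6) + 1" "fits W s3" "I N (rv s3) (av s3)" "rv s3 v = N" "rv s3 u = N"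
    by blast
  have "nat (N - k) = Suc (nat (N - (k + 1)))" using kN by simp
  with exec.WhileTrue[OF h exec.Seq[OF 1(1) 2(1)] 3(1)] 1(2) 2(2) 3(2-6) show ?case
    by (intro exI[of _ "Suc (t1 + t2 + t3)"] exI[of _ s3]) auto
qed

text \<open>Each iteration costs 6 steps beyond its body: 5 for the increment and 1 for the
  test.\<close>

lemma triple_For:
  assumes e: "safe W \<rho> \<mu> e" "ev \<rho> \<mu> e = N" "0 \<le> N"
    and v: "v < 50" "u < 50" "u \<noteq> v" and W: "1 \<le> W"
    and init: "I 0 (\<rho>(u := N, v := 0)) \<mu>"
    and body: "\<And>k \<rho>' \<mu>'. 0 \<le> k \<Longrightarrow> k < N \<Longrightarrow> \<rho>' v = k \<Longrightarrow> \<rho>' u = N \<Longrightarrow> I k \<rho>' \<mu>' \<Longrightarrow>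
      triple W p c \<rho>' \<mu>' (step_post v u k N I)"
    and final: "\<And>\<rho>' \<mu>'. I N \<rho>' \<mu>' \<Longrightarrow> \<rho>' v = N \<Longrightarrow> \<rho>' u = N \<Longrightarrow> Q \<rho>' \<mu>'"
    and k: "nat N * (c + 6) + cost e + 5 \<le> k"
  shows "triple W (For v u e p) k \<rho> \<mu> Q"
  unfolding For_def
proof (rule triple_Seq)
  show "triple W (block [Set u e, Set v (Num 0)]) (cost e + 4) \<rho> \<mu>
      (\<lambda>\<rho>' \<mu>'. \<rho>' = \<rho>(u := N, v := 0) \<and> \<mu>' = \<mu>)"
    by (rule triple_block) (use e v W in auto)
next
  fix \<rho>' \<mu>' assume "\<rho>' = \<rho>(u := N, v := 0) \<and> \<mu>' = \<mu>"
  then have *: "\<rho>' v = 0" "\<rho>' u = N" "I 0 \<rho>' \<mu>'" using v init by auto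
  show "triple W (While (Less v u) (Seq p (block [Set v (Var v \<boxplus> Num 1)])))
      (nat N * (c + 6) + 1) \<rho>' \<mu>' Q"
    proof (rule tripleI)
    fix s assume s: "fits W s" "rv s = \<rho>'" "av s = \<mu>'"
    have "\<exists>t s'. exec W (While (Less v u) (Seq p (block [Set v (Var v \<boxplus> Num 1)]))) s t s' \<and>
        t \<le> nat (N - 0) * (c + 6) + 1 \<and> fits W s' \<and> I N (rv s') (av s') \<and> rv s' v = N \<and> rv s' u = N"
      by (rule triple_While_counter[where I=I]) (fact | use s * v e W in simp | erule (4) body)+
    then obtain t s' where "exec W (While (Less v u) (Seq p (block [Set v (Var v \<boxplus> Num 1)]))) s t s'"
      "t \<le> nat N * (c + 6) + 1" "fits W s'" "I N (rv s') (av s')" "rv s' v = N" "rv s' u = N"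
      by auto
    then show "\<exists>t s'. exec W (While (Less v u) (Seq p (block [Set v (Var v \<boxplus> Num 1)]))) s t s' \<and>
        t \<le> nat N * (c + 6) + 1 \<and> fits W s' \<and> Q (rv s') (av s')"
      using final by blast
  qed
qed (use k in auto)

section \<open>Running a program as a subroutine\<close>

text \<open>A subroutine works in a window of the memory centred at the address in register 7, and on
  the registers from 51 on.\<close>

fun relocate_test :: "test \<Rightarrow> test" where
  "relocate_test (Less a b) = Less (a + 51) (b + 51)"
| "relocate_test (Equal a b) = Equal (a + 51) (b + 51)"

fun relocate :: "prog \<Rightarrow> prog" where
  "relocate Skip = Skip"
| "relocate (Instr (Const r v)) = Instr (Const (r + 51) v)"
| "relocate (Instr (Op r f a b)) = Instr (Op (r + 51) f (a + 51) (b + 51))"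
| "relocate (Instr (Load r a)) = Seq (Instr (Op 50 Add 7 (a + 51))) (Instr (Load (r + 51) 50))"
| "relocate (Instr (Store a r)) = Seq (Instr (Op 50 Add 7 (a + 51))) (Instr (Store 50 (r + 51)))"
| "relocate (Seq p q) = Seq (relocate p) (relocate q)"
| "relocate (If b p q) = If (relocate_test b) (relocate p) (relocate q)"
| "relocate (While b p) = While (relocate_test b) (relocate p)"

fun test_regs :: "test \<Rightarrow> reg set" where
  "test_regs (Less a b) = {a, b}"
| "test_regs (Equal a b) = {a, b}"

fun instr_regs :: "instr \<Rightarrow> reg set" where
  "instr_regs (Const r v) = {r}"
| "instr_regs (Op r f a b) = {r, a, b}"
| "instr_regs (Load r a) = {r, a}"
| "instr_regs (Store a r) = {a, r}"

fun prog_regs :: "prog \<Rightarrow> reg set" where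
  "prog_regs Skip = {}"
| "prog_regs (Instr i) = instr_regs i"
| "prog_regs (Seq p q) = prog_regs p \<union> prog_regs q"
| "prog_regs (If b p q) = test_regs b \<union> prog_regs p \<union> prog_regs q"
| "prog_regs (While b p) = test_regs b \<union> prog_regs p"

lemma finite_prog_regs: "finite (prog_regs p)"
proof (induction p)
  case (Instr i) then show ?case by (cases i) auto
next
  case (If b p q) then show ?case by (cases b) auto
next
  case (While b p) then show ?case by (cases b) auto
qed auto

lemma exec_fits: "exec W p s t s' \<Longrightarrow> fits W s \<Longrightarrow> fits W s'"
  by (induction rule: exec.induct) auto

lemma fits_mono: "fits W s \<Longrightarrow> W \<le> W' \<Longrightarrow> fits W' s"
  unfolding fits_def by (meson order_trans)

text \<open>The word bound only forbids overflow, so a run survives in longer words. Solver runs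
  whose bounds vary with the instance can therefore share one bound \<open>V\<close>.\<close>

lemma exec_mono: "exec W p s t s' \<Longrightarrow> W \<le> W' \<Longrightarrow> exec W' p s t s'"
  by (induction rule: exec.induct) (auto intro: exec.intros[unfolded One_nat_def] fits_mono)

text \<open>One step stores to at most one cell. This turns the number of output cells that differ
  from the input into a lower bound on running time.\<close>

lemma exec_changed:
  "exec W p s t s' \<Longrightarrow> finite {a. mem s a \<noteq> mem s' a} \<and> card {a. mem s a \<noteq> mem s' a} \<le> t"
proof (induction rule: exec.induct)
  case (Instr i s)
  show ?case
  proof (cases i)
    case (Store a r)
    have "{b. mem s b \<noteq> mem (run_instr i s) b} \<subseteq> {regs s a}" unfolding Store by auto
    then show ?thesis using card_mono[of "{regs s a}"] finite_subset by fastforce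
  qed (simp_all add: set_reg_def)
next
  case (Seq p s t s' q t' s'')
  let ?A = "{a. mem s a \<noteq> mem s' a}" and ?B = "{a. mem s' a \<noteq> mem s'' a}"
  have "{a. mem s a \<noteq> mem s'' a} \<subseteq> ?A \<union> ?B" by auto
  moreover have "card (?A \<union> ?B) \<le> t + t'" using Seq.IH card_Un_le[of ?A ?B] by linarith
  ultimately show ?case using Seq.IH by (meson card_mono finite_UnI finite_subset order_trans)
next
  case (WhileTrue b s p t s' t' s'')
  let ?A = "{a. mem s a \<noteq> mem s' a}" and ?B = "{a. mem s' a \<noteq> mem s'' a}"
  have "{a. mem s a \<noteq> mem s'' a} \<subseteq> ?A \<union> ?B" by auto
  moreover have "card (?A \<union> ?B) \<le> Suc (t + t')" using WhileTrue.IH card_Un_le[of ?A ?B] by linarith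
  ultimately show ?case using WhileTrue.IH by (meson card_mono finite_UnI finite_subset order_trans)
qed auto

text \<open>Only registers below \<open>R\<close>, a bound on those the program mentions, are
  matched: finitely many can be reset to 0 before a call, and the copies of the others may hold
  anything.\<close>

definition simulates :: "nat \<Rightarrow> int \<Rightarrow> int \<Rightarrow> state \<Rightarrow> state \<Rightarrow> bool" where
  "simulates R V z s s' \<longleftrightarrow> (\<forall>r < R. regs s' (r + 51) = regs s r) \<and>
     (\<forall>a. \<bar>a\<bar> \<le> V \<longrightarrow> mem s' (z + a) = mem s a) \<and> regs s' 7 = z"

definition frame :: "int \<Rightarrow> int \<Rightarrow> state \<Rightarrow> state \<Rightarrow> bool" where
  "frame V z s s' \<longleftrightarrow> (\<forall>r < 50. regs s' r = regs s r) \<and> (\<forall>a. V < \<bar>a - z\<bar> \<longrightarrow> mem s' a = mem s a)"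

lemma frame_trans: "frame V z s s' \<Longrightarrow> frame V z s' s'' \<Longrightarrow> frame V z s s''"
  by (auto simp: frame_def)

lemma holds_relocate:
  assumes "simulates R V z s s'" "test_regs b \<subseteq> {..<R}"
  shows "holds (relocate_test b) s' \<longleftrightarrow> holds b s"
  using assms by (cases b) (auto simp: simulates_def)

text \<open>Every address the solver uses is the content of one of its registers, hence at most
  \<open>V\<close> in absolute value. The shifted access stays in the window, so nothing outside
  changes; shifting costs one more step per memory access, hence the 2.\<close>

lemma relocate_instr_correct:
  assumes "fits V (run_instr i s)" "fits V s" "fits W s'" "simulates R V z s s'"
    "instr_regs i \<subseteq> {..<R}" "\<bar>z\<bar> + V \<le> W"
  shows "\<exists>t s''. exec W (relocate (Instr i)) s' t s'' \<and> t \<le> 2 \<and> fits W s'' \<and>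
    simulates R V z (run_instr i s) s'' \<and> frame V z s' s''"
proof -
  have V: "\<And>r. \<bar>regs s r\<bar> \<le> V" "\<And>a. \<bar>mem s a\<bar> \<le> V" using assms(2) by (auto simp: fits_def)
  have sim: "\<And>r. r < R \<Longrightarrow> regs s' (r + 51) = regs s r"
    "\<And>a. \<bar>a\<bar> \<le> V \<Longrightarrow> mem s' (z + a) = mem s a" "regs s' 7 = z"
    using assms(4) by (auto simp: simulates_def)
  have VW: "V \<le> W" using assms(6) by linarith
  show ?thesis
  proof (cases i)
    case (Const r v)
    have v: "\<bar>v\<bar> \<le> W" using assms(1) VW unfolding Const
      by (auto simp: fits_def set_reg_def split: if_splits intro: order_trans)
    have "exec W (relocate (Instr i)) s' 1 (set_reg (r + 51) v s')"
      unfolding Const relocate.simps by (rule exec_set) (use assms v in auto)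
    then show ?thesis using fits_set_reg[OF assms(3) v, of "r + 51"] sim unfolding Const
      by (intro exI[of _ 1] exI[of _ "set_reg (r + 51) v s'"])
        (auto simp: simulates_def frame_def set_reg_def)
  next
    case (Op r f a b)
    let ?v = "apply_binop f (regs s a) (regs s b)"
    have v: "\<bar>?v\<bar> \<le> W" using assms(1) VW unfolding Op
      by (auto simp: fits_def set_reg_def split: if_splits intro: order_trans)
    have ab: "regs s' (a + 51) = regs s a" "regs s' (b + 51) = regs s b"
      using sim(1) assms(5) unfolding Op by auto
    have "exec W (relocate (Instr i)) s' 1 (set_reg (r + 51) ?v s')"
      unfolding Op relocate.simps by (rule exec_set) (use assms v ab in auto)
    then show ?thesis using fits_set_reg[OF assms(3) v, of "r + 51"] sim unfolding Op
      by (intro exI[of _ 1] exI[of _ "set_reg (r + 51) ?v s'"])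
        (auto simp: simulates_def frame_def set_reg_def)
  next
    case (Load r a)
    let ?x = "z + regs s a"
    define s1 where "s1 = set_reg 50 ?x s'"
    let ?v = "mem s (regs s a)"
    have a: "regs s' (a + 51) = regs s a" using sim(1) assms(5) unfolding Load by auto
    have x: "\<bar>?x\<bar> \<le> W" using V(1)[of a] assms(6) by linarith
    have v: "\<bar>?v\<bar> \<le> W" using V(2) VW order_trans by blast
    have e1: "exec W (Instr (Op 50 Add 7 (a + 51))) s' 1 s1"
      unfolding s1_def by (rule exec_set) (use assms x a sim(3) in auto)
    have f1: "fits W s1" unfolding s1_def by (rule fits_set_reg[OF assms(3) x])
    have m: "mem s' ?x = ?v" using sim(2) V(1) by blast
    have e2: "exec W (Instr (Load (r + 51) 50)) s1 1 (set_reg (r + 51) ?v s1)"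
      by (rule exec_set) (use f1 v m in \<open>auto simp: s1_def set_reg_def\<close>)
    show ?thesis using exec.Seq[OF e1 e2] fits_set_reg[OF f1 v, of "r + 51"] sim unfolding Load
      by (intro exI[of _ "1 + 1"] exI[of _ "set_reg (r + 51) ?v s1"])
        (auto simp: simulates_def frame_def set_reg_def s1_def)
  next
    case (Store a r)
    let ?x = "z + regs s a"
    define s1 where "s1 = set_reg 50 ?x s'"
    let ?v = "regs s r"
    have a: "regs s' (a + 51) = regs s a" "regs s' (r + 51) = regs s r"
      using sim(1) assms(5) unfolding Store by auto
    have x: "\<bar>?x\<bar> \<le> W" using V(1)[of a] assms(6) by linarith
    have v: "\<bar>?v\<bar> \<le> W" using V(1) VW order_trans by blast
    have e1: "exec W (Instr (Op 50 Add 7 (a + 51))) s' 1 s1"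
      unfolding s1_def by (rule exec_set) (use assms x a sim(3) in auto)
    have f1: "fits W s1" unfolding s1_def by (rule fits_set_reg[OF assms(3) x])
    define s2 where "s2 = s1\<lparr>mem := (mem s1)(?x := ?v)\<rparr>"
    have f2: "fits W s2" using f1 v by (auto simp: s2_def fits_def)
    have r: "run_instr (Store 50 (r + 51)) s1 = s2" using a(2) by (simp add: s2_def s1_def set_reg_def)
    have e2: "exec W (Instr (Store 50 (r + 51))) s1 1 s2"
      using exec.Instr[of W "Store 50 (r + 51)" s1] f2 unfolding r by blast
    show ?thesis using exec.Seq[OF e1 e2] f2 sim V(1)[of a] unfolding Store
      by (intro exI[of _ "1 + 1"] exI[of _ s2])
        (auto simp: simulates_def frame_def set_reg_def s1_def s2_def)
  qed
qed

lemma relocate_correct: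
  assumes "exec V p s t s1" "fits V s" "fits W s'" "simulates R V z s s'"
    "prog_regs p \<subseteq> {..<R}" "\<bar>z\<bar> + V \<le> W"
  shows "\<exists>u s1'. exec W (relocate p) s' u s1' \<and> u \<le> 2 * t \<and> fits W s1' \<and>
    simulates R V z s1 s1' \<and> frame V z s' s1'"
  using assms
proof (induction arbitrary: s' rule: exec.induct)
  case (Skip s)
  then show ?case by (auto simp: frame_def intro!: exI[of _ 1] exI[of _ s'] exec.Skip)
next
  case (Instr i s)
  then show ?case using relocate_instr_correct[of V i s W s' R z] by simp
next
  case (Seq p s t s2 q t' s3)
  obtain u1 s2' where 1: "exec W (relocate p) s' u1 s2'" "u1 \<le> 2 * t" "fits W s2'"
    "simulates R V z s2 s2'" "frame V z s' s2'"
    using Seq.IH(1)[of s'] Seq.prems by auto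
  obtain u2 s3' where 2: "exec W (relocate q) s2' u2 s3'" "u2 \<le> 2 * t'" "fits W s3'"
    "simulates R V z s3 s3'" "frame V z s2' s3'"
    using Seq.IH(2)[of s2'] Seq.prems 1(3,4) exec_fits[OF Seq.hyps(1)] by auto
  show ?case using exec.Seq[OF 1(1) 2(1)] 1(2) 2 frame_trans[OF 1(5) 2(5)]
    by (intro exI[of _ "u1 + u2"] exI[of _ s3']) auto
next
  case (IfTrue b s p t s2 q)
  obtain u1 s2' where 1: "exec W (relocate p) s' u1 s2'" "u1 \<le> 2 * t" "fits W s2'"
    "simulates R V z s2 s2'" "frame V z s' s2'"
    using IfTrue.IH[of s'] IfTrue.prems by auto
  have "holds (relocate_test b) s'" using holds_relocate[OF IfTrue.prems(3)] IfTrue by auto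
  from exec.IfTrue[OF this 1(1), of "relocate q"] 1 show ?case
    by (intro exI[of _ "Suc u1"] exI[of _ s2']) auto
next
  case (IfFalse b s q t s2 p)
  obtain u1 s2' where 1: "exec W (relocate q) s' u1 s2'" "u1 \<le> 2 * t" "fits W s2'"
    "simulates R V z s2 s2'" "frame V z s' s2'"
    using IfFalse.IH[of s'] IfFalse.prems by auto
  have "\<not> holds (relocate_test b) s'" using holds_relocate[OF IfFalse.prems(3)] IfFalse by auto
  from exec.IfFalse[OF this 1(1), of "relocate p"] 1 show ?case
    by (intro exI[of _ "Suc u1"] exI[of _ s2']) auto
next
  case (WhileFalse b s p)
  have "\<not> holds (relocate_test b) s'" using holds_relocate[OF WhileFalse.prems(3)] WhileFalse by auto
  from exec.WhileFalse[OF this] WhileFalse.prems show ?case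
    by (intro exI[of _ 1] exI[of _ s']) (auto simp: frame_def)
next
  case (WhileTrue b s p t s2 t' s3)
  obtain u1 s2' where 1: "exec W (relocate p) s' u1 s2'" "u1 \<le> 2 * t" "fits W s2'"
    "simulates R V z s2 s2'" "frame V z s' s2'"
    using WhileTrue.IH(1)[of s'] WhileTrue.prems by auto
  obtain u2 s3' where 2: "exec W (relocate (While b p)) s2' u2 s3'" "u2 \<le> 2 * t'" "fits W s3'"
    "simulates R V z s3 s3'" "frame V z s2' s3'"
    using WhileTrue.IH(2)[of s2'] WhileTrue.prems 1(3,4) exec_fits[OF WhileTrue.hyps(2)] by auto
  have "holds (relocate_test b) s'" using holds_relocate[OF WhileTrue.prems(3)] WhileTrue by auto
  from exec.WhileTrue[OF this 1(1)] 2(1) have "exec W (relocate (While b p)) s' (Suc (u1 + u2)) s3'"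
    by simp
  then show ?case using 1(2) 2 frame_trans[OF 1(5) 2(5)]
    by (intro exI[of _ "Suc (u1 + u2)"] exI[of _ s3']) auto
qed

text \<open>Evaluating expressions and earlier calls leave values in the registers from 51 on,
  whereas a solver run starts with all registers 0.\<close>

fun clear_regs :: "nat \<Rightarrow> prog" where
  "clear_regs 0 = Skip"
| "clear_regs (Suc r) = Seq (clear_regs r) (Instr (Const (r + 51) 0))"

lemma clear_regs_correct:
  assumes "fits W s"
  shows "\<exists>s'. exec W (clear_regs R) s (R + 1) s' \<and> fits W s' \<and> mem s' = mem s \<and>
    (\<forall>r < 50. regs s' r = regs s r) \<and> (\<forall>r < R. regs s' (r + 51) = 0)"
  using assms
proof (induction R)
  case 0
  then show ?case using exec.Skip[of W s] by auto
next
  case (Suc R)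
  then obtain s' where 1: "exec W (clear_regs R) s (R + 1) s'" "fits W s'" "mem s' = mem s"
    "\<forall>r < 50. regs s' r = regs s r" "\<forall>r < R. regs s' (r + 51) = 0" by blast
  have e: "exec W (Instr (Const (R + 51) 0)) s' 1 (set_reg (R + 51) 0 s')"
    using 1(2) fits_nonneg[OF 1(2)] by (intro exec_set) auto
  have "fits W (set_reg (R + 51) 0 s')" using 1(2) fits_nonneg[OF 1(2)] by (intro fits_set_reg) auto
  then show ?case using exec.Seq[OF 1(1) e] 1
    by (intro exI[of _ "set_reg (R + 51) 0 s'"]) (auto simp: set_reg_def less_Suc_eq)
qed

definition call :: "nat \<Rightarrow> prog \<Rightarrow> prog" where
  "call R p = Seq (clear_regs R) (relocate p)"

text \<open>\<open>V \<le> z\<close> puts the whole window in nonnegative addresses, which keeps the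
  arrays 1 to 15 out of it. The last hypothesis covers the entire window: around the instance it
  must contain the zeros of a fresh memory.\<close>

lemma triple_call:
  assumes p: "exec V p (initial_state xs) t s1" "fits V (initial_state xs)" "prog_regs p \<subseteq> {..<R}"
    and z: "\<rho> 7 = z" "V \<le> z" "z + V \<le> W"
    and input: "\<And>a. \<bar>a\<bar> \<le> V \<Longrightarrow> \<mu> 0 (z + a) = mem (initial_state xs) a"
  shows "triple W (call R p) (R + 1 + 2 * t) \<rho> \<mu> (\<lambda>\<rho>' \<mu>'. \<rho>' = \<rho> \<and> (\<forall>c. c \<noteq> 0 \<longrightarrow> \<mu>' c = \<mu> c) \<and>
    (\<forall>a. V < \<bar>a - z\<bar> \<longrightarrow> \<mu>' 0 a = \<mu> 0 a) \<and> (\<forall>a. \<bar>a\<bar> \<le> V \<longrightarrow> \<mu>' 0 (z + a) = mem s1 a))"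
proof (rule tripleI)
  fix s assume s: "fits W s" "rv s = \<rho>" "av s = \<mu>"
  from clear_regs_correct[OF s(1), of R] obtain s2 where 2: "exec W (clear_regs R) s (R + 1) s2"
    "fits W s2" "mem s2 = mem s" "\<forall>r < 50. regs s2 r = regs s r" "\<forall>r < R. regs s2 (r + 51) = 0"
    by blast
  have m: "mem s (z + a) = mem (initial_state xs) a" if "\<bar>a\<bar> \<le> V" for a
  proof -
    have "0 \<le> z + a" using that z(2) by linarith
    then show ?thesis using input[OF that] s(3) by (auto simp: av_def addr_def)
  qed
  have "simulates R V z (initial_state xs) s2"
    using 2 m z(1) s(2) by (auto simp: simulates_def initial_state_def rv_def)
  moreover have "\<bar>z\<bar> + V \<le> W" using z fits_nonneg[OF p(2)] by linarith
  ultimately obtain u s3 where 3: "exec W (relocate p) s2 u s3" "u \<le> 2 * t" "fits W s3"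
    "simulates R V z s1 s3" "frame V z s2 s3"
    using relocate_correct[OF p(1,2) 2(2) _ p(3)] by blast
  have r: "rv s3 = \<rho>" using 2(4) 3(5) s(2) unfolding frame_def rv_def by auto
  have c: "av s3 c = \<mu> c" if "c \<noteq> 0" for c
  proof -
    have "mem s3 (addr c i) = mem s (addr c i)" if "0 \<le> i" for i
      using 3(5) 2(3) z(2) that \<open>c \<noteq> 0\<close> unfolding frame_def by (auto simp: addr_def)
    then show ?thesis using s(3) by (auto simp: av_def)
  qed
  have f: "av s3 0 a = \<mu> 0 a" if "V < \<bar>a - z\<bar>" for a
    using 3(5) 2(3) s(3) that by (auto simp: av_def addr_def frame_def)
  have o: "av s3 0 (z + a) = mem s1 a" if "\<bar>a\<bar> \<le> V" for a
    using 3(4) that z(2) by (auto simp: av_def addr_def simulates_def)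
  show "\<exists>t' s'. exec W (call R p) s t' s' \<and> t' \<le> R + 1 + 2 * t \<and> fits W s' \<and> rv s' = \<rho> \<and>
      (\<forall>c. c \<noteq> 0 \<longrightarrow> av s' c = \<mu> c) \<and> (\<forall>a. V < \<bar>a - z\<bar> \<longrightarrow> av s' 0 a = \<mu> 0 a) \<and>
      (\<forall>a. \<bar>a\<bar> \<le> V \<longrightarrow> av s' 0 (z + a) = mem s1 a)"
    using exec.Seq[OF 2(1) 3(1)] 3(2,3) r c f o unfolding call_def
    by (intro exI[of _ "R + 1 + u"] exI[of _ s3]) auto
qed

section \<open>Merge sort\<close>

text \<open>Registers: \<open>n\<close>, \<open>m = n\<^sup>2\<close>, \<open>h\<close>, \<open>P = 2 ^ L\<close> and \<open>L\<close>, the centre of the current window, the distance of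
  consecutive windows, and the step of the binary search.  Lines are numbered from 0 (rows, then columns).
  Entry \<open>k\<close> of line \<open>l\<close> is item \<open>l * n + k\<close>; its value is kept in \<open>aKey\<close>, and \<open>aSrc\<close> gets the items in increasing order.
  For the entry of line \<open>l\<close> that is preceded by \<open>q\<close> others, cell \<open>l * n + q\<close> holds its index in \<open>aItem\<close> and its
  rank in \<open>aRank\<close>.  For the pair \<open>t = i * n + j\<close>, \<open>aLow\<close> is the lower bound on the rank, \<open>aX\<close> and \<open>aY\<close> are the
  lengths of the two prefixes, and \<open>aF\<close> is 1 as long as no call of the round has found a common index.\<close>

abbreviation (input) rN :: nat where "rN \<equiv> 2"
abbreviation (input) rM :: nat where "rM \<equiv> 3"
abbreviation (input) rH :: nat where "rH \<equiv> 4"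
abbreviation (input) rP :: nat where "rP \<equiv> 5"
abbreviation (input) rL :: nat where "rL \<equiv> 6"
abbreviation (input) rO :: nat where "rO \<equiv> 7"
abbreviation (input) rD :: nat where "rD \<equiv> 8"
abbreviation (input) rS :: nat where "rS \<equiv> 9"

abbreviation (input) aRaw :: nat where "aRaw \<equiv> 0"
abbreviation (input) aKey :: nat where "aKey \<equiv> 11"
abbreviation (input) aSrc :: nat where "aSrc \<equiv> 2"
abbreviation (input) aDst :: nat where "aDst \<equiv> 3"
abbreviation (input) aItem :: nat where "aItem \<equiv> 4"
abbreviation (input) aRank :: nat where "aRank \<equiv> 5"
abbreviation (input) aFill :: nat where "aFill \<equiv> 6"
abbreviation (input) aLow :: nat where "aLow \<equiv> 7"
abbreviation (input) aX :: nat where "aX \<equiv> 8"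
abbreviation (input) aY :: nat where "aY \<equiv> 9"
abbreviation (input) aF :: nat where "aF \<equiv> 10"

section \<open>Merging two sorted blocks\<close>

fun merge :: "('a \<Rightarrow> int) \<Rightarrow> 'a list \<Rightarrow> 'a list \<Rightarrow> 'a list" where
  "merge K [] ys = ys"
| "merge K xs [] = xs"
| "merge K (x # xs) (y # ys) = (if K y < K x then y # merge K (x # xs) ys else x # merge K xs (y # ys))"

lemma merge_Nil2 [simp]: "merge K xs [] = xs"
  by (cases xs) auto

lemma mset_merge: "mset (merge K xs ys) = mset xs + mset ys"
  by (induction K xs ys rule: merge.induct) auto

lemma sorted_merge:
  "sorted (map K xs) \<Longrightarrow> sorted (map K ys) \<Longrightarrow> sorted (map K (merge K xs ys))"
proof (induction K xs ys rule: merge.induct)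
  case (3 K x xs y ys)
  have "set (merge K xs (y # ys)) = set xs \<union> set (y # ys)" "set (merge K (x # xs) ys) = set (x # xs) \<union> set ys"
    by (metis mset_merge set_mset_mset set_mset_union)+
  with 3 show ?case by fastforce
qed auto

definition chunk :: "(int \<Rightarrow> 'a) \<Rightarrow> int \<Rightarrow> int \<Rightarrow> 'a list" where
  "chunk f i j = map f [i..j - 1]"

lemma chunk_empty: "j \<le> i \<Longrightarrow> chunk f i j = []"
  by (simp add: chunk_def)

lemma chunk_Cons: "i < j \<Longrightarrow> chunk f i j = f i # chunk f (i + 1) j"
  by (simp add: chunk_def upto_rec1)

lemma chunk_append: "i \<le> j \<Longrightarrow> j \<le> k \<Longrightarrow> chunk f i k = chunk f i j @ chunk f j k"
  unfolding chunk_def map_append[symmetric] using upto_split1[of i "j" "k - 1"]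
  by (cases "j = k") (auto)

lemma chunk_snoc: "i \<le> j \<Longrightarrow> chunk f i (j + 1) = chunk f i j @ [f j]"
  using chunk_append[of i j "j + 1" f] by (simp add: chunk_Cons chunk_empty)

lemma chunk_cong: "(\<And>x. i \<le> x \<Longrightarrow> x < j \<Longrightarrow> f x = g x) \<Longrightarrow> chunk f i j = chunk g i j"
  by (auto simp: chunk_def)

lemma set_chunk: "set (chunk f i j) = f ` {i..<j}"
  by (auto simp: chunk_def)

definition merge_body :: prog where
  "merge_body = block [
     Set 26 (Lt (Var 21) (Var 24) \<boxtimes> (Num 1 \<boxminus> Lt (Var 20) (Var 23) \<boxtimes>
       (Num 1 \<boxminus> Lt (Arr aKey (Arr aSrc (Var 21))) (Arr aKey (Arr aSrc (Var 20)))))),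
     Put aDst (Var 25 \<boxplus> Var 14) (Arr aSrc (Var 20 \<boxplus> Var 26 \<boxtimes> (Var 21 \<boxminus> Var 20))),
     Set 21 (Var 21 \<boxplus> Var 26),
     Set 20 (Var 20 \<boxplus> (Num 1 \<boxminus> Var 26))]"

definition merge_loop :: prog where
  "merge_loop = For 14 15 (Var 22 \<boxplus> Var 22) merge_body"

text \<open>The range of \<open>f\<close> is required at all positions because the body also reads
  the cell behind a used-up block and takes its content as an index into the keys.\<close>

lemma merge_loop_correct:
  fixes lo w P :: int
  assumes bounds: "0 \<le> lo" "1 \<le> w" "lo + 2 * w \<le> P" "16 * P + 32 \<le> W"
    and regs: "\<rho> 20 = lo" "\<rho> 21 = lo + w" "\<rho> 22 = w" "\<rho> 23 = lo + w" "\<rho> 24 = lo + 2 * w" "\<rho> 25 = lo"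
    and f: "f = \<mu> aSrc" "\<And>x. 0 \<le> f x \<and> f x < P" and K: "K = \<mu> aKey"
  shows "triple W merge_loop (nat (2 * w) * 90 + 10) \<rho> \<mu> (\<lambda>\<rho>' \<mu>'. \<exists>g. \<mu>' = \<mu>(aDst := g) \<and>
    (\<forall>x. x < lo \<or> lo + 2 * w \<le> x \<longrightarrow> g x = \<mu> aDst x) \<and>
    chunk g lo (lo + 2 * w) = merge K (chunk f lo (lo + w)) (chunk f (lo + w) (lo + 2 * w)) \<and>
    agree {14, 15, 20, 21, 26} \<rho>' \<rho>)" (is "triple W _ _ _ _ ?Q")
proof -
  let ?T = "merge K (chunk f lo (lo + w)) (chunk f (lo + w) (lo + 2 * w))"
  define I where "I k \<rho>' \<mu>' \<longleftrightarrow> (\<exists>a b g. \<rho>' 20 = a \<and> \<rho>' 21 = b \<and> lo \<le> a \<and> a \<le> lo + w \<and> lo + w \<le> b \<and>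
    b \<le> lo + 2 * w \<and> k = (a - lo) + (b - lo - w) \<and> \<mu>' = \<mu>(aDst := g) \<and>
    (\<forall>x. x < lo \<or> lo + 2 * w \<le> x \<longrightarrow> g x = \<mu> aDst x) \<and>
    chunk g lo (lo + k) @ merge K (chunk f a (lo + w)) (chunk f b (lo + 2 * w)) = ?T \<and>
    agree {14, 15, 20, 21, 26} \<rho>' \<rho>)" for k :: int and \<rho>' :: "nat \<Rightarrow> int" and \<mu>'
  have body: "triple W merge_body 84 \<rho>' \<mu>'
      (step_post 14 15 k (2 * w) I)"
    if k: "0 \<le> k" "k < 2 * w" and c: "\<rho>' 14 = k" "\<rho>' 15 = 2 * w" and I: "I k \<rho>' \<mu>'" for k \<rho>' \<mu>'
  proof -
    from I obtain a b g where ab: "\<rho>' 20 = a" "\<rho>' 21 = b" "lo \<le> a" "a \<le> lo + w" "lo + w \<le> b"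
      "b \<le> lo + 2 * w" "k = (a - lo) + (b - lo - w)" and \<mu>': "\<mu>' = \<mu>(aDst := g)"
      and out: "\<forall>x. x < lo \<or> lo + 2 * w \<le> x \<longrightarrow> g x = \<mu> aDst x"
      and T: "chunk g lo (lo + k) @ merge K (chunk f a (lo + w)) (chunk f b (lo + 2 * w)) = ?T"
      and fr: "agree {14, 15, 20, 21, 26} \<rho>' \<rho>" unfolding I_def by blast
    have r: "\<rho>' 22 = w" "\<rho>' 23 = lo + w" "\<rho>' 24 = lo + 2 * w" "\<rho>' 25 = lo" using fr regs by auto
    define tk where "tk \<longleftrightarrow> b < lo + 2 * w \<and> (a < lo + w \<longrightarrow> K (f b) < K (f a))"
    define v where "v = (if tk then f b else f a)"
    define g' where "g' = g(lo + k := v)"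
    have new: "chunk g' lo (lo + (k + 1)) = chunk g lo (lo + k) @ [v]"
      using chunk_snoc[of lo "lo + k" g'] k chunk_cong[of lo "lo + k" g' g]
      by (auto simp: g'_def add.assoc)
    have step: "merge K (chunk f a (lo + w)) (chunk f b (lo + 2 * w)) =
        v # merge K (chunk f (if tk then a else a + 1) (lo + w)) (chunk f (if tk then b + 1 else b) (lo + 2 * w))"
      using ab k chunk_Cons[of a "lo + w" f] chunk_Cons[of b "lo + 2 * w" f]
        chunk_empty[of "lo + w" a f] chunk_empty[of "lo + 2 * w" b f]
      by (cases "a < lo + w"; cases "b < lo + 2 * w") (simp_all add: v_def tk_def)
    have I': "I (k + 1) (\<rho>'(26 := of_bool tk, 21 := b + of_bool tk, 20 := a + (1 - of_bool tk), 14 := k + 1)) (\<mu>(aDst := g'))"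
      unfolding I_def
    proof (rule exI[of _ "if tk then a else a + 1"], rule exI[of _ "if tk then b + 1 else b"],
        rule exI[of _ g'], intro conjI)
      show "\<forall>x. x < lo \<or> lo + 2 * w \<le> x \<longrightarrow> g' x = \<mu> aDst x"
        using out k by (auto simp: g'_def)
      show "chunk g' lo (lo + (k + 1)) @ merge K (chunk f (if tk then a else a + 1) (lo + w))
          (chunk f (if tk then b + 1 else b) (lo + 2 * w)) = ?T"
        using T step new by simp
    qed (use ab k fr in \<open>auto simp: tk_def\<close>)
    have fb: "0 \<le> f x" "f x < P" for x using f(2) by auto
    have fW: "16 * f x + 16 \<le> W" "f x \<le> W" for x using f(2)[of x] bounds by linarith+
    have key: "of_bool (b < lo + 2 * w) * (1 - of_bool (a < lo + w) * (1 - of_bool (K (f b) < K (f a)))) = (of_bool tk :: int)"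
      by (auto simp: tk_def)
    have sel: "f (a + of_bool tk * (b - a)) = v" by (simp add: v_def)
    have W: "1 \<le> W" "b \<le> P" "a \<le> P" "P \<le> W" using bounds ab by linarith+
    show ?thesis unfolding merge_body_def using I' c
      by - (rule triple_block, simp add: ab(1,2) r \<mu>' f(1)[symmetric] K[symmetric] key sel g'_def[symmetric],
        use ab k bounds W fb fW in \<open>auto simp: tk_def\<close>)
  qed
  have W: "1 \<le> W" "2 * w \<le> W" using bounds by linarith+
  show ?thesis unfolding merge_loop_def
  proof (rule triple_For[where I=I and N="2 * w" and c=84])
    show "I 0 (\<rho>(15 := 2 * w, 14 := 0)) \<mu>" unfolding I_def
      by (rule exI[of _ lo], rule exI[of _ "lo + w"], rule exI[of _ "\<mu> aDst"])
        (use regs bounds in \<open>auto simp: chunk_empty\<close>)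
    show "?Q \<rho>' \<mu>'" if "I (2 * w) \<rho>' \<mu>'" for \<rho>' \<mu>'
      using that unfolding I_def by (elim exE conjE) (intro exI conjI; (assumption | simp add: chunk_empty))
  qed (use regs bounds W body in auto)
qed


definition pass_body :: prog where
  "pass_body = Seq (block [
     Set 20 (Var 12 \<boxtimes> (Var 22 \<boxplus> Var 22)),
     Set 21 (Var 20 \<boxplus> Var 22), Set 23 (Var 21), Set 24 (Var 21 \<boxplus> Var 22), Set 25 (Var 20)]) merge_loop"

definition pass_loop :: prog where
  "pass_loop = For 12 13 (Var rP \<boxslash> (Var 22 \<boxplus> Var 22)) pass_body"

definition merged :: "(int \<Rightarrow> int) \<Rightarrow> (int \<Rightarrow> int) \<Rightarrow> (int \<Rightarrow> int) \<Rightarrow> int \<Rightarrow> int \<Rightarrow> bool" where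
  "merged K f g w j \<longleftrightarrow> chunk g (2 * w * j) (2 * w * (j + 1)) =
    merge K (chunk f (w * (2 * j)) (w * (2 * j + 1))) (chunk f (w * (2 * j + 1)) (w * (2 * j + 2)))"

definition pass_regs :: "nat set" where
  "pass_regs = {12, 13, 14, 15, 20, 21, 23, 24, 25, 26}"

lemma pass_loop_correct:
  fixes w P J :: int
  assumes bounds: "1 \<le> w" "0 \<le> J" "P = 2 * w * J" "16 * P + 32 \<le> W" "1 \<le> P"
    and regs: "\<rho> 22 = w" "\<rho> rP = P"
    and f: "f = \<mu> aSrc" "\<And>x. 0 \<le> f x \<and> f x < P" and K: "K = \<mu> aKey"
  shows "triple W pass_loop (nat P * 90 + nat J * 80 + 20) \<rho> \<mu> (\<lambda>\<rho>' \<mu>'. \<exists>g. \<mu>' = \<mu>(aDst := g) \<and>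
    (\<forall>j. 0 \<le> j \<and> j < J \<longrightarrow> merged K f g w j) \<and>
    agree pass_regs \<rho>' \<rho>)"
proof -
  define I where "I k \<rho>' \<mu>' \<longleftrightarrow> (\<exists>g. \<mu>' = \<mu>(aDst := g) \<and>
    (\<forall>j. 0 \<le> j \<and> j < k \<longrightarrow> merged K f g w j) \<and>
    agree pass_regs \<rho>' \<rho>)" for k :: int and \<rho>' :: "nat \<Rightarrow> int" and \<mu>'
  have W: "1 \<le> W" "P \<le> W" "2 * w \<le> W"
  proof -
    have "1 \<le> J" using bounds by (cases "J = 0") auto
    then have "2 * w * 1 \<le> P" unfolding bounds(3) using bounds(1) by (intro mult_left_mono) auto
    then show "1 \<le> W" "P \<le> W" "2 * w \<le> W" using bounds by linarith+
  qed
  have body: "triple W pass_body (nat (2 * w) * 90 + 64) \<rho>' \<mu>'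
      (step_post 12 13 k J I)"
    if k: "0 \<le> k" "k < J" and c: "\<rho>' 12 = k" "\<rho>' 13 = J" and I: "I k \<rho>' \<mu>'" for k \<rho>' \<mu>'
  proof -
    from I obtain g where \<mu>': "\<mu>' = \<mu>(aDst := g)"
      and prev: "\<forall>j. 0 \<le> j \<and> j < k \<longrightarrow> merged K f g w j"
      and fr: "agree pass_regs \<rho>' \<rho>" unfolding I_def by blast
    have r: "\<rho>' 22 = w" using fr regs by (simp add: pass_regs_def)
    let ?lo = "k * (w + w)"
    have le: "2 * w * (k + 1) \<le> 2 * w * J" using k bounds(1) by (intro mult_left_mono) auto
    have lo: "0 \<le> ?lo" "?lo + 2 * w \<le> P" "?lo = 2 * w * k" "?lo + 2 * w = 2 * w * (k + 1)"
      "?lo = w * (2 * k)" "?lo + w = w * (2 * k + 1)" "?lo + 2 * w = w * (2 * k + 2)"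
      using k bounds le by (simp_all add: algebra_simps)
    have b: "\<bar>w + w\<bar> \<le> W" "\<bar>?lo\<bar> \<le> W" "\<bar>?lo + w\<bar> \<le> W" "\<bar>?lo + w + w\<bar> \<le> W"
      using lo(1,2) W bounds(1) by auto
    let ?\<rho> = "\<rho>'(20 := ?lo, 21 := ?lo + w, 23 := ?lo + w, 24 := ?lo + w + w, 25 := ?lo)"
    show ?thesis unfolding pass_body_def
    proof (rule triple_Seq)
      show "triple W (block [Set 20 (Var 12 \<boxtimes> (Var 22 \<boxplus> Var 22)),
         Set 21 (Var 20 \<boxplus> Var 22), Set 23 (Var 21), Set 24 (Var 21 \<boxplus> Var 22), Set 25 (Var 20)]) 50 \<rho>' \<mu>'
         (\<lambda>\<rho>'' \<mu>''. \<rho>'' = ?\<rho> \<and> \<mu>'' = \<mu>')"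
        by (rule triple_block) (use c r b W in auto)
    next
      fix \<rho>'' \<mu>'' assume s: "\<rho>'' = ?\<rho> \<and> \<mu>'' = \<mu>'"
      show "triple W merge_loop (nat (2 * w) * 90 + 10) \<rho>'' \<mu>''
        (step_post 12 13 k J I)"
      proof (rule triple_conseq, rule merge_loop_correct[where lo="?lo" and w=w and P=P and f=f and K=K])
        fix \<rho>3 \<mu>3
        assume "\<exists>g. \<mu>3 = \<mu>''(aDst := g) \<and> (\<forall>x. x < ?lo \<or> ?lo + 2 * w \<le> x \<longrightarrow> g x = \<mu>'' aDst x) \<and>
          chunk g ?lo (?lo + 2 * w) = merge K (chunk f ?lo (?lo + w)) (chunk f (?lo + w) (?lo + 2 * w)) \<and>
          agree {14, 15, 20, 21, 26} \<rho>3 \<rho>''"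
        then obtain g' where g': "\<mu>3 = \<mu>''(aDst := g')"
          "\<forall>x. x < ?lo \<or> ?lo + 2 * w \<le> x \<longrightarrow> g' x = g x"
          "chunk g' ?lo (?lo + 2 * w) = merge K (chunk f ?lo (?lo + w)) (chunk f (?lo + w) (?lo + 2 * w))"
          and fr': "agree {14, 15, 20, 21, 26} \<rho>3 \<rho>''" using s \<mu>' by auto
        have "merged K f g' w j" if j: "0 \<le> j" "j < k + 1" for j
        proof (cases "j = k")
          case True
          then show ?thesis using g'(3) unfolding merged_def lo(4) lo(3) by (metis lo(3-7))
        next
          case False
          \<comment> \<open>The earlier output blocks lie left of \<open>?lo\<close>, so the current
            merge has not touched them.\<close>
          then have "2 * w * (j + 1) \<le> 2 * w * k" using j bounds(1) by (intro mult_left_mono) auto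
          then have "x < ?lo" if "x < 2 * w * (j + 1)" for x using that lo(3) by linarith
          then have "chunk g' (2 * w * j) (2 * w * (j + 1)) = chunk g (2 * w * j) (2 * w * (j + 1))"
            using g'(2) by (intro chunk_cong) blast
          then show ?thesis using prev j False by (simp add: merged_def)
        qed
        then show "\<rho>3 12 = k \<and> \<rho>3 13 = J \<and> I (k + 1) (\<rho>3(12 := k + 1)) \<mu>3"
          unfolding I_def using g'(1) s \<mu>' fr fr' c
          by (auto intro!: exI[of _ g'] simp: pass_regs_def)
      qed (use s \<mu>' f K bounds lo r in auto)
    qed auto
  qed
  show ?thesis unfolding pass_loop_def
  proof (rule triple_For[where I=I and N=J and c="nat (2 * w) * 90 + 64"])
    show "ev \<rho> \<mu> (Var rP \<boxslash> (Var 22 \<boxplus> Var 22)) = J"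
      using regs bounds by (simp add: mult.commute)
    have "P div (w + w) = J" using bounds by (simp add: mult.commute)
    moreover have "J \<le> P" unfolding bounds(3) using bounds(1,2) by (simp add: mult_le_cancel_right1)
    ultimately show "safe W \<rho> \<mu> (Var rP \<boxslash> (Var 22 \<boxplus> Var 22))" using regs W bounds by simp
    show "I 0 (\<rho>(13 := J, 12 := 0)) \<mu>" unfolding I_def
      by (rule exI[of _ "\<mu> aDst"]) (auto simp: pass_regs_def)
    \<comment> \<open>The merges of one pass produce \<open>P\<close> items in total, whatever the
      width \<open>w\<close>.\<close>
    have "nat J * nat (2 * w) = nat P" using bounds by (simp add: nat_mult_distrib mult.commute)
    then have "nat J * (nat (2 * w) * 90) = nat P * 90" by simp
    then show "nat J * ((nat (2 * w) * 90 + 64) + 6) + cost (Var rP \<boxslash> (Var 22 \<boxplus> Var 22)) + 5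
        \<le> nat P * 90 + nat J * 80 + 20"
      by (simp add: distrib_left)
  qed (use bounds W body in \<open>auto simp: I_def\<close>)
qed

definition copy_loop :: prog where
  "copy_loop = For 12 13 (Var rP) (block [Put aSrc (Var 12) (Arr aDst (Var 12))])"

lemma copy_loop_correct:
  assumes "16 * P + 32 \<le> W" "0 \<le> P" "\<rho> rP = P"
  shows "triple W copy_loop (nat P * 30 + 10) \<rho> \<mu> (\<lambda>\<rho>' \<mu>'.
    \<mu>' = \<mu>(aSrc := (\<lambda>x. if 0 \<le> x \<and> x < P then \<mu> aDst x else \<mu> aSrc x)) \<and>
    agree {12, 13} \<rho>' \<rho>)"
proof -
  define f where "f k = (\<lambda>x. if 0 \<le> x \<and> x < k then \<mu> aDst x else \<mu> aSrc x)" for k :: int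
  define I where "I k \<rho>' \<mu>' \<longleftrightarrow> \<mu>' = \<mu>(aSrc := f k) \<and> agree {12, 13} \<rho>' \<rho>"
    for k :: int and \<rho>' :: "nat \<Rightarrow> int" and \<mu>'
  have f0: "f 0 = \<mu> aSrc" by (auto simp: f_def)
  show ?thesis unfolding copy_loop_def f_def[symmetric]
  proof (rule triple_For[where I=I and N=P and c=24])
    fix k \<rho>' \<mu>' assume k: "0 \<le> k" "k < P" "\<rho>' 12 = k" "\<rho>' 13 = P" "I k \<rho>' \<mu>'"
    have "(f k)(k := \<mu> aDst k) = f (k + 1)" using k by (auto simp: f_def fun_eq_iff)
    with k show "triple W (block [Put aSrc (Var 12) (Arr aDst (Var 12))]) 24 \<rho>' \<mu>'
      (step_post 12 13 k P I)"
      using assms by (intro triple_block) (auto simp: I_def)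
  qed (use assms f0 in \<open>auto simp: I_def\<close>)
qed


lemma mset_pass:
  fixes w :: int
  assumes "1 \<le> w"
    and "\<And>j. 0 \<le> j \<Longrightarrow> j < int J \<Longrightarrow> merged K f g w j"
  shows "mset (chunk g 0 (2 * w * int J)) = mset (chunk f 0 (2 * w * int J))"
  using assms(2)
proof (induction J)
  case (Suc J)
  let ?j = "int J"
  have le: "0 \<le> 2 * w * ?j" "2 * w * ?j \<le> 2 * w * (?j + 1)"
    "w * (2 * ?j) \<le> w * (2 * ?j + 1)" "w * (2 * ?j + 1) \<le> w * (2 * ?j + 2)"
    using assms(1) by (auto intro!: mult_left_mono)
  have eq: "w * (2 * ?j) = 2 * w * ?j" "w * (2 * ?j + 2) = 2 * w * (?j + 1)" by (simp_all add: algebra_simps)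
  have "mset (chunk g (2 * w * ?j) (2 * w * (?j + 1))) = mset (chunk f (2 * w * ?j) (2 * w * (?j + 1)))"
    using Suc.prems[of ?j, unfolded merged_def] chunk_append[OF le(3,4), of f] by (simp add: mset_merge eq)
  moreover have "mset (chunk g 0 (2 * w * ?j)) = mset (chunk f 0 (2 * w * ?j))"
    by (rule Suc.IH) (use Suc.prems in auto)
  moreover have "int (Suc J) = ?j + 1" by simp
  ultimately show ?case
    using chunk_append[OF le(1,2), of g] chunk_append[OF le(1,2), of f] by (simp only: mset_append)
qed (simp add: chunk_empty)

section \<open>Bottom-up merge sort\<close>

definition sort_step :: prog where
  "sort_step = Seq pass_loop (Seq copy_loop (block [Set 22 (Var 22 \<boxplus> Var 22)]))"

definition sort_prog :: prog where
  "sort_prog = Seq (For 10 11 (Var rP) (block [Put aSrc (Var 10) (Var 10)]))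
     (Seq (block [Set 22 (Num 1)]) (For 10 11 (Var rL) sort_step))"

definition sort_regs :: "nat set" where
  "sort_regs = {10, 11, 22} \<union> pass_regs"

definition sorted_blocks :: "(int \<Rightarrow> int) \<Rightarrow> (int \<Rightarrow> int) \<Rightarrow> int \<Rightarrow> int \<Rightarrow> bool" where
  "sorted_blocks K f w J \<longleftrightarrow> (\<forall>j. 0 \<le> j \<and> j < J \<longrightarrow> sorted (map K (chunk f (w * j) (w * (j + 1)))))"

lemma sort_step_correct:
  fixes w P :: int and J :: nat
  assumes bounds: "1 \<le> w" "P = 2 * w * int J" "16 * P + 32 \<le> W" "1 \<le> P"
    and regs: "\<rho> 22 = w" "\<rho> rP = P"
    and f: "f = \<mu> aSrc" "\<And>x. 0 \<le> f x \<and> f x < P" "mset (chunk f 0 P) = mset [0..P - 1]"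
      "sorted_blocks K f w (2 * int J)" and K: "K = \<mu> aKey"
  shows "triple W sort_step (nat P * 210 + 50) \<rho> \<mu> (\<lambda>\<rho>' \<mu>'. \<exists>f g. \<mu>' = \<mu>(aSrc := f, aDst := g) \<and>
    (\<forall>x. 0 \<le> f x \<and> f x < P) \<and> mset (chunk f 0 P) = mset [0..P - 1] \<and>
    sorted_blocks K f (2 * w) (int J) \<and> \<rho>' 22 = 2 * w \<and> agree (insert 22 pass_regs) \<rho>' \<rho>)" (is "triple W _ _ _ _ ?Q")
  unfolding sort_step_def
proof (rule triple_Seq)
  show "triple W pass_loop (nat P * 90 + nat (int J) * 80 + 20) \<rho> \<mu> (\<lambda>\<rho>' \<mu>'. \<exists>g. \<mu>' = \<mu>(aDst := g) \<and>
    (\<forall>j. 0 \<le> j \<and> j < int J \<longrightarrow> merged K f g w j) \<and> agree pass_regs \<rho>' \<rho>)"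
    by (rule pass_loop_correct) (use assms in auto)
next
  fix \<rho>1 \<mu>1 assume "\<exists>g. \<mu>1 = \<mu>(aDst := g) \<and>
    (\<forall>j. 0 \<le> j \<and> j < int J \<longrightarrow> merged K f g w j) \<and>
    agree pass_regs \<rho>1 \<rho>"
  then obtain g where \<mu>1: "\<mu>1 = \<mu>(aDst := g)"
    and g: "\<And>j. 0 \<le> j \<Longrightarrow> j < int J \<Longrightarrow> merged K f g w j"
    and fr: "agree pass_regs \<rho>1 \<rho>" by blast
  define f' where "f' x = (if 0 \<le> x \<and> x < P then g x else f x)" for x
  have ms: "mset (chunk g 0 P) = mset [0..P - 1]"
    using mset_pass[OF bounds(1) g] f(3) bounds(2) by simp
  have cg: "chunk f' i j = chunk g i j" if "0 \<le> i" "j \<le> P" for i j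
    using that by (intro chunk_cong) (auto simp: f'_def)
  have ms': "mset (chunk f' 0 P) = mset [0..P - 1]" using ms cg by simp
  \<comment> \<open>The output of the pass is a permutation of \<open>0..P - 1\<close>; this keeps
    all items valid indices for the next pass.\<close>
  have "set (chunk g 0 P) = {0..P - 1}" using ms by (metis set_mset_mset set_upto)
  then have "g x \<in> {0..P - 1}" if "0 \<le> x" "x < P" for x using that unfolding set_chunk by auto
  then have rng: "\<forall>x. 0 \<le> f' x \<and> f' x < P" using f(2) by (force simp: f'_def)
  have sb: "sorted_blocks K f' (2 * w) (int J)" unfolding sorted_blocks_def
  proof (intro allI impI, elim conjE)
    fix j assume j: "0 \<le> j" "j < int J"
    have "2 * w * (j + 1) \<le> P" "0 \<le> 2 * w * j"
      unfolding bounds(2) using j bounds(1) by (auto intro!: mult_left_mono)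
    then have c: "chunk f' (2 * w * j) (2 * w * (j + 1)) = chunk g (2 * w * j) (2 * w * (j + 1))" by (intro cg)
    have "sorted (map K (chunk f (w * (2 * j)) (w * (2 * j + 1))))"
      using f(4) j unfolding sorted_blocks_def by auto
    moreover have "sorted (map K (chunk f (w * (2 * j + 1)) (w * (2 * j + 1 + 1))))"
      using f(4)[unfolded sorted_blocks_def, rule_format, of "2 * j + 1"] j by linarith
    ultimately show "sorted (map K (chunk f' (2 * w * j) (2 * w * (j + 1))))"
      unfolding c g[OF j, unfolded merged_def] by (intro sorted_merge) (simp_all add: add.assoc)
  qed
  have w: "2 * w \<le> P" "int J \<le> P"
  proof -
    have "1 \<le> int J" using bounds by (cases "J = 0") auto
    then have "2 * w * 1 \<le> P" unfolding bounds(2) using bounds(1) by (intro mult_left_mono) auto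
    moreover have "int J \<le> P" unfolding bounds(2) using bounds(1) by (simp add: mult_le_cancel_right1)
    ultimately show "2 * w \<le> P" "int J \<le> P" by auto
  qed
  show "triple W (Seq copy_loop (block [Set 22 (Var 22 \<boxplus> Var 22)])) (nat P * 30 + 20) \<rho>1 \<mu>1 ?Q"
  proof (rule triple_Seq, rule copy_loop_correct[where P=P])
    show "\<rho>1 rP = P" using fr regs by (simp add: pass_regs_def)
  next
    fix \<rho>2 \<mu>2 assume 2: "\<mu>2 = \<mu>1(aSrc := (\<lambda>x. if 0 \<le> x \<and> x < P then \<mu>1 aDst x else \<mu>1 aSrc x)) \<and>
      agree {12, 13} \<rho>2 \<rho>1"
    then have \<mu>2: "\<mu>2 = \<mu>(aSrc := f', aDst := g)"
      unfolding \<mu>1 f'_def by (auto simp: fun_eq_iff f(1))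
    have r2: "\<rho>2 22 = w" "agree pass_regs \<rho>2 \<rho>"
      using 2 fr regs by (auto simp: pass_regs_def)
    show "triple W (block [Set 22 (Var 22 \<boxplus> Var 22)]) 6 \<rho>2 \<mu>2 ?Q"
    proof (rule triple_conseq[where k=6])
      have "2 * w \<le> W" using w(1) bounds by linarith
      then show "triple W (block [Set 22 (Var 22 \<boxplus> Var 22)]) 6 \<rho>2 \<mu>2
          (\<lambda>\<rho>' \<mu>'. \<rho>' = \<rho>2(22 := 2 * w) \<and> \<mu>' = \<mu>2)"
        using r2(1) bounds by (intro triple_block) auto
    next
      fix \<rho>' \<mu>' assume "\<rho>' = \<rho>2(22 := 2 * w) \<and> \<mu>' = \<mu>2"
      then show "?Q \<rho>' \<mu>'"
        using rng ms' sb \<mu>2 r2 by - (rule exI[of _ f'], rule exI[of _ g], auto)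
    qed simp
  qed (use bounds in auto)
next
  have "int J \<le> P" unfolding bounds(2) using bounds(1) by (simp add: mult_le_cancel_right1)
  then show "nat P * 90 + nat (int J) * 80 + 20 + (nat P * 30 + 20) \<le> nat P * 210 + 50"
    by linarith
qed

text \<open>Padding the items to a power of two makes each pass a merge of blocks of equal width.
  The padding items are sorted along with the others and may end up anywhere among them.\<close>

lemma sort_prog_correct:
  assumes "P = 2 ^ L" "16 * P + 32 \<le> W" "int L \<le> P" "\<rho> rP = P" "\<rho> rL = int L"
    "\<And>x. \<mu> aSrc x = 0" and K: "K = \<mu> aKey"
  shows "triple W sort_prog (L * (nat P * 300) + nat P * 30 + 50) \<rho> \<mu> (\<lambda>\<rho>' \<mu>'. \<exists>f g. \<mu>' = \<mu>(aSrc := f, aDst := g) \<and>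
    (\<forall>x. 0 \<le> f x \<and> f x < P) \<and> mset (chunk f 0 P) = mset [0..P - 1] \<and> sorted (map K (chunk f 0 P)) \<and>
    agree sort_regs \<rho>' \<rho>)" (is "triple W _ _ _ _ ?Q")
proof -
  have P: "1 \<le> P" using assms(1) by simp
  have W: "1 \<le> W" "P \<le> W" "int L \<le> W" using assms P by linarith+
  define f0 where "f0 k x = (if 0 \<le> x \<and> x < k then x else 0)" for k x :: int
  define I0 where "I0 k \<rho>' \<mu>' \<longleftrightarrow> \<mu>' = \<mu>(aSrc := f0 k) \<and> agree {10, 11} \<rho>' \<rho>"
    for k :: int and \<rho>' :: "nat \<Rightarrow> int" and \<mu>'
  define I where "I k \<rho>' \<mu>' \<longleftrightarrow> \<rho>' 22 = 2 ^ nat k \<and> (\<exists>f g. \<mu>' = \<mu>(aSrc := f, aDst := g) \<and>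
    (\<forall>x. 0 \<le> f x \<and> f x < P) \<and> mset (chunk f 0 P) = mset [0..P - 1] \<and>
    sorted_blocks K f (2 ^ nat k) (2 ^ (L - nat k)) \<and> agree sort_regs \<rho>' \<rho>)"
    for k :: int and \<rho>' :: "nat \<Rightarrow> int" and \<mu>'
  show ?thesis unfolding sort_prog_def
  proof (rule triple_Seq)
    show "triple W (For 10 11 (Var rP) (block [Put aSrc (Var 10) (Var 10)]))
        (nat P * (16 + 6) + cost (Var rP) + 5) \<rho> \<mu> (\<lambda>\<rho>' \<mu>'. I0 P \<rho>' \<mu>')"
    proof (rule triple_For[where I=I0 and N=P])
      fix k \<rho>' \<mu>' assume k: "0 \<le> k" "k < P" "\<rho>' 10 = k" "\<rho>' 11 = P" "I0 k \<rho>' \<mu>'"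
      have "(f0 k)(k := k) = f0 (k + 1)" using k by (auto simp: f0_def fun_eq_iff)
      with k show "triple W (block [Put aSrc (Var 10) (Var 10)]) 16 \<rho>' \<mu>'
        (\<lambda>\<rho>'' \<mu>''. \<rho>'' 10 = k \<and> \<rho>'' 11 = P \<and> I0 (k + 1) (\<rho>''(10 := k + 1)) \<mu>'')"
        using assms by (intro triple_block) (auto simp: I0_def)
    next
      have "f0 0 = \<mu> aSrc" using assms(6) by (auto simp: f0_def)
      then show "I0 0 (\<rho>(11 := P, 10 := 0)) \<mu>" by (auto simp: I0_def)
    qed (use assms P W in auto)
  next
    fix \<rho>1 \<mu>1 assume "I0 P \<rho>1 \<mu>1"
    then have 1: "\<mu>1 = \<mu>(aSrc := f0 P)" "agree {10, 11} \<rho>1 \<rho>" by (auto simp: I0_def)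
    show "triple W (Seq (block [Set 22 (Num 1)]) (For 10 11 (Var rL) sort_step))
        (L * (nat P * 300) + 20) \<rho>1 \<mu>1 ?Q"
    proof (rule triple_Seq)
      show "triple W (block [Set 22 (Num 1)]) 5 \<rho>1 \<mu>1 (\<lambda>\<rho>' \<mu>'. \<rho>' = \<rho>1(22 := 1) \<and> \<mu>' = \<mu>1)"
        using W by (intro triple_block) auto
    next
      fix \<rho>2 \<mu>2 assume 2: "\<rho>2 = \<rho>1(22 := 1) \<and> \<mu>2 = \<mu>1"
      show "triple W (For 10 11 (Var rL) sort_step)
          (nat (int L) * ((nat P * 210 + 50) + 6) + cost (Var rL) + 5) \<rho>2 \<mu>2 ?Q"
      proof (rule triple_For[where I=I and N="int L"])
        have "chunk (f0 P) 0 P = [0..P - 1]"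
          unfolding chunk_def by (rule map_idI) (auto simp: f0_def)
        moreover have "sorted_blocks K (f0 P) 1 J" for J
          by (auto simp: sorted_blocks_def chunk_Cons chunk_empty)
        ultimately show "I 0 (\<rho>2(11 := int L, 10 := 0)) \<mu>2"
          unfolding I_def using 1 2 P
          by - (rule conjI, simp, rule exI[of _ "f0 P"], rule exI[of _ "\<mu> aDst"],
            auto simp: sort_regs_def fun_upd_twist f0_def)
      next
        fix k \<rho>' \<mu>' assume k: "0 \<le> k" "k < int L" "\<rho>' 10 = k" "\<rho>' 11 = int L" "I k \<rho>' \<mu>'"
        from k(5) obtain f g where \<mu>': "\<mu>' = \<mu>(aSrc := f, aDst := g)" and w: "\<rho>' 22 = 2 ^ nat k"
          and f: "\<forall>x. 0 \<le> f x \<and> f x < P" "mset (chunk f 0 P) = mset [0..P - 1]"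
            "sorted_blocks K f (2 ^ nat k) (2 ^ (L - nat k))"
          and fr: "agree sort_regs \<rho>' \<rho>" unfolding I_def by blast
        define J :: nat where "J = 2 ^ (L - nat (k + 1))"
        have L: "L = Suc (nat k + (L - nat (k + 1)))" "L - nat k = Suc (L - nat (k + 1))"
          "nat (k + 1) = Suc (nat k)" using k by linarith+
        have PJ: "P = 2 * 2 ^ nat k * int J" unfolding assms(1) J_def by (subst L(1)) (simp add: power_add)
        have J2: "2 ^ (L - nat k) = 2 * int J" unfolding L(2) J_def by simp
        show "triple W sort_step (nat P * 210 + 50) \<rho>' \<mu>'
          (step_post 10 11 k (int L) I)"
        proof (rule triple_conseq, rule sort_step_correct[OF _ PJ])
          fix \<rho>3 \<mu>3 assume "\<exists>f g. \<mu>3 = \<mu>'(aSrc := f, aDst := g) \<and>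
            (\<forall>x. 0 \<le> f x \<and> f x < P) \<and> mset (chunk f 0 P) = mset [0..P - 1] \<and>
            sorted_blocks K f (2 * 2 ^ nat k) (int J) \<and> \<rho>3 22 = 2 * 2 ^ nat k \<and>
            agree (insert 22 pass_regs) \<rho>3 \<rho>'"
          then obtain f' g' where 3: "\<mu>3 = \<mu>'(aSrc := f', aDst := g')" "\<forall>x. 0 \<le> f' x \<and> f' x < P"
            "mset (chunk f' 0 P) = mset [0..P - 1]" "sorted_blocks K f' (2 * 2 ^ nat k) (int J)"
            "\<rho>3 22 = 2 * 2 ^ nat k" "agree (insert 22 pass_regs) \<rho>3 \<rho>'" by blast
          have "\<mu>3 = \<mu>(aSrc := f', aDst := g')" using 3(1) \<mu>' by (auto simp: fun_eq_iff)
          moreover have "\<rho>3 10 = k" "\<rho>3 11 = int L" using 3(6) k by (auto simp: pass_regs_def)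
          moreover have "agree sort_regs (\<rho>3(10 := k + 1)) \<rho>"
            using 3(6) fr by (auto simp: sort_regs_def)
          ultimately show "\<rho>3 10 = k \<and> \<rho>3 11 = int L \<and> I (k + 1) (\<rho>3(10 := k + 1)) \<mu>3"
            unfolding I_def using 3 L by (auto simp: J_def)
        next
          show "\<rho>' rP = P" using fr assms(4) by (simp add: sort_regs_def pass_regs_def)
          show "sorted_blocks K f (2 ^ nat k) (2 * int J)" using f(3) J2 by simp
          show "K = \<mu>' aKey" using \<mu>' K by simp
        qed (use assms P \<mu>' w f J2 in auto)
      next
        fix \<rho>' \<mu>' assume "I (int L) \<rho>' \<mu>'"
        then obtain f g where fg: "\<mu>' = \<mu>(aSrc := f, aDst := g)" "\<forall>x. 0 \<le> f x \<and> f x < P"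
          "mset (chunk f 0 P) = mset [0..P - 1]" "sorted_blocks K f P 1" "agree sort_regs \<rho>' \<rho>"
          unfolding I_def using assms(1) by auto
        from fg(4) have "sorted (map K (chunk f 0 P))" unfolding sorted_blocks_def by fastforce
        with fg show "?Q \<rho>' \<mu>'" by blast
      qed (use assms P W 1 2 in auto)
    next
      have "1 \<le> nat P" using P by simp
      then have "L * ((nat P * 210 + 50) + 6) \<le> L * (nat P * 300)" by (intro mult_left_mono) auto
      then show "5 + (nat (int L) * ((nat P * 210 + 50) + 6) + cost (Var rL) + 5) \<le> L * (nat P * 300) + 20"
        unfolding cost.simps nat_int by linarith
    qed
  qed auto
qed

section \<open>Ranks and buckets\<close>

text \<open>\<open>P\<close> is the number of items after padding. The factor 64 in the bound on
  \<open>W\<close> is the interleaving factor 16 times 4, for indices up to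
  \<open>4 * P\<close>.\<close>

locale sizes =
  fixes n m h P W :: int and L :: nat
  assumes n: "2 \<le> n" and m: "m = n * n" and h: "h = n div 2"
    and P: "P = 2 ^ L" "2 * m \<le> P" "P < 4 * m" and W: "64 * P + 64 \<le> W" and L: "int L \<le> P"
begin

lemma m_ge: "2 * n \<le> m" "4 \<le> m" "n \<le> m"
proof -
  show "2 * n \<le> m" unfolding m using n by (intro mult_right_mono) auto
  then show "4 \<le> m" "n \<le> m" using n by linarith+
qed

lemma h_bounds: "1 \<le> h" "2 * h \<le> n" "n \<le> 3 * h" "n - 1 \<le> 2 * h"
  using n unfolding h by presburger+

lemma W_bounds: "8 \<le> P" "1 \<le> W" "P \<le> W" "m \<le> W" "n \<le> W"
  using m_ge P W by linarith+

lemma line_bounds: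
  assumes "0 \<le> l" "l < 2 * n" "0 \<le> k" "k < n"
  shows "0 \<le> l * n + k" "l * n + k < 2 * m" "l * n + n \<le> 2 * m" "l * n + k < P" "(l * n + k) div n = l" "(l * n + k) mod n = k"
proof -
  have "(l + 1) * n \<le> 2 * n * n" using assms n by (intro mult_right_mono) auto
  then have "l * n + n \<le> 2 * m" by (simp add: m algebra_simps)
  then show "l * n + n \<le> 2 * m" "l * n + k < 2 * m" "l * n + k < P" using assms P by linarith+
  show "0 \<le> l * n + k" using assms n by simp
  show "(l * n + k) div n = l" "(l * n + k) mod n = k" using assms n by simp_all
qed

lemma pair_bounds:
  assumes "0 \<le> t" "t < m"
  shows "0 \<le> t div n" "t div n < n" "0 \<le> t mod n" "t mod n < n" "t div n * n + t mod n = t"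
proof -
  have "t div n * n \<le> t" using n pos_mod_sign[of n t] div_mult_mod_eq[of t n] by linarith
  then have "t div n * n < n * n" using assms(2) m by linarith
  then show "t div n < n" using n by (simp add: mult_less_cancel_right)
qed (use assms n in \<open>auto simp: pos_imp_zdiv_nonneg_iff\<close>)

end

section \<open>The sorting permutation, ranks and positions along a line\<close>

locale sorting = sizes +
  fixes K \<sigma> :: "int \<Rightarrow> int"
  assumes perm: "mset (chunk \<sigma> 0 P) = mset [0..P - 1]" and sorted: "sorted (map K (chunk \<sigma> 0 P))"
begin

lemma \<sigma>_image: "\<sigma> ` {0..<P} = {0..<P}"
proof -
  have "set (chunk \<sigma> 0 P) = set [0..P - 1]" using perm by (metis set_mset_mset)
  then show ?thesis by (auto simp: set_chunk)
qed

lemma \<sigma>_inj: "inj_on \<sigma> {0..<P}"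
proof -
  have "distinct (chunk \<sigma> 0 P)" using perm by (metis distinct_upto mset_eq_imp_distinct_iff)
  then have "inj_on \<sigma> {0..P - 1}" by (simp add: chunk_def distinct_map)
  moreover have "{0..P - 1} = {0..<P}" by auto
  ultimately show ?thesis by simp
qed

lemma \<sigma>_range: "0 \<le> r \<Longrightarrow> r < P \<Longrightarrow> 0 \<le> \<sigma> r \<and> \<sigma> r < P"
  using \<sigma>_image by (metis atLeastLessThan_iff imageI)

lemma \<sigma>_mono:
  assumes "0 \<le> r" "r \<le> r'" "r' < P"
  shows "K (\<sigma> r) \<le> K (\<sigma> r')"
proof -
  have "map K (chunk \<sigma> 0 P) ! nat r \<le> map K (chunk \<sigma> 0 P) ! nat r'"
    by (rule sorted_nth_mono[OF sorted]) (use assms in \<open>auto simp: chunk_def\<close>)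
  then show ?thesis using assms by (simp add: chunk_def nth_upto)
qed

text \<open>It plays two roles: at the rank of an entry of line \<open>l\<close> it is the position
  of this entry along the sorted line, and at a threshold it is the length of the prefix below the
  threshold.\<close>

definition cnt :: "int \<Rightarrow> int \<Rightarrow> int" where
  "cnt l r = int (card {r'. 0 \<le> r' \<and> r' < r \<and> \<sigma> r' div n = l})"

lemma cnt_set_finite: "finite {r'. 0 \<le> r' \<and> r' < r \<and> \<sigma> r' div n = l}"
  by (rule finite_subset[of _ "{0..<r}"]) auto

lemma cnt_0 [simp]: "cnt l 0 = 0"
proof -
  have "{r'. 0 \<le> r' \<and> r' < 0 \<and> \<sigma> r' div n = l} = {}" by auto
  then show ?thesis unfolding cnt_def by (simp only: card.empty)
qed

lemma cnt_Suc:
  assumes "0 \<le> r"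
  shows "cnt l (r + 1) = cnt l r + of_bool (\<sigma> r div n = l)"
proof -
  have "r' < r + 1 \<longleftrightarrow> r' < r \<or> r' = r" for r' by auto
  then have "{r'. 0 \<le> r' \<and> r' < r + 1 \<and> \<sigma> r' div n = l} =
    (if \<sigma> r div n = l then insert r else id) {r'. 0 \<le> r' \<and> r' < r \<and> \<sigma> r' div n = l}"
    using assms by (simp only:) auto
  then show ?thesis using cnt_set_finite by (simp add: cnt_def)
qed

lemma cnt_mono: "r \<le> r' \<Longrightarrow> cnt l r \<le> cnt l r'"
  unfolding cnt_def using cnt_set_finite by (auto intro!: card_mono)

lemma cnt_nonneg: "0 \<le> cnt l r"
  by (simp add: cnt_def)

text \<open>Over all ranks the order no longer matters: \<open>\<sigma>\<close> maps the counted
  ranks bijectively to the items of the line.\<close>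

lemma cnt_P: "cnt l P = int (card {e. 0 \<le> e \<and> e < P \<and> e div n = l})"
proof -
  let ?A = "{r. 0 \<le> r \<and> r < P \<and> \<sigma> r div n = l}"
  have "\<sigma> ` ?A = {e. 0 \<le> e \<and> e < P \<and> e div n = l}"
  proof (intro equalityI subsetI)
    fix e assume e: "e \<in> {e. 0 \<le> e \<and> e < P \<and> e div n = l}"
    then have "e \<in> \<sigma> ` {0..<P}" using \<sigma>_image by simp
    then show "e \<in> \<sigma> ` ?A" using e by auto
  qed (use \<sigma>_range in auto)
  moreover have "inj_on \<sigma> ?A" using \<sigma>_inj by (rule inj_on_subset) auto
  ultimately show ?thesis unfolding cnt_def using card_image[of \<sigma> ?A] by simp
qed

lemma div_eq_set: "e div n = l \<longleftrightarrow> l * n \<le> e \<and> e < l * n + n"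
proof
  assume "e div n = l"
  then have "e = l * n + e mod n" using div_mult_mod_eq[of e n] by simp
  then show "l * n \<le> e \<and> e < l * n + n" using pos_mod_bound[of n e] pos_mod_sign[of n e] n by linarith
next
  assume "l * n \<le> e \<and> e < l * n + n"
  then obtain x where "e = l * n + x" "0 \<le> x" "x < n"
    by (metis add_diff_cancel_left' add_less_cancel_left diff_ge_0_iff_ge diff_add_cancel add.commute)
  then show "e div n = l" using n by simp
qed

lemma cnt_le: "r \<le> P \<Longrightarrow> cnt l r \<le> n"
proof -
  have "card {e. 0 \<le> e \<and> e < P \<and> e div n = l} \<le> card {l * n..<l * n + n}"
    by (rule card_mono) (auto simp: div_eq_set)
  then have "cnt l P \<le> n" using n by (simp add: cnt_P)
  then show "r \<le> P \<Longrightarrow> cnt l r \<le> n" using cnt_mono[of r P l] by linarith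
qed

text \<open>Padding items are numbered from \<open>2 * m\<close> on and so belong to lines from
  \<open>2 * n\<close> on. A genuine line consists of exactly its n entries, wherever the padding
  has been ranked.\<close>

lemma cnt_full:
  assumes "0 \<le> l" "l < 2 * n"
  shows "cnt l P = n"
proof -
  have "l * n + n \<le> P" using line_bounds(3)[of l 0] assms n P by auto
  moreover have "0 \<le> l * n" using assms(1) n by simp
  ultimately have "{e. 0 \<le> e \<and> e < P \<and> e div n = l} = {l * n..<l * n + n}"
    unfolding div_eq_set by auto
  then show ?thesis using n by (simp add: cnt_P)
qed

lemma cnt_less: "0 \<le> r \<Longrightarrow> r < P \<Longrightarrow> cnt (\<sigma> r div n) r < n"
  using cnt_le[of "r + 1" "\<sigma> r div n"] cnt_Suc[of r "\<sigma> r div n"] by simp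

lemma cnt_strict: "0 \<le> r \<Longrightarrow> r < r' \<Longrightarrow> cnt (\<sigma> r div n) r < cnt (\<sigma> r div n) r'"
  using cnt_mono[of "r + 1" r' "\<sigma> r div n"] cnt_Suc[of r "\<sigma> r div n"] by simp

text \<open>A discrete intermediate value argument: the count starts at 0 and never grows by more
  than 1, and the rank at which it leaves the value \<open>y\<close> is the one wanted.\<close>

lemma cnt_onto:
  assumes "0 \<le> y" "y < cnt l (int r)"
  shows "\<exists>r'. 0 \<le> r' \<and> r' < int r \<and> \<sigma> r' div n = l \<and> cnt l r' = y"
  using assms
proof (induction r)
  case (Suc r)
  have eq: "cnt l (int (Suc r)) = cnt l (int r) + of_bool (\<sigma> (int r) div n = l)"
    using cnt_Suc[of "int r" l] by (simp add: add.commute)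
  show ?case
  proof (cases "y < cnt l (int r)")
    case True
    with Suc obtain r' where "0 \<le> r'" "r' < int r" "\<sigma> r' div n = l" "cnt l r' = y" by blast
    then show ?thesis by (intro exI[of _ r']) auto
  next
    case False
    with Suc.prems(2) eq have "\<sigma> (int r) div n = l" "cnt l (int r) = y" by (auto split: if_splits simp: of_bool_def)
    then show ?thesis by (intro exI[of _ "int r"]) auto
  qed
qed simp

definition slot :: "int \<Rightarrow> int" where
  "slot r = \<sigma> r div n * n + cnt (\<sigma> r div n) r"

lemma slot_nonneg: "0 \<le> r \<Longrightarrow> r < P \<Longrightarrow> 0 \<le> slot r"
  using \<sigma>_range[of r] n cnt_nonneg unfolding slot_def by (simp add: pos_imp_zdiv_nonneg_iff)

lemma slot_bound: "0 \<le> r \<Longrightarrow> r < P \<Longrightarrow> slot r < 2 * P"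
proof -
  assume r: "0 \<le> r" "r < P"
  have "\<sigma> r div n * n \<le> \<sigma> r" using n div_mult_mod_eq[of "\<sigma> r" n] pos_mod_sign[of n "\<sigma> r"] by linarith
  then show ?thesis using \<sigma>_range[OF r] cnt_less[OF r] m_ge P unfolding slot_def by linarith
qed

text \<open>A slot encodes line and position as quotient and remainder by n, and along a line the
  position grows strictly with the rank.\<close>

lemma slot_inj:
  assumes "0 \<le> r" "r < r'" "r' < P"
  shows "slot r \<noteq> slot r'"
proof
  assume eq: "slot r = slot r'"
  have c: "cnt (\<sigma> r div n) r < n" "cnt (\<sigma> r' div n) r' < n" using cnt_less assms by auto
  have "slot r div n = \<sigma> r div n" "slot r' div n = \<sigma> r' div n"
    unfolding slot_def using c cnt_nonneg n by simp_all
  then have "\<sigma> r div n = \<sigma> r' div n" using eq by simp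
  then show False using eq cnt_strict[OF assms(1,2)] unfolding slot_def by simp
qed

definition rank :: "int \<Rightarrow> int" where
  "rank e = (THE r. 0 \<le> r \<and> r < P \<and> \<sigma> r = e)"

lemma rank:
  assumes "0 \<le> e" "e < P"
  shows "0 \<le> rank e" "rank e < P" "\<sigma> (rank e) = e"
proof -
  have "e \<in> \<sigma> ` {0..<P}" using assms \<sigma>_image by simp
  then obtain r where r: "0 \<le> r" "r < P" "\<sigma> r = e" by auto
  have "0 \<le> rank e \<and> rank e < P \<and> \<sigma> (rank e) = e"
    unfolding rank_def
  proof (rule theI)
    show "0 \<le> r \<and> r < P \<and> \<sigma> r = e" using r by simp
    show "r' = r" if "0 \<le> r' \<and> r' < P \<and> \<sigma> r' = e" for r'
      using that r \<sigma>_inj by (auto dest: inj_onD)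
  qed
  then show "0 \<le> rank e" "rank e < P" "\<sigma> (rank e) = e" by auto
qed

lemma rank_\<sigma>: "0 \<le> r \<Longrightarrow> r < P \<Longrightarrow> rank (\<sigma> r) = r"
  using rank[of "\<sigma> r"] \<sigma>_range[of r] \<sigma>_inj by (auto dest: inj_onD)

definition answer :: "int \<Rightarrow> int" where
  "answer t = Min ((\<lambda>k. max (rank (t div n * n + k)) (rank ((n + t mod n) * n + k))) ` {0..<n})"

definition hit :: "int \<Rightarrow> int \<Rightarrow> bool" where
  "hit t w \<longleftrightarrow> (\<exists>k. 0 \<le> k \<and> k < n \<and> rank (t div n * n + k) < w \<and> rank ((n + t mod n) * n + k) < w)"

lemma hit_iff: "hit t w \<longleftrightarrow> answer t < w"
proof -
  have "{0..<n} \<noteq> {}" using n by auto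
  then have "answer t < w \<longleftrightarrow>
    (\<exists>k\<in>{0..<n}. max (rank (t div n * n + k)) (rank ((n + t mod n) * n + k)) < w)"
    unfolding answer_def by (subst Min_less_iff) auto
  then show ?thesis unfolding hit_def by auto
qed

text \<open>Ranks refine the order of the keys, that is, \<open>K\<close> is monotone along
  \<open>\<sigma>\<close>. Hence a maximum of ranks is sent to the maximum of the keys, and likewise
  for the minimum, with ties doing no harm.\<close>

lemma answer_bounds:
  assumes "0 \<le> t" "t < m"
  shows "0 \<le> answer t" "answer t < P"
    "K (\<sigma> (answer t)) = Min ((\<lambda>k. max (K (t div n * n + k)) (K ((n + t mod n) * n + k))) ` {0..<n})"
proof -
  let ?f = "\<lambda>k. max (rank (t div n * n + k)) (rank ((n + t mod n) * n + k))"
  let ?g = "\<lambda>k. max (K (t div n * n + k)) (K ((n + t mod n) * n + k))"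
  have ne: "{0..<n} \<noteq> {}" using n by auto
  note tb = pair_bounds[OF assms]
  have e: "0 \<le> t div n * n + k" "t div n * n + k < P" "0 \<le> (n + t mod n) * n + k" "(n + t mod n) * n + k < P"
    if "0 \<le> k" "k < n" for k
    using line_bounds[of "t div n" k] line_bounds[of "n + t mod n" k] tb that n by auto
  have f: "0 \<le> ?f k \<and> ?f k < P \<and> K (\<sigma> (?f k)) = ?g k" if "0 \<le> k" "k < n" for k
  proof -
    note r1 = rank[OF e(1,2)[OF that]] and r2 = rank[OF e(3,4)[OF that]]
    show ?thesis
    proof (cases "rank (t div n * n + k) \<le> rank ((n + t mod n) * n + k)")
      case True
      then show ?thesis using r1 r2 \<sigma>_mono[OF r1(1) True r2(2)] by (simp add: max_def)
    next
      case False
      then have "rank ((n + t mod n) * n + k) \<le> rank (t div n * n + k)" by simp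
      then show ?thesis using r1 r2 \<sigma>_mono[OF r2(1) _ r1(2)] False by (auto simp: max_def)
    qed
  qed
  have "answer t \<in> ?f ` {0..<n}" unfolding answer_def using ne by (intro Min_in) auto
  then obtain k0 where k0: "0 \<le> k0" "k0 < n" "answer t = ?f k0" by auto
  show a: "0 \<le> answer t" "answer t < P" using f[OF k0(1,2)] k0(3) by auto
  have min: "answer t \<le> ?f k" if "0 \<le> k" "k < n" for k
    unfolding answer_def using that by (intro Min_le) auto
  show "K (\<sigma> (answer t)) = Min (?g ` {0..<n})"
  proof (rule Min_eqI[symmetric])
    show "K (\<sigma> (answer t)) \<in> ?g ` {0..<n}"
      using f[OF k0(1,2)] k0 by (intro image_eqI[of _ _ k0]) auto
    fix y assume "y \<in> ?g ` {0..<n}"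
    then obtain k where k: "0 \<le> k" "k < n" "y = ?g k" by auto
    then show "K (\<sigma> (answer t)) \<le> y" using f[OF k(1,2)] \<sigma>_mono[OF a(1) min[OF k(1,2)]] by auto
  qed simp
qed

end

text \<open>The contents are specified at slots only, but \<open>item_range\<close> is required
  everywhere: query arrays may contain filler cells from beyond the lines, and these must be small
  words too.\<close>

locale buckets = sorting +
  fixes item rk :: "int \<Rightarrow> int"
  assumes item: "\<And>r. 0 \<le> r \<Longrightarrow> r < P \<Longrightarrow> item (slot r) = \<sigma> r mod n"
    and rk: "\<And>r. 0 \<le> r \<Longrightarrow> r < P \<Longrightarrow> rk (slot r) = r"
    and item_range: "\<And>x. 0 \<le> item x \<and> item x < n"
begin

lemma slot_obtain:
  assumes "0 \<le> l" "l < 2 * n" "0 \<le> q" "q < n"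
  obtains r where "0 \<le> r" "r < P" "\<sigma> r div n = l" "cnt l r = q" "slot r = l * n + q"
proof -
  have "q < cnt l (int (nat P))" using assms cnt_full W_bounds by simp
  from cnt_onto[OF assms(3) this] obtain r where "0 \<le> r" "r < P" "\<sigma> r div n = l" "cnt l r = q"
    using W_bounds by auto
  then show ?thesis using that by (simp add: slot_def)
qed

text \<open>Ranks increase along a line, so the predicate is monotone in \<open>x\<close> and a
  binary search can find the count. Positions run from 1 here, which leaves 0 for the empty
  prefix.\<close>

lemma rk_less_iff:
  assumes "0 \<le> l" "l < 2 * n" "1 \<le> x" "x \<le> n"
  shows "rk (l * n + x - 1) < w \<longleftrightarrow> x \<le> cnt l w"
proof -
  obtain r where r: "0 \<le> r" "r < P" "\<sigma> r div n = l" "cnt l r = x - 1" "slot r = l * n + x - 1"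
    using slot_obtain[of l "x - 1"] assms by (auto simp: algebra_simps)
  have "rk (l * n + x - 1) = r" using rk[OF r(1,2)] r(5) by simp
  moreover have "r < w \<longleftrightarrow> x \<le> cnt l w"
  proof
    assume "r < w"
    then show "x \<le> cnt l w" using cnt_strict[OF r(1)] r(3,4) by fastforce
  next
    assume "x \<le> cnt l w"
    then show "r < w" using cnt_mono[of w r l] r(4) by linarith
  qed
  ultimately show ?thesis by simp
qed

text \<open>Comparing the rank of an entry with a threshold is traded for membership of its index in
  a contiguous range of \<open>item\<close>, the only kind of set that a query can speak
  about.\<close>

lemma item_prefix:
  assumes "0 \<le> l" "l < 2 * n" "w \<le> P" "0 \<le> k" "k < n"
  shows "rank (l * n + k) < w \<longleftrightarrow> (\<exists>q. 0 \<le> q \<and> q < cnt l w \<and> item (l * n + q) = k)"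
proof
  note lb = line_bounds[OF assms(1,2,4,5)]
  let ?r = "rank (l * n + k)"
  note r = rank[OF lb(1,4)]
  assume "?r < w"
  then have "cnt l ?r < cnt l w" using cnt_strict[OF r(1)] r(3) lb(5) by simp
  moreover have "item (l * n + cnt l ?r) = k"
    using item[OF r(1,2)] r(3) lb(5,6) by (simp add: slot_def)
  ultimately show "\<exists>q. 0 \<le> q \<and> q < cnt l w \<and> item (l * n + q) = k" using cnt_nonneg by blast
next
  assume "\<exists>q. 0 \<le> q \<and> q < cnt l w \<and> item (l * n + q) = k"
  then obtain q where q: "0 \<le> q" "q < cnt l w" "item (l * n + q) = k" by blast
  then have "q < n" using cnt_le[OF assms(3), of l] by linarith
  from slot_obtain[OF assms(1,2) q(1) this] obtain r where
    r: "0 \<le> r" "r < P" "\<sigma> r div n = l" "cnt l r = q" "slot r = l * n + q" by blast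
  have "\<sigma> r mod n = k" using item[OF r(1,2)] r(5) q(3) by simp
  then have "\<sigma> r = l * n + k" using r(3) div_mult_mod_eq[of "\<sigma> r" n] by simp
  then have "rank (l * n + k) = r" using rank_\<sigma>[OF r(1,2)] by simp
  moreover have "r < w" using q(2) r(4) cnt_mono[of w r l] by linarith
  ultimately show "rank (l * n + k) < w" by simp
qed

text \<open>Injectivity of \<open>\<sigma>\<close> lets an index occur only once along a line. With
  \<open>2 \<le> n\<close> this supplies two unequal neighbours for the default query.\<close>

lemma item_distinct:
  assumes "0 \<le> l" "l < 2 * n"
  shows "item (l * n) \<noteq> item (l * n + 1)"
proof
  assume eq: "item (l * n) = item (l * n + 1)"
  obtain r where r: "0 \<le> r" "r < P" "\<sigma> r div n = l" "cnt l r = 0" "slot r = l * n + 0"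
    using slot_obtain[OF assms, of 0] n by auto
  obtain r' where r': "0 \<le> r'" "r' < P" "\<sigma> r' div n = l" "cnt l r' = 1" "slot r' = l * n + 1"
    using slot_obtain[OF assms, of 1] n by auto
  have "\<sigma> r mod n = \<sigma> r' mod n" using item r r' eq by (metis add_0_right)
  then have "\<sigma> r = \<sigma> r'" using r(3) r'(3) by (metis div_mult_mod_eq)
  then have "r = r'" using \<sigma>_inj r r' by (auto dest: inj_onD)
  then show False using r(4) r'(4) by simp
qed

lemma hit_iff_prefixes:
  assumes "0 \<le> t" "t < m" "w \<le> P"
  shows "hit t w \<longleftrightarrow> (\<exists>q q'. 0 \<le> q \<and> q < cnt (t div n) w \<and> 0 \<le> q' \<and> q' < cnt (n + t mod n) w \<and>
    item (t div n * n + q) = item ((n + t mod n) * n + q'))"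
proof -
  note tb = pair_bounds[OF assms(1,2)]
  have l: "t div n < 2 * n" "0 \<le> n + t mod n" "n + t mod n < 2 * n" using tb n by auto
  have "hit t w \<longleftrightarrow> (\<exists>k. 0 \<le> k \<and> k < n \<and>
      (\<exists>q. 0 \<le> q \<and> q < cnt (t div n) w \<and> item (t div n * n + q) = k) \<and>
      (\<exists>q. 0 \<le> q \<and> q < cnt (n + t mod n) w \<and> item ((n + t mod n) * n + q) = k))"
    unfolding hit_def using item_prefix[OF tb(1) l(1) assms(3)] item_prefix[OF l(2,3) assms(3)]
    by (simp cong: conj_cong)
  also have "\<dots> \<longleftrightarrow> (\<exists>q q'. 0 \<le> q \<and> q < cnt (t div n) w \<and> 0 \<le> q' \<and> q' < cnt (n + t mod n) w \<and>
    item (t div n * n + q) = item ((n + t mod n) * n + q'))" (is "?L \<longleftrightarrow> ?R")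
  proof
    assume ?R
    then obtain q q' where "0 \<le> q" "q < cnt (t div n) w" "0 \<le> q'" "q' < cnt (n + t mod n) w"
      "item (t div n * n + q) = item ((n + t mod n) * n + q')" by blast
    \<comment> \<open>A common value of the two prefixes is an index of the product only because
      \<open>item\<close> takes values below n.\<close>
    then show ?L using item_range[of "t div n * n + q"]
      by (intro exI[of _ "item (t div n * n + q)"]) auto
  next
    assume ?L
    then obtain k q q' where "0 \<le> q" "q < cnt (t div n) w" "item (t div n * n + q) = k"
      "0 \<le> q'" "q' < cnt (n + t mod n) w" "item ((n + t mod n) * n + q') = k" by blast
    then show ?R by - (rule exI[of _ q], rule exI[of _ q'], simp)
  qed
  finally show ?thesis .
qed

end

text \<open>The step of both binary searches. Their lower bound is always the target
  \<open>v\<close> rounded down to a multiple of the current step; halving the step adds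
  \<open>S\<close> iff the midpoint does not exceed \<open>v\<close>.\<close>

lemma binary_step:
  fixes v S :: int
  assumes "1 \<le> S"
  shows "v div (2 * S) * (2 * S) + of_bool (v div (2 * S) * (2 * S) + S \<le> v) * S = v div S * S"
proof -
  define q r where "q = v div (2 * S)" and "r = v mod (2 * S)"
  have v: "v = S * (2 * q) + r" "0 \<le> r" "r < 2 * S"
    using assms mult_div_mod_eq[of "2 * S" v] unfolding q_def r_def by (simp_all add: mult.assoc mult.left_commute)
  have "v div S = 2 * q + r div S" unfolding v(1) using assms by simp
  moreover have "r div S = of_bool (S \<le> r)"
  proof (cases "S \<le> r")
    case True
    then have "r div S = (S + (r - S)) div S" by simp
    also have "\<dots> = 1" using assms v True by (subst div_add_self1) auto
    finally show ?thesis using True by simp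
  qed (use v in auto)
  moreover have "v div (2 * S) * (2 * S) + S \<le> v \<longleftrightarrow> S \<le> r"
    unfolding q_def[symmetric] using v(1) by (simp add: algebra_simps)
  ultimately show ?thesis unfolding q_def[symmetric] by (simp add: algebra_simps)
qed

section \<open>Preparing the search\<close>

lemmas machine_simps = wp.simps safe.simps ev.simps apply_binop.simps fun_upd_apply if_True if_False
  simp_thms rel_simps abs_one abs_numeral abs_zero

definition setup_body :: prog where
  "setup_body = block [
     Set 23 (Lt (Var rP) (Var rM \<boxplus> Var rM)),
     Set rP (Var rP \<boxplus> Var 23 \<boxtimes> Var rP),
     Set rL (Var rL \<boxplus> Var 23)]"

definition setup_prog :: prog where
  "setup_prog = Seq (block [Set rM (Var rN \<boxtimes> Var rN), Set rH (Var rN \<boxslash> Num 2), Set rP (Num 1), Set rL (Num 0)])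
     (For 10 11 (Var rM \<boxplus> Var rM) setup_body)"

lemma setup_prog_correct:
  assumes n: "2 \<le> n" and m: "m = n * n" and W: "64 * (4 * m) + 64 \<le> W" and r: "\<rho> rN = n"
  shows "triple W setup_prog (nat m * 100 + 50) \<rho> \<mu> (\<lambda>\<rho>' \<mu>'. \<mu>' = \<mu> \<and>
    (\<exists>L. sizes n m (n div 2) (2 ^ L) W L \<and> \<rho>' rN = n \<and> \<rho>' rM = m \<and> \<rho>' rH = n div 2 \<and>
      \<rho>' rP = 2 ^ L \<and> \<rho>' rL = int L))" (is "triple W _ _ _ _ ?Q")
proof -
  have nm: "2 * n \<le> m" unfolding m using n by (intro mult_right_mono) auto
  have W': "1 \<le> W" "m \<le> W" "n \<le> W" "2 * m \<le> W" "4 * m \<le> W" using W nm n by linarith+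
  \<comment> \<open>Either the power has reached \<open>2 * m\<close> or every iteration so far has
    doubled it, and \<open>i < 2 ^ i\<close> makes \<open>2 * m\<close> iterations enough. Doubling
    happens only below \<open>2 * m\<close>, which keeps the power below
    \<open>4 * m\<close>.\<close>
  define I where "I k \<rho>' \<mu>' \<longleftrightarrow> \<mu>' = \<mu> \<and> (\<exists>i. \<rho>' rL = int i \<and> \<rho>' rP = 2 ^ i \<and> 2 ^ i < 4 * m \<and>
      (2 * m \<le> 2 ^ i \<or> int i = k)) \<and> \<rho>' rN = n \<and> \<rho>' rM = m \<and> \<rho>' rH = n div 2"
    for k :: int and \<rho>' :: "nat \<Rightarrow> int" and \<mu>'
  show ?thesis unfolding setup_prog_def
  proof (rule triple_Seq)
    have "n div 2 \<le> W" "0 \<le> n div 2" using n W' by linarith+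
    then show "triple W (block [Set rM (Var rN \<boxtimes> Var rN), Set rH (Var rN \<boxslash> Num 2), Set rP (Num 1), Set rL (Num 0)])
      25 \<rho> \<mu> (\<lambda>\<rho>' \<mu>'. \<rho>' = \<rho>(rM := m, rH := n div 2, rP := 1, rL := 0) \<and> \<mu>' = \<mu>)"
      by (intro triple_block) (use r m W' n in auto)
  next
    fix \<rho>1 \<mu>1 assume 1: "\<rho>1 = \<rho>(rM := m, rH := n div 2, rP := 1, rL := 0) \<and> \<mu>1 = \<mu>"
    show "triple W (For 10 11 (Var rM \<boxplus> Var rM) setup_body)
      (nat (2 * m) * (40 + 6) + cost (Var rM \<boxplus> Var rM) + 5) \<rho>1 \<mu>1 ?Q"
    proof (rule triple_For[where I=I])
      show "I 0 (\<rho>1(11 := 2 * m, 10 := 0)) \<mu>1" using 1 nm n r by (auto simp: I_def intro!: exI[of _ 0])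
    next
      fix k \<rho>' \<mu>' assume k: "0 \<le> k" "k < 2 * m" "\<rho>' 10 = k" "\<rho>' 11 = 2 * m" "I k \<rho>' \<mu>'"
      from k(5) obtain i where i: "\<rho>' rL = int i" "\<rho>' rP = 2 ^ i" "2 ^ i < 4 * m" "2 * m \<le> 2 ^ i \<or> int i = k"
        and s: "\<mu>' = \<mu>" "\<rho>' rN = n" "\<rho>' rM = m" "\<rho>' rH = n div 2" unfolding I_def by blast
      have ib: "int i < 2 ^ i" by (metis of_nat_less_two_power)
      define i' where "i' = (if 2 ^ i < 2 * m then Suc i else i)"
      define tk :: int where "tk = of_bool ((2::int) ^ i < 2 * m)"
      have I': "I (k + 1) (\<rho>'(23 := tk, rP := 2 ^ i', rL := int i', 10 := k + 1)) \<mu>"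
        unfolding I_def using i s by (auto simp: i'_def)
      have eqs: "2 ^ i + tk * 2 ^ i = (2 ^ i' :: int)" "int i + tk = int i'"
        by (auto simp: i'_def tk_def)
      have b: "\<bar>(2::int) ^ i'\<bar> \<le> W" "\<bar>int i'\<bar> \<le> W" "\<bar>tk * (2::int) ^ i\<bar> \<le> W"
        using i(3) ib W' unfolding i'_def tk_def by (cases "2 ^ i < 2 * m"; simp; linarith)+
      have mm: "\<bar>2 * m\<bar> \<le> W" "2 * m \<le> W" "2 ^ i' \<le> W" using W' nm n b by simp_all
      show "triple W setup_body 40 \<rho>' \<mu>'
        (step_post 10 11 k (2 * m) I)"
        unfolding setup_body_def using I' b(2) k
        by - (rule triple_block, simp add: s i(1,2) mm eqs b tk_def[symmetric], use W' in auto)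
    next
      fix \<rho>' \<mu>' assume "I (2 * m) \<rho>' \<mu>'"
      then obtain i where i: "\<rho>' rL = int i" "\<rho>' rP = 2 ^ i" "2 ^ i < 4 * m" "2 * m \<le> 2 ^ i \<or> int i = 2 * m"
        and s: "\<mu>' = \<mu>" "\<rho>' rN = n" "\<rho>' rM = m" "\<rho>' rH = n div 2" unfolding I_def by blast
      have ib: "int i < 2 ^ i" by (metis of_nat_less_two_power)
      have "sizes n m (n div 2) (2 ^ i) W i"
      proof unfold_locales
        show "2 * m \<le> 2 ^ i" using i(4) ib by linarith
      qed (use n m i(3) W ib in auto)
      then show "?Q \<rho>' \<mu>'" using s i by blast
    qed (use 1 W' nm n in auto)
  qed (use nm n in auto)
qed

text \<open>The second matrix is transposed on the way: its row-major cell
  \<open>x mod n * n + x div n\<close> goes to place \<open>x\<close>, so that columns become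
  contiguous lines. The leading 1 skips the input word n.\<close>

definition keys_body :: prog where
  "keys_body = block [
     Put aKey (Var 10) (Arr aRaw (Num 1 \<boxplus> Var 10)),
     Put aKey (Var rM \<boxplus> Var 10)
       (Arr aRaw (Num 1 \<boxplus> Var rM \<boxplus> (Var 10 \<box>% Var rN) \<boxtimes> Var rN \<boxplus> Var 10 \<boxslash> Var rN))]"

definition keys_prog :: prog where
  "keys_prog = For 10 11 (Var rM) keys_body"

context sizes
begin

definition base :: "(nat \<Rightarrow> int) \<Rightarrow> bool" where
  "base \<rho> \<longleftrightarrow> \<rho> rN = n \<and> \<rho> rM = m \<and> \<rho> rH = h \<and> \<rho> rP = P \<and> \<rho> rL = int L"

lemma transpose_bounds:
  assumes "0 \<le> k" "k < m"
  shows "0 \<le> k mod n * n" "k mod n * n + k div n < m" "0 \<le> k div n" "k div n < n"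
proof -
  note t = pair_bounds[OF assms]
  show "0 \<le> k div n" "k div n < n" using t by auto
  show "0 \<le> k mod n * n" using t n by simp
  have "(k mod n + 1) * n \<le> n * n" using t(4) n by (intro mult_right_mono) linarith+
  then show "k mod n * n + k div n < m" using t unfolding m by (simp add: algebra_simps)
qed

lemma keys_prog_correct:
  assumes "base \<rho>"
  shows "triple W keys_prog (nat m * 60 + 20) \<rho> \<mu> (\<lambda>\<rho>' \<mu>'. (\<exists>K. \<mu>' = \<mu>(aKey := K) \<and>
    (\<forall>x. 0 \<le> x \<and> x < m \<longrightarrow> K x = \<mu> aRaw (1 + x) \<and>
      K (m + x) = \<mu> aRaw (1 + m + x mod n * n + x div n))) \<and> agree {10, 11} \<rho>' \<rho>)"
proof -
  note Wb = W_bounds m_ge P W n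
  define I where "I k \<rho>' \<mu>' \<longleftrightarrow> (\<exists>K. \<mu>' = \<mu>(aKey := K) \<and>
    (\<forall>x. 0 \<le> x \<and> x < k \<longrightarrow> K x = \<mu> aRaw (1 + x) \<and>
      K (m + x) = \<mu> aRaw (1 + m + x mod n * n + x div n))) \<and> agree {10, 11} \<rho>' \<rho>"
    for k :: int and \<rho>' :: "nat \<Rightarrow> int" and \<mu>'
  have b: "\<rho> rN = n" "\<rho> rM = m" using assms by (auto simp: base_def)
  show ?thesis unfolding keys_prog_def
  proof (rule triple_For[where I=I and c=54])
    show "I 0 (\<rho>(11 := m, 10 := 0)) \<mu>" by (auto simp: I_def intro!: exI[of _ "\<mu> aKey"])
  next
    fix k \<rho>' \<mu>' assume k: "0 \<le> k" "k < m" "\<rho>' 10 = k" "\<rho>' 11 = m" "I k \<rho>' \<mu>'"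
    from k(5) obtain K where K: "\<mu>' = \<mu>(aKey := K)" "\<forall>x. 0 \<le> x \<and> x < k \<longrightarrow> K x = \<mu> aRaw (1 + x) \<and>
      K (m + x) = \<mu> aRaw (1 + m + x mod n * n + x div n)" and fr: "agree {10, 11} \<rho>' \<rho>"
      unfolding I_def by blast
    note t = transpose_bounds[OF k(1,2)] pair_bounds[OF k(1,2)]
    have r: "\<rho>' rN = n" "\<rho>' rM = m" using fr b by auto
    let ?K = "K(k := \<mu> aRaw (1 + k), m + k := \<mu> aRaw (1 + m + k mod n * n + k div n))"
    have I': "I (k + 1) (\<rho>'(10 := k + 1)) (\<mu>(aKey := ?K))"
      unfolding I_def
    proof (intro conjI exI[of _ ?K] allI impI)
      fix x assume "0 \<le> x \<and> x < k + 1"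
      then show "?K x = \<mu> aRaw (1 + x)" "?K (m + x) = \<mu> aRaw (1 + m + x mod n * n + x div n)"
        using K(2) k by (cases "x = k"; force)+
    qed (use fr in auto)
    have bb: "1 + m + k mod n * n + k div n \<le> 2 * m" using t by linarith
    show "triple W keys_body 54 \<rho>' \<mu>'
      (step_post 10 11 k m I)"
      unfolding keys_body_def
    proof (rule triple_block, simp add: r k K(1), intro conjI)
      show "I (k + 1) (\<rho>'(10 := k + 1)) (\<mu>(aKey := ?K))" by (rule I')
    qed (use k t bb Wb in \<open>linarith | simp\<close>)+
  qed (use b Wb in \<open>auto simp: I_def\<close>)
qed

end

text \<open>Distributing the items in order of rank leaves every line sorted. When rank
  \<open>k\<close> is reached, \<open>aFill\<close> of a line equals \<open>cnt\<close> of that line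
  at \<open>k\<close>, so the cell written is \<open>slot k\<close>.\<close>

definition bucket_body :: prog where
  "bucket_body = block [
     Set 20 (Arr aSrc (Var 10)),
     Set 21 (Var 20 \<boxslash> Var rN),
     Set 22 (Var 21 \<boxtimes> Var rN \<boxplus> Arr aFill (Var 21)),
     Put aItem (Var 22) (Var 20 \<box>% Var rN),
     Put aRank (Var 22) (Var 10),
     Put aFill (Var 21) (Arr aFill (Var 21) \<boxplus> Num 1)]"

definition bucket_prog :: prog where
  "bucket_prog = For 10 11 (Var rP) bucket_body"

text \<open>Starting from a zero \<open>aItem\<close> gives \<open>item_range\<close> also at the
  cells that no item reaches.\<close>

lemma (in sorting) bucket_prog_correct:
  assumes "base \<rho>" and \<mu>: "\<mu> aSrc = \<sigma>" "\<mu> aItem = (\<lambda>_. 0)" "\<mu> aRank = (\<lambda>_. 0)" "\<mu> aFill = (\<lambda>_. 0)"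
  shows "triple W bucket_prog (nat P * 110 + 20) \<rho> \<mu> (\<lambda>\<rho>' \<mu>'. (\<exists>item rk fill.
    \<mu>' = \<mu>(aItem := item, aRank := rk, aFill := fill) \<and> buckets n m h P W L K \<sigma> item rk) \<and>
    agree {10, 11, 20, 21, 22} \<rho>' \<rho>)" (is "triple W _ _ _ _ ?Q")
proof -
  note Wb = W_bounds m_ge P(2,3) W n
  have b: "\<rho> rN = n" "\<rho> rP = P" using assms by (auto simp: base_def)
  define I where "I k \<rho>' \<mu>' \<longleftrightarrow> (\<exists>item rk fill. \<mu>' = \<mu>(aItem := item, aRank := rk, aFill := fill) \<and>
    (\<forall>l. fill l = cnt l k) \<and> (\<forall>r. 0 \<le> r \<and> r < k \<longrightarrow> item (slot r) = \<sigma> r mod n \<and> rk (slot r) = r) \<and>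
    (\<forall>x. 0 \<le> item x \<and> item x < n)) \<and> agree {10, 11, 20, 21, 22} \<rho>' \<rho>"
    for k :: int and \<rho>' :: "nat \<Rightarrow> int" and \<mu>'
  show ?thesis unfolding bucket_prog_def
  proof (rule triple_For[where I=I and c=104])
    have "\<mu>(aItem := \<mu> aItem, aRank := \<mu> aRank, aFill := \<mu> aFill) = \<mu>" by simp
    then show "I 0 (\<rho>(11 := P, 10 := 0)) \<mu>" unfolding I_def using \<mu> n
      by - (rule conjI, rule exI[of _ "\<mu> aItem"], rule exI[of _ "\<mu> aRank"], rule exI[of _ "\<mu> aFill"], auto)
  next
    fix k \<rho>' \<mu>' assume k: "0 \<le> k" "k < P" "\<rho>' 10 = k" "\<rho>' 11 = P" "I k \<rho>' \<mu>'"
    from k(5) obtain item rk fill where s: "\<mu>' = \<mu>(aItem := item, aRank := rk, aFill := fill)"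
      "\<And>l. fill l = cnt l k" "\<And>r. 0 \<le> r \<Longrightarrow> r < k \<Longrightarrow> item (slot r) = \<sigma> r mod n \<and> rk (slot r) = r"
      "\<And>x. 0 \<le> item x \<and> item x < n" and fr: "agree {10, 11, 20, 21, 22} \<rho>' \<rho>"
      unfolding I_def by blast
    have r: "\<rho>' rN = n" using fr b by auto
    let ?l = "\<sigma> k div n"
    let ?item = "item(slot k := \<sigma> k mod n)" and ?rk = "rk(slot k := k)" and ?fill = "fill(?l := fill ?l + 1)"
    have I': "I (k + 1) (\<rho>'(20 := \<sigma> k, 21 := ?l, 22 := slot k, 10 := k + 1))
      (\<mu>(aItem := ?item, aRank := ?rk, aFill := ?fill))"
      unfolding I_def
    proof (rule conjI, rule exI[of _ ?item], rule exI[of _ ?rk], rule exI[of _ ?fill], intro conjI allI impI)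
      show "?fill l = cnt l (k + 1)" for l using s(2) cnt_Suc[OF k(1)] by auto
      fix r assume r: "0 \<le> r \<and> r < k + 1"
      have "slot r \<noteq> slot k" if "r \<noteq> k" using slot_inj[of r k] r k that by auto
      then show "?item (slot r) = \<sigma> r mod n" "?rk (slot r) = r" using s(3)[of r] r by fastforce+
    next
      show "0 \<le> ?item x" "?item x < n" for x using s(4) n by auto
    qed (use fr in auto)
    have slot: "?l * n + fill ?l = slot k" by (simp add: slot_def s(2))
    note sb = slot_nonneg[OF k(1,2)] slot_bound[OF k(1,2)] \<sigma>_range[OF k(1,2)] cnt_less[OF k(1,2)] cnt_nonneg[of ?l k]
    have l: "0 \<le> ?l" "?l \<le> \<sigma> k" "?l * n \<le> slot k" "0 \<le> ?l * n"
      using sb n zdiv_mono2[of "\<sigma> k" 1 n] by (auto simp: pos_imp_zdiv_nonneg_iff slot_def)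
    have md: "0 \<le> \<sigma> k mod n" "\<sigma> k mod n < n" using n by auto
    have bb: "?l \<le> W" "slot k \<le> W" "1 \<le> W" "\<bar>?l\<bar> \<le> W" "0 \<le> ?l" "16 * ?l + 16 \<le> W" "\<bar>?l * n\<bar> \<le> W" "0 \<le> slot k" "\<bar>slot k\<bar> \<le> W"
      "16 * slot k + 16 \<le> W" "\<bar>\<sigma> k mod n\<bar> \<le> W" "\<bar>fill ?l + 1\<bar> \<le> W" "16 * k + 16 \<le> W"
      using sb l md k Wb unfolding s(2) by linarith+
    show "triple W bucket_body 104 \<rho>' \<mu>'
      (step_post 10 11 k P I)"
      unfolding bucket_body_def using I'
      by - (rule triple_block, simp add: r s(1) k \<mu>(1) slot fun_upd_twist bb, use Wb in auto)
  next
    fix \<rho>' \<mu>' assume "I P \<rho>' \<mu>'"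
    then obtain item rk fill where "\<mu>' = \<mu>(aItem := item, aRank := rk, aFill := fill)"
      "buckets_axioms n P \<sigma> item rk" "agree {10, 11, 20, 21, 22} \<rho>' \<rho>"
      unfolding I_def buckets_axioms_def by blast
    then show "?Q \<rho>' \<mu>'"
      using sorting_axioms by (auto simp: buckets_def)
  qed (use b Wb in auto)
qed


text \<open>Binary search for a prefix length with steps \<open>P div 2\<close> down to 1. The first
  factor masks the comparison beyond the end of the line, although the cell is still read.\<close>

definition count_body :: prog where
  "count_body = block [
     Set 25 (Var 25 \<boxslash> Num 2),
     Set 23 (Lt (Var 24 \<boxplus> Var 25) (Var rN \<boxplus> Num 1) \<boxtimes>
       Lt (Arr aRank (Var 26 \<boxtimes> Var rN \<boxplus> Var 24 \<boxplus> Var 25 \<boxminus> Num 1)) (Var 27)),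
     Set 24 (Var 24 \<boxplus> Var 23 \<boxtimes> Var 25)]"

definition count_prog :: prog where
  "count_prog = Seq (block [Set 24 (Num 0), Set 25 (Var rP)]) (For 14 15 (Var rL) count_body)"

lemma (in sizes) P_div_step:
  assumes "0 \<le> k" "k < int L"
  shows "P div 2 ^ nat k div 2 = P div 2 ^ nat (k + 1)" "1 \<le> P div 2 ^ nat (k + 1)"
    "P div 2 ^ nat k = 2 * (P div 2 ^ nat (k + 1))" "P div 2 ^ nat (k + 1) \<le> P"
proof -
  have s: "nat (k + 1) = Suc (nat k)" using assms by simp
  show 1: "P div 2 ^ nat k div 2 = P div 2 ^ nat (k + 1)" unfolding s
    by (simp add: zdiv_zmult2_eq mult.commute[of 2])
  have e: "P div 2 ^ i = 2 ^ (L - i)" if "i \<le> L" for i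
    using that P(1) by (simp add: power_diff)
  show "1 \<le> P div 2 ^ nat (k + 1)" using assms by (subst e) auto
  have "P div 2 ^ nat k = 2 ^ (L - nat k)" using assms by (intro e) auto
  moreover have "P div 2 ^ nat (k + 1) = 2 ^ (L - nat (k + 1))" using assms by (intro e) auto
  moreover have "L - nat k = Suc (L - nat (k + 1))" using assms by linarith
  ultimately show "P div 2 ^ nat k = 2 * (P div 2 ^ nat (k + 1))" by simp
  show "P div 2 ^ nat (k + 1) \<le> P" by (subst e) (use assms P(1) in \<open>auto intro: power_increasing\<close>)
qed

lemma (in sizes) count_prog_correct:
  assumes b: "\<rho> rN = n" "\<rho> rP = P" "\<rho> rL = int L" and l: "\<rho> 26 = l" "0 \<le> l" "l < 2 * n" and w: "\<rho> 27 = w"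
    and v: "0 \<le> v" "v \<le> n" "\<And>x. 1 \<le> x \<Longrightarrow> x \<le> n \<Longrightarrow> \<mu> aRank (l * n + x - 1) < w \<longleftrightarrow> x \<le> v"
  shows "triple W count_prog (L * 70 + 20) \<rho> \<mu> (\<lambda>\<rho>' \<mu>'. \<mu>' = \<mu> \<and> \<rho>' 24 = v \<and>
    agree {14, 15, 23, 24, 25} \<rho>' \<rho>)"
proof -
  note Wb = W_bounds m_ge P(2,3) W n
  define S where "S k = P div 2 ^ nat k" for k
  define I where "I k \<rho>' \<mu>' \<longleftrightarrow> \<mu>' = \<mu> \<and> \<rho>' 24 = v div S k * S k \<and> \<rho>' 25 = S k \<and>
    agree {14, 15, 23, 24, 25} \<rho>' \<rho>" for k :: int and \<rho>' :: "nat \<Rightarrow> int" and \<mu>'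
  have lb: "0 \<le> l * n" "l * n + n \<le> 2 * m" using line_bounds[OF l(2,3), of 0] n by auto
  show ?thesis unfolding count_prog_def
  proof (rule triple_Seq)
    show "triple W (block [Set 24 (Num 0), Set 25 (Var rP)]) 6 \<rho> \<mu>
      (\<lambda>\<rho>' \<mu>'. \<rho>' = \<rho>(24 := 0, 25 := P) \<and> \<mu>' = \<mu>)"
      by (rule triple_block) (use b Wb in auto)
  next
    fix \<rho>1 \<mu>1 assume 1: "\<rho>1 = \<rho>(24 := 0, 25 := P) \<and> \<mu>1 = \<mu>"
    show "triple W (For 14 15 (Var rL) count_body) (nat (int L) * (64 + 6) + cost (Var rL) + 5) \<rho>1 \<mu>1
     (\<lambda>\<rho>' \<mu>'. \<mu>' = \<mu> \<and> \<rho>' 24 = v \<and> agree {14, 15, 23, 24, 25} \<rho>' \<rho>)"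
    proof (rule triple_For[where I=I and N="int L"])
      \<comment> \<open>A prefix has at most n entries, fewer than \<open>P\<close>; rounded down to
        a multiple of \<open>P\<close> its length is the initial value 0.\<close>
      have "v div P = 0" using v Wb by simp
      then show "I 0 (\<rho>1(15 := int L, 14 := 0)) \<mu>1" using 1 by (simp add: I_def S_def)
    next
      fix k \<rho>' \<mu>' assume k: "0 \<le> k" "k < int L" "\<rho>' 14 = k" "\<rho>' 15 = int L" "I k \<rho>' \<mu>'"
      define s where "s = S (k + 1)"
      note PS = P_div_step[OF k(1,2), folded S_def s_def]
      define q where "q = v div (2 * s) * (2 * s)"
      have I: "\<mu>' = \<mu>" "\<rho>' 24 = q" "\<rho>' 25 = 2 * s" "agree {14, 15, 23, 24, 25} \<rho>' \<rho>"
        using k(5) PS unfolding I_def q_def by auto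
      have r: "\<rho>' rN = n" "\<rho>' 26 = l" "\<rho>' 27 = w" using I(4) b l w by auto
      have q: "0 \<le> q" "q \<le> v"
      proof -
        show "0 \<le> q" using v(1) PS(2) by (simp add: q_def pos_imp_zdiv_nonneg_iff)
        have "0 \<le> v mod (2 * s)" using PS(2) by simp
        then show "q \<le> v" using div_mult_mod_eq[of v "2 * s"] unfolding q_def by linarith
      qed
      define tk :: int where "tk = of_bool (q + s \<le> v)"
      have tk: "of_bool (q + s < n + 1) * of_bool (\<mu> aRank (l * n + q + s - 1) < w) = tk"
        using v(3)[of "q + s"] v(2) q PS(2) by (auto simp: tk_def add.assoc)
      have new: "q + tk * s = v div s * s"
        using binary_step[OF PS(2), of v] by (simp add: q_def tk_def)
      have bb: "\<bar>q + s\<bar> \<le> W" "0 \<le> l * n + q + s - 1" "16 * (l * n + q + s - 1) + 16 \<le> W"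
        "\<bar>l * n\<bar> \<le> W" "\<bar>l * n + q\<bar> \<le> W" "\<bar>l * n + q + s\<bar> \<le> W" "\<bar>l * n + q + s - 1\<bar> \<le> W" "\<bar>s\<bar> \<le> W" "s \<le> W" "\<bar>n + 1\<bar> \<le> W"
        "n + 1 \<le> W"
      proof -
        have "1 \<le> s" "s \<le> P" "0 \<le> q" "q \<le> n" "0 \<le> l * n" "l * n \<le> P"
          using q v(2) lb n P(2) by (simp_all add: PS(2,4))
        moreover define e where "e = l * n + q + s - 1"
        ultimately have "16 * e + 16 \<le> W" "\<bar>q + s\<bar> \<le> W" "0 \<le> e"
          "\<bar>l * n\<bar> \<le> W" "\<bar>l * n + q\<bar> \<le> W" "\<bar>l * n + q + s\<bar> \<le> W" "\<bar>e\<bar> \<le> W" "\<bar>s\<bar> \<le> W"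
          "s \<le> W" "\<bar>n + 1\<bar> \<le> W" "n + 1 \<le> W"
          using Wb by linarith+
        then show "\<bar>q + s\<bar> \<le> W" "0 \<le> l * n + q + s - 1" "16 * (l * n + q + s - 1) + 16 \<le> W"
          "\<bar>l * n\<bar> \<le> W" "\<bar>l * n + q\<bar> \<le> W" "\<bar>l * n + q + s\<bar> \<le> W" "\<bar>l * n + q + s - 1\<bar> \<le> W" "\<bar>s\<bar> \<le> W"
          "s \<le> W" "\<bar>n + 1\<bar> \<le> W" "n + 1 \<le> W"
          unfolding e_def by - assumption+
      qed
      have "\<bar>tk * s\<bar> \<le> W" "\<bar>tk\<bar> \<le> W" using bb Wb by (auto simp: tk_def)
      moreover have "\<bar>q + tk * s\<bar> \<le> W" using bb q v Wb by (auto simp: tk_def)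
      ultimately have b2: "\<bar>tk * s\<bar> \<le> W" "\<bar>tk\<bar> \<le> W" "\<bar>v div s * s\<bar> \<le> W" using new by auto
      have I': "I (k + 1) (\<rho>'(25 := s, 23 := tk, 24 := v div s * s, 14 := k + 1)) \<mu>"
        using I by (simp add: I_def s_def[symmetric])
      have W12: "1 \<le> W" "2 \<le> W" using Wb by linarith+
      show "triple W count_body 64 \<rho>' \<mu>'
        (step_post 14 15 k (int L) I)"
        unfolding count_body_def using PS(1)
        by - (rule triple_block, simp only: machine_simps r I(1-3) k(3,4) tk new bb b2 W12 I' nonzero_mult_div_cancel_left,
          use Wb in auto)
    next
      fix \<rho>' \<mu>' assume I: "I (int L) \<rho>' \<mu>'"
      have "S (int L) = 1" using P(1) by (simp add: S_def)
      then show "\<mu>' = \<mu> \<and> \<rho>' 24 = v \<and> agree {14, 15, 23, 24, 25} \<rho>' \<rho>"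
        using I by (simp add: I_def)
    qed (use 1 b Wb in auto)
  qed auto
qed

section \<open>Prefix lengths for all pairs\<close>

definition prep_body :: prog where
  "prep_body = Seq (block [Set 27 (Arr aLow (Var 12) \<boxplus> Var rS), Set 26 (Var 12 \<boxslash> Var rN)])
     (Seq count_prog (Seq (block [Put aX (Var 12) (Var 24), Set 26 (Var rN \<boxplus> Var 12 \<box>% Var rN)])
       (Seq count_prog (block [Put aY (Var 12) (Var 24), Put aF (Var 12) (Num 1)]))))"

definition prep_prog :: prog where
  "prep_prog = For 12 13 (Var rM) prep_body"

abbreviation (input) prep_regs :: "nat set" where
  "prep_regs \<equiv> {12, 13, 14, 15, 23, 24, 25, 26, 27}"

lemma (in buckets) count_prog_cnt:
  assumes "base \<rho>" "\<mu> aRank = rk" "\<rho> 26 = l" "0 \<le> l" "l < 2 * n" "\<rho> 27 = w" "w \<le> P"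
  shows "triple W count_prog (L * 70 + 20) \<rho> \<mu> (\<lambda>\<rho>' \<mu>'. \<mu>' = \<mu> \<and> \<rho>' 24 = cnt l w \<and>
    agree {14, 15, 23, 24, 25} \<rho>' \<rho>)"
  using assms rk_less_iff[OF assms(4,5)] cnt_nonneg cnt_le[OF assms(7)]
  by (intro count_prog_correct) (auto simp: base_def)

text \<open>\<open>lo t\<close> is the midpoint tested in this round, the lower bound plus the
  current step. Each pair needs two binary searches, one in its row and one in its column.\<close>

lemma (in buckets) prep_prog_correct:
  assumes "base \<rho>" "\<mu> aRank = rk" "\<rho> rS = S" and lo: "\<And>t. 0 \<le> t \<Longrightarrow> t < m \<Longrightarrow> lo t = \<mu> aLow t + S \<and> 0 \<le> lo t \<and> lo t \<le> P"
  shows "triple W prep_prog (nat m * (L * 140 + 110) + 20) \<rho> \<mu> (\<lambda>\<rho>' \<mu>'. (\<exists>X Y F.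
    \<mu>' = \<mu>(aX := X, aY := Y, aF := F) \<and>
    (\<forall>t. 0 \<le> t \<and> t < m \<longrightarrow> X t = cnt (t div n) (lo t) \<and> Y t = cnt (n + t mod n) (lo t) \<and> F t = 1)) \<and>
    agree prep_regs \<rho>' \<rho>)"
proof -
  note Wb = W_bounds m_ge P(2,3) W n
  define I where "I k \<rho>' \<mu>' \<longleftrightarrow> (\<exists>X Y F. \<mu>' = \<mu>(aX := X, aY := Y, aF := F) \<and>
    (\<forall>t. 0 \<le> t \<and> t < k \<longrightarrow> X t = cnt (t div n) (lo t) \<and> Y t = cnt (n + t mod n) (lo t) \<and> F t = 1)) \<and>
    agree prep_regs \<rho>' \<rho>" for k :: int and \<rho>' :: "nat \<Rightarrow> int" and \<mu>'
  show ?thesis unfolding prep_prog_def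
  proof (rule triple_For[where I=I and c="L * 140 + 104"])
    show "I 0 (\<rho>(13 := m, 12 := 0)) \<mu>" unfolding I_def
      by (rule conjI, rule exI[of _ "\<mu> aX"], rule exI[of _ "\<mu> aY"], rule exI[of _ "\<mu> aF"]) auto
  next
    fix k \<rho>' \<mu>' assume k: "0 \<le> k" "k < m" "\<rho>' 12 = k" "\<rho>' 13 = m" "I k \<rho>' \<mu>'"
    from k(5) obtain X Y F where \<mu>': "\<mu>' = \<mu>(aX := X, aY := Y, aF := F)" and
      XY: "\<And>t. 0 \<le> t \<Longrightarrow> t < k \<Longrightarrow> X t = cnt (t div n) (lo t) \<and> Y t = cnt (n + t mod n) (lo t) \<and> F t = 1"
      and fr: "agree prep_regs \<rho>' \<rho>" unfolding I_def by blast
    note t = pair_bounds[OF k(1,2)]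
    have b: "base \<rho>'" using fr assms(1) by (simp add: base_def)
    have r: "\<rho>' rN = n" "\<rho>' rS = S" using fr assms(1,3) by (auto simp: base_def)
    let ?i = "k div n" and ?j = "n + k mod n" and ?w = "lo k"
    have w: "\<mu>' aLow k + S = ?w" "\<bar>?w\<bar> \<le> W" "?w \<le> P" using lo[OF k(1,2)] \<mu>' Wb by auto
    have kW: "16 * k + 16 \<le> W" "\<bar>?j\<bar> \<le> W" "\<bar>?i\<bar> \<le> W" "\<bar>k mod n\<bar> \<le> W" using k t Wb by linarith+
    let ?x = "cnt ?i ?w" and ?y = "cnt ?j ?w"
    have xy: "\<bar>?x\<bar> \<le> W" "\<bar>?y\<bar> \<le> W" using cnt_le[OF w(3), of ?i] cnt_nonneg[of ?i ?w]
        cnt_le[OF w(3), of ?j] cnt_nonneg[of ?j ?w] Wb by linarith+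
    show "triple W prep_body (L * 140 + 104) \<rho>' \<mu>'
      (step_post 12 13 k m I)"
      unfolding prep_body_def
    proof (rule triple_Seq)
      show "triple W (block [Set 27 (Arr aLow (Var 12) \<boxplus> Var rS), Set 26 (Var 12 \<boxslash> Var rN)]) 20 \<rho>' \<mu>'
        (\<lambda>\<rho>1 \<mu>1. \<rho>1 = \<rho>'(27 := ?w, 26 := ?i) \<and> \<mu>1 = \<mu>')"
        by (rule triple_block) (use k r w kW Wb in auto)
    next
      fix \<rho>1 \<mu>1 assume 1: "\<rho>1 = \<rho>'(27 := ?w, 26 := ?i) \<and> \<mu>1 = \<mu>'"
      show "triple W (Seq count_prog (Seq (block [Put aX (Var 12) (Var 24), Set 26 (Var rN \<boxplus> Var 12 \<box>% Var rN)])
        (Seq count_prog (block [Put aY (Var 12) (Var 24), Put aF (Var 12) (Num 1)])))) (L * 140 + 84) \<rho>1 \<mu>1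
        (step_post 12 13 k m I)"
      proof (rule triple_Seq, rule count_prog_cnt[where l="?i" and w="?w"])
        show "base \<rho>1" using b 1 by (simp add: base_def)
      next
        fix \<rho>2 \<mu>2 assume 2: "\<mu>2 = \<mu>1 \<and> \<rho>2 24 = ?x \<and> agree {14, 15, 23, 24, 25} \<rho>2 \<rho>1"
        then have r2: "\<rho>2 12 = k" "\<rho>2 rN = n" "\<rho>2 24 = ?x" using 1 k r by auto
        show "triple W (Seq (block [Put aX (Var 12) (Var 24), Set 26 (Var rN \<boxplus> Var 12 \<box>% Var rN)])
          (Seq count_prog (block [Put aY (Var 12) (Var 24), Put aF (Var 12) (Num 1)]))) (L * 70 + 60) \<rho>2 \<mu>2
          (step_post 12 13 k m I)"
        proof (rule triple_Seq)
          show "triple W (block [Put aX (Var 12) (Var 24), Set 26 (Var rN \<boxplus> Var 12 \<box>% Var rN)]) 20 \<rho>2 \<mu>2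
            (\<lambda>\<rho>3 \<mu>3. \<rho>3 = \<rho>2(26 := ?j) \<and> \<mu>3 = \<mu>2(aX := (\<mu>2 aX)(k := ?x)))"
            by (rule triple_block) (use k r2 kW Wb in auto)
        next
          fix \<rho>3 \<mu>3 assume 3: "\<rho>3 = \<rho>2(26 := ?j) \<and> \<mu>3 = \<mu>2(aX := (\<mu>2 aX)(k := ?x))"
          show "triple W (Seq count_prog (block [Put aY (Var 12) (Var 24), Put aF (Var 12) (Num 1)])) (L * 70 + 40) \<rho>3 \<mu>3
            (step_post 12 13 k m I)"
          proof (rule triple_Seq, rule count_prog_cnt[where l="?j" and w="?w"])
            show "base \<rho>3" using b 1 2 3 by (simp add: base_def)
          next
            fix \<rho>4 \<mu>4 assume 4: "\<mu>4 = \<mu>3 \<and> \<rho>4 24 = ?y \<and> agree {14, 15, 23, 24, 25} \<rho>4 \<rho>3"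
            then have r4: "\<rho>4 12 = k" "\<rho>4 24 = ?y" "\<rho>4 13 = m" using 1 2 3 k by auto
            have fr4: "agree prep_regs \<rho>4 \<rho>" using 1 2 3 4 fr by simp
            have \<mu>4: "\<mu>4 = \<mu>(aX := X(k := ?x), aY := Y, aF := F)"
              using 1 2 3 4 \<mu>' by (auto simp: fun_eq_iff)
            have "\<mu>4(aY := (\<mu>4 aY)(k := ?y), aF := (\<mu>4 aF)(k := 1)) =
              \<mu>(aX := X(k := ?x), aY := Y(k := ?y), aF := F(k := 1))"
              unfolding \<mu>4 by (auto simp: fun_eq_iff)
            then have I': "I (k + 1) (\<rho>4(12 := k + 1)) (\<mu>4(aY := (\<mu>4 aY)(k := ?y), aF := (\<mu>4 aF)(k := 1)))"
              unfolding I_def using XY fr4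
              by - (rule conjI, rule exI[of _ "X(k := ?x)"], rule exI[of _ "Y(k := ?y)"], rule exI[of _ "F(k := 1)"], auto)
            show "triple W (block [Put aY (Var 12) (Var 24), Put aF (Var 12) (Num 1)]) 20 \<rho>4 \<mu>4
              (step_post 12 13 k m I)"
              by (rule triple_block) (use k r4 kW Wb I' in auto)
          qed (use 1 2 3 \<mu>' assms t w in auto)
        qed auto
      qed (use 1 \<mu>' assms t w in auto)
    qed auto
  next
    show "nat m * ((L * 140 + 104) + 6) + cost (Var rM) + 5 \<le> nat m * (L * 140 + 110) + 20"
      by (simp add: add.commute)
  qed (use assms Wb in \<open>auto simp: base_def I_def\<close>)
qed

section \<open>One call of the query solver\<close>

text \<open>Serves both encodings made of blocks of constant length: the queries with four words
  each and the matrices with n words per row.\<close>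

lemma concat_map_const:
  assumes "\<And>t. t < N \<Longrightarrow> length (f t) = c"
  shows "length (concat (map f [0..<N])) = N * c"
    and "t < N \<Longrightarrow> i < c \<Longrightarrow> concat (map f [0..<N]) ! (t * c + i) = f t ! i"
proof -
  have "length (concat (map f [0..<N])) = N * c \<and>
    (\<forall>t<N. \<forall>i<c. concat (map f [0..<N]) ! (t * c + i) = f t ! i)"
    using assms
  proof (induction N)
    case (Suc N)
    let ?xs = "concat (map f [0..<N])"
    have IH: "length ?xs = N * c" "\<And>t i. t < N \<Longrightarrow> i < c \<Longrightarrow> ?xs ! (t * c + i) = f t ! i"
      using Suc by auto
    have eq: "concat (map f [0..<Suc N]) = ?xs @ f N" by simp
    have "(?xs @ f N) ! (t * c + i) = f t ! i" if "t < Suc N" "i < c" for t i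
    proof (cases "t = N")
      case True
      then show ?thesis using IH(1) by (simp add: nth_append)
    next
      case False
      then have t: "t < N" using that by simp
      have "(t + 1) * c \<le> N * c" using t by (intro mult_right_mono) auto
      then have "t * c + i < N * c" using that(2) by simp
      then show ?thesis using IH t that(2) by (simp add: nth_append)
    qed
    then show ?case unfolding eq using IH(1) Suc.prems[of N] by auto
  qed simp
  then show "length (concat (map f [0..<N])) = N * c"
    "t < N \<Longrightarrow> i < c \<Longrightarrow> concat (map f [0..<N]) ! (t * c + i) = f t ! i" by auto
qed

definition query_of :: "(int \<Rightarrow> int \<Rightarrow> int) \<Rightarrow> int \<Rightarrow> query" where
  "query_of q t = ((nat (q t 0), nat (q t 1)), (nat (q t 2), nat (q t 3)))"

definition inst_array :: "int \<Rightarrow> (int \<Rightarrow> int) \<Rightarrow> int list" where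
  "inst_array m arr = map (\<lambda>i. arr (int i)) [0..<nat m]"

definition inst_queries :: "int \<Rightarrow> (int \<Rightarrow> int \<Rightarrow> int) \<Rightarrow> query list" where
  "inst_queries m q = map (\<lambda>i. query_of q (int i)) [0..<nat m]"

definition inst_words :: "int \<Rightarrow> (int \<Rightarrow> int) \<Rightarrow> (int \<Rightarrow> int \<Rightarrow> int) \<Rightarrow> int list" where
  "inst_words m arr q = [m, m] @ inst_array m arr @ concat (map query_words (inst_queries m q))"

text \<open>The instance as a function of the address. Both header words are \<open>m\<close>,
  because there are as many queries as array cells.\<close>

definition inst :: "int \<Rightarrow> (int \<Rightarrow> int) \<Rightarrow> (int \<Rightarrow> int \<Rightarrow> int) \<Rightarrow> int \<Rightarrow> int" where
  "inst m arr q a = (if a < 2 then m else if a < 2 + m then arr (a - 2)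
     else q ((a - 2 - m) div 4) ((a - 2 - m) mod 4))"

lemma inst_words_nth:
  assumes "0 \<le> m" "\<And>t i. 0 \<le> t \<Longrightarrow> t < m \<Longrightarrow> 0 \<le> q t i"
  shows "length (inst_words m arr q) = nat (2 + 5 * m)"
    and "0 \<le> a \<Longrightarrow> a < 2 + 5 * m \<Longrightarrow> inst_words m arr q ! nat a = inst m arr q a"
proof -
  let ?f = "\<lambda>i. query_words (query_of q (int i))"
  have f: "?f i = [q (int i) 0, q (int i) 1, q (int i) 2, q (int i) 3]" if "i < nat m" for i
    using assms(2)[of "int i"] that by (simp add: query_of_def)
  have len4: "length (?f i) = 4" for i by (simp add: query_of_def)
  have cc: "concat (map query_words (inst_queries m q)) = concat (map ?f [0..<nat m])"
    by (simp add: inst_queries_def comp_def)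
  note cm = concat_map_const[of "nat m" ?f 4, OF len4]
  show "length (inst_words m arr q) = nat (2 + 5 * m)"
    unfolding inst_words_def cc using cm(1) assms(1) by (simp add: inst_array_def nat_add_distrib nat_mult_distrib)
  assume a: "0 \<le> a" "a < 2 + 5 * m"
  consider "a < 2" | "2 \<le> a" "a < 2 + m" | "2 + m \<le> a" by linarith
  then show "inst_words m arr q ! nat a = inst m arr q a"
  proof cases
    case 1
    then have "a = 0 \<or> a = 1" using a by linarith
    then show ?thesis by (auto simp: inst_words_def inst_def)
  next
    case 2
    then have "nat a = Suc (Suc (nat (a - 2)))" "nat (a - 2) < nat m" by linarith+
    then show ?thesis using 2 by (simp add: inst_words_def inst_def inst_array_def nth_append)
  next
    case 3
    define y where "y = a - 2 - m"
    have y: "0 \<le> y" "y < 4 * m" using 3 a by (auto simp: y_def)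
    define t where "t = nat (y div 4)"
    define i where "i = nat (y mod 4)"
    have ti: "t < nat m" "i < 4" "int t = y div 4" "int i = y mod 4"
      using y unfolding t_def i_def by (auto simp: nat_less_iff)
    then have "int (nat y) = int (t * 4 + i)" using y(1) by simp
    then have ny: "nat y = t * 4 + i" by (rule of_nat_eq_iff[THEN iffD1])
    have n: "nat a = Suc (Suc (nat m + (t * 4 + i)))" using 3 y ny assms(1) unfolding y_def by linarith
    have "inst_words m arr q ! nat a = ?f t ! i"
      unfolding n inst_words_def cc using cm(2)[OF ti(1,2)] by (simp add: inst_array_def nth_append)
    also have "\<dots> = q (y div 4) (y mod 4)"
    proof -
      have "i = 0 \<or> i = 1 \<or> i = 2 \<or> i = 3" using ti(2) by linarith
      then show ?thesis unfolding f[OF ti(1)] ti(3)[symmetric] ti(4)[symmetric] by auto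
    qed
    also have "\<dots> = inst m arr q a" using 3 assms(1) by (simp add: inst_def y_def)
    finally show ?thesis .
  qed
qed

lemma initial_inst:
  assumes "0 \<le> m" "\<And>t i. 0 \<le> t \<Longrightarrow> t < m \<Longrightarrow> 0 \<le> q t i"
  shows "mem (initial_state (inst_words m arr q)) a = (if 0 \<le> a \<and> a < 2 + 5 * m then inst m arr q a else 0)"
  using inst_words_nth[OF assms] assms(1) by (auto simp: initial_state_def)

text \<open>The interface to the solver at one length \<open>m\<close>: a single word bound and a
  single time bound for all instances with small entries. The condition \<open>fits\<close> is
  included because the simulation in a window starts from a memory of words.\<close>

definition solves :: "prog \<Rightarrow> int \<Rightarrow> int \<Rightarrow> nat \<Rightarrow> bool" where
  "solves p V m c \<longleftrightarrow> (\<forall>arr q. (\<forall>x. 0 \<le> x \<and> x < m \<longrightarrow> 0 \<le> arr x \<and> arr x \<le> m) \<and>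
     (\<forall>t. 0 \<le> t \<and> t < m \<longrightarrow> valid_query (nat m) (query_of q t) \<and> (\<forall>i. 0 \<le> q t i \<and> q t i \<le> m)) \<longrightarrow>
     (\<exists>t s. exec V p (initial_state (inst_words m arr q)) t s \<and> t \<le> c \<and>
       fits V (initial_state (inst_words m arr q)) \<and>
       (\<forall>i. 0 \<le> i \<and> i < m \<longrightarrow> mem s i = of_bool (ranges_disjoint (inst_array m arr) (query_of q i)))))"

text \<open>The array consists of the lines of \<open>h\<close> rows from row \<open>s\<close> on and of \<open>h\<close> columns from column
  \<open>s'\<close> on, which is where \<open>2 * h \<le> n\<close> is needed.  A pair outside these blocks, or with an empty prefix,
  gets the query \<open>((1, 1), (2, 2))\<close>, whose ranges are disjoint because the first two entries belong to the
  same line.\<close>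

definition (in buckets) arr :: "int \<Rightarrow> int \<Rightarrow> int \<Rightarrow> int" where
  "arr s s' x = item (x + s * n + (1 - of_bool (x < h * n)) * ((n + s' - s - h) * n))"

definition (in buckets) in_block :: "int \<Rightarrow> int \<Rightarrow> int \<Rightarrow> bool" where
  "in_block s s' t \<longleftrightarrow> s \<le> t div n \<and> t div n < s + h \<and> s' \<le> t mod n \<and> t mod n < s' + h"

definition (in buckets) real_query :: "int \<Rightarrow> int \<Rightarrow> (int \<Rightarrow> int) \<Rightarrow> int \<Rightarrow> bool" where
  "real_query s s' lo t \<longleftrightarrow> in_block s s' t \<and> 0 < cnt (t div n) (lo t) \<and> 0 < cnt (n + t mod n) (lo t)"

definition (in buckets) qry :: "int \<Rightarrow> int \<Rightarrow> (int \<Rightarrow> int) \<Rightarrow> int \<Rightarrow> int \<Rightarrow> int" where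
  "qry s s' lo t i = (if real_query s s' lo t then
     (if i = 0 then (t div n - s) * n + 1 else if i = 1 then (t div n - s) * n + cnt (t div n) (lo t)
      else if i = 2 then h * n + (t mod n - s') * n + 1
      else h * n + (t mod n - s') * n + cnt (n + t mod n) (lo t))
     else if i < 2 then 1 else 2)"

context buckets
begin

lemma arr_row: "0 \<le> x \<Longrightarrow> x < h * n \<Longrightarrow> arr s s' x = item (s * n + x)"
  by (simp add: arr_def add.commute)

lemma arr_col: "h * n \<le> x \<Longrightarrow> arr s s' x = item ((n + s') * n + (x - h * n))"
  by (simp add: arr_def algebra_simps)

lemma hn_bounds: "2 * (h * n) \<le> m" "n \<le> h * n" "2 \<le> h * n"
proof -
  have "(2 * h) * n \<le> n * n" using h_bounds n by (intro mult_right_mono) auto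
  then show "2 * (h * n) \<le> m" by (simp add: m)
  have "1 * n \<le> h * n" using h_bounds n by (intro mult_right_mono) auto
  then show "n \<le> h * n" "2 \<le> h * n" using n by linarith+
qed

lemma block_line_bounds:
  assumes "0 \<le> d" "d < h"
  shows "0 \<le> d * n" "d * n + n \<le> h * n"
proof -
  show "0 \<le> d * n" using assms n by simp
  have "(d + 1) * n \<le> h * n" using assms n by (intro mult_right_mono) auto
  then show "d * n + n \<le> h * n" by (simp add: algebra_simps)
qed

lemma qry_bounds:
  assumes t: "0 \<le> t" "t < m" and lo: "lo t \<le> P"
  shows "0 \<le> qry s s' lo t i" "qry s s' lo t i \<le> m" "valid_query (nat m) (query_of (qry s s' lo) t)"
proof -
  let ?X = "cnt (t div n) (lo t)" and ?Y = "cnt (n + t mod n) (lo t)"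
  have XY: "0 \<le> ?X" "?X \<le> n" "0 \<le> ?Y" "?Y \<le> n" using cnt_nonneg cnt_le[OF lo] by auto
  note hb = hn_bounds m_ge
  have "0 \<le> qry s s' lo t i \<and> qry s s' lo t i \<le> m \<and> valid_query (nat m) (query_of (qry s s' lo) t)"
  proof (cases "real_query s s' lo t")
    case True
    then have r: "0 \<le> t div n - s" "t div n - s < h" "0 \<le> t mod n - s'" "t mod n - s' < h" "0 < ?X" "0 < ?Y"
      by (auto simp: real_query_def in_block_def)
    note b1 = block_line_bounds[OF r(1,2)] and b2 = block_line_bounds[OF r(3,4)]
    show ?thesis using r(5,6) b1 b2 hb XY
      by (simp add: qry_def True query_of_def nat_le_iff nat_less_eq_zless le_nat_iff)
  qed (use hb in \<open>simp add: qry_def query_of_def nat_le_iff le_nat_iff\<close>)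
  then show "0 \<le> qry s s' lo t i" "qry s s' lo t i \<le> m" "valid_query (nat m) (query_of (qry s s' lo) t)" by auto
qed

lemma arr_range: "0 \<le> arr s s' x" "arr s s' x \<le> m"
  using item_range[of "x + s * n + (1 - of_bool (x < h * n)) * ((n + s' - s - h) * n)"] m_ge
  unfolding arr_def by linarith+

lemma inst_array_nth: "0 \<le> x \<Longrightarrow> x < m \<Longrightarrow> inst_array m (arr s s') ! nat x = arr s s' x"
  by (simp add: inst_array_def)

text \<open>A pair outside the two blocks must be reported as disjoint, so that it does not disturb
  the conjunction over the nine calls. A pair with an empty prefix has no hit, so the default query
  gives the right answer there too.\<close>

lemma disjoint_iff_not_hit:
  assumes t: "0 \<le> t" "t < m" and lo: "lo t \<le> P" and s: "0 \<le> s" "s + h \<le> n" "0 \<le> s'" "s' + h \<le> n"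
  shows "ranges_disjoint (inst_array m (arr s s')) (query_of (qry s s' lo) t) \<longleftrightarrow>
    \<not> (in_block s s' t \<and> hit t (lo t))"
proof -
  let ?X = "cnt (t div n) (lo t)" and ?Y = "cnt (n + t mod n) (lo t)"
  let ?A = "inst_array m (arr s s')"
  have XY: "0 \<le> ?X" "?X \<le> n" "0 \<le> ?Y" "?Y \<le> n" using cnt_nonneg cnt_le[OF lo] by auto
  note hb = hn_bounds m_ge
  show ?thesis
  proof (cases "real_query s s' lo t")
    case True
    then have r: "0 \<le> t div n - s" "t div n - s < h" "0 \<le> t mod n - s'" "t mod n - s' < h" "0 < ?X" "0 < ?Y"
      "in_block s s' t"
      by (auto simp: real_query_def in_block_def)
    define a where "a = (t div n - s) * n"
    define b where "b = h * n + (t mod n - s') * n"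
    have ab: "0 \<le> a" "a + n \<le> h * n" "h * n \<le> b" "b + n \<le> 2 * (h * n)"
      using block_line_bounds[OF r(1,2)] block_line_bounds[OF r(3,4)] by (auto simp: a_def b_def)
    have A1: "?A ! nat (a + q) = item (t div n * n + q)" if "0 \<le> q" "q < n" for q
    proof -
      have "0 \<le> a + q" "a + q < h * n" "a + q < m" using that ab hb by linarith+
      then show ?thesis by (simp add: inst_array_nth arr_row) (simp add: a_def algebra_simps)
    qed
    have A2: "?A ! nat (b + q) = item ((n + t mod n) * n + q)" if "0 \<le> q" "q < n" for q
    proof -
      have "0 \<le> b + q" "h * n \<le> b + q" "b + q < m" using that ab hb by linarith+
      then show ?thesis by (simp add: inst_array_nth arr_col) (simp add: b_def algebra_simps)
    qed
    have "\<not> ranges_disjoint ?A (query_of (qry s s' lo) t) \<longleftrightarrow>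
      (\<exists>i j. nat (a + 1) \<le> i \<and> i \<le> nat (a + ?X) \<and> nat (b + 1) \<le> j \<and> j \<le> nat (b + ?Y) \<and> ?A ! (i - 1) = ?A ! (j - 1))"
      using ab XY r(5,6) n by (auto simp: query_of_def qry_def True a_def[symmetric] b_def[symmetric])
    also have "\<dots> \<longleftrightarrow> (\<exists>q q'. 0 \<le> q \<and> q < ?X \<and> 0 \<le> q' \<and> q' < ?Y \<and>
      item (t div n * n + q) = item ((n + t mod n) * n + q'))" (is "?L \<longleftrightarrow> ?R")
    proof
      assume ?L
      then obtain i j where ij: "nat (a + 1) \<le> i" "i \<le> nat (a + ?X)" "nat (b + 1) \<le> j" "j \<le> nat (b + ?Y)"
        "?A ! (i - 1) = ?A ! (j - 1)" by blast
      \<comment> \<open>Query positions count from 1, offsets along a line from 0.\<close>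
      define q q' where "q = int i - 1 - a" and "q' = int j - 1 - b"
      have q: "0 \<le> q" "q < ?X" "0 \<le> q'" "q' < ?Y" "i - 1 = nat (a + q)" "j - 1 = nat (b + q')"
        using ij(1-4) ab XY n unfolding q_def q'_def by linarith+
      then have "item (t div n * n + q) = item ((n + t mod n) * n + q')"
        using A1[of q] A2[of q'] XY ij(5) by simp
      then show ?R using q by blast
    next
      assume ?R
      then obtain q q' where q: "0 \<le> q" "q < ?X" "0 \<le> q'" "q' < ?Y"
        "item (t div n * n + q) = item ((n + t mod n) * n + q')" by blast
      have e: "nat (a + q + 1) - 1 = nat (a + q)" "nat (b + q' + 1) - 1 = nat (b + q')"
        using q ab n by linarith+
      show ?L
      proof (rule exI[of _ "nat (a + q + 1)"], rule exI[of _ "nat (b + q' + 1)"], intro conjI)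
        show "?A ! (nat (a + q + 1) - 1) = ?A ! (nat (b + q' + 1) - 1)"
          unfolding e using A1[of q] A2[of q'] q XY by simp
      qed (use q ab n in linarith)+
    qed
    also have "\<dots> \<longleftrightarrow> hit t (lo t)" using hit_iff_prefixes[OF t lo] by simp
    finally show ?thesis using r(7) by auto
  next
    case False
    have "?A ! nat 0 \<noteq> ?A ! nat 1"
    proof -
      have "s < 2 * n" using s h_bounds by linarith
      then have "item (s * n) \<noteq> item (s * n + 1)" using item_distinct[of s] s by simp
      then show ?thesis using hb by (simp add: inst_array_nth[of 0, simplified] inst_array_nth[of 1, simplified] arr_row)
    qed
    then have d: "ranges_disjoint ?A (query_of (qry s s' lo) t)"
      by (auto simp: query_of_def qry_def False dest: le_antisym)
    have "\<not> (in_block s s' t \<and> hit t (lo t))"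
    proof (cases "in_block s s' t")
      case True
      then have "?X = 0 \<or> ?Y = 0" using False XY by (auto simp: real_query_def)
      then show ?thesis using hit_iff_prefixes[OF t lo] by auto
    qed simp
    then show ?thesis using d by simp
  qed
qed

end


text \<open>One iteration writes array cell \<open>k\<close> and query \<open>k\<close> together, as
  both run up to \<open>m\<close>. Register 24 is 1 for a real query; with the value 0 it turns the
  four words into 1, 1, 2, 2.\<close>

definition query_body :: prog where
  "query_body = block [
     Put aRaw (Var rO \<boxplus> Num 2 \<boxplus> Var 14)
       (Arr aItem (Var 14 \<boxplus> Var 20 \<boxtimes> Var rN \<boxplus>
         (Num 1 \<boxminus> Lt (Var 14) (Var rH \<boxtimes> Var rN)) \<boxtimes> ((Var rN \<boxplus> Var 21 \<boxminus> Var 20 \<boxminus> Var rH) \<boxtimes> Var rN))),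
     Set 22 (Var 14 \<boxslash> Var rN),
     Set 23 (Var 14 \<box>% Var rN),
     Set 24 ((Num 1 \<boxminus> Lt (Var 22) (Var 20)) \<boxtimes> Lt (Var 22) (Var 20 \<boxplus> Var rH) \<boxtimes>
       (Num 1 \<boxminus> Lt (Var 23) (Var 21)) \<boxtimes> Lt (Var 23) (Var 21 \<boxplus> Var rH) \<boxtimes>
       Lt (Num 0) (Arr aX (Var 14)) \<boxtimes> Lt (Num 0) (Arr aY (Var 14))),
     Set 25 (Var rO \<boxplus> Num 2 \<boxplus> Var rM \<boxplus> Num 4 \<boxtimes> Var 14),
     Set 26 ((Var 22 \<boxminus> Var 20) \<boxtimes> Var rN),
     Set 27 (Var rH \<boxtimes> Var rN \<boxplus> (Var 23 \<boxminus> Var 21) \<boxtimes> Var rN),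
     Put aRaw (Var 25) (Num 1 \<boxplus> Var 24 \<boxtimes> Var 26),
     Put aRaw (Var 25 \<boxplus> Num 1) (Num 1 \<boxplus> Var 24 \<boxtimes> (Var 26 \<boxplus> Arr aX (Var 14) \<boxminus> Num 1)),
     Put aRaw (Var 25 \<boxplus> Num 2) (Num 2 \<boxplus> Var 24 \<boxtimes> (Var 27 \<boxminus> Num 1)),
     Put aRaw (Var 25 \<boxplus> Num 3) (Num 2 \<boxplus> Var 24 \<boxtimes> (Var 27 \<boxplus> Arr aY (Var 14) \<boxminus> Num 2))]"

text \<open>An instance in the course of being written at address \<open>z\<close>: header, the
  first \<open>k\<close> cells and the first \<open>k\<close> queries are in place, over the old
  contents \<open>raw\<close>.\<close>

definition partial_inst :: "int \<Rightarrow> (int \<Rightarrow> int) \<Rightarrow> (int \<Rightarrow> int \<Rightarrow> int) \<Rightarrow> int \<Rightarrow> (int \<Rightarrow> int) \<Rightarrow> int \<Rightarrow> int \<Rightarrow> int" where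
  "partial_inst m arr q z raw k x =
     (if z \<le> x \<and> x < z + 2 then m else if z + 2 \<le> x \<and> x < z + 2 + k then arr (x - z - 2)
      else if z + 2 + m \<le> x \<and> x < z + 2 + m + 4 * k then q ((x - z - 2 - m) div 4) ((x - z - 2 - m) mod 4)
      else raw x)"

lemma partial_inst_step:
  fixes b :: int
  assumes k: "0 \<le> k" "k < m" and b: "b = z + 2 + m + 4 * k"
  shows "(partial_inst m arr q z raw k)(z + 2 + k := arr k, b := q k 0, b + 1 := q k 1, b + 2 := q k 2, b + 3 := q k 3)
    = partial_inst m arr q z raw (k + 1)"
proof
  fix x
  let ?g = "partial_inst m arr q z raw"
  have q: "?g (k + 1) (b + i) = q k i" if "0 \<le> i" "i < 4" for i
  proof -
    have e: "b + i - z - 2 - m = 4 * k + i" "4 * (k + 1) = 4 * k + 4" using b by simp_all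
    have d: "(4 * k + i) div 4 = k" "(4 * k + i) mod 4 = i" using that by simp_all
    have "\<not> b + i < z + 2" "\<not> b + i < z + 2 + (k + 1)" "z + 2 + m \<le> b + i" "b + i < z + 2 + m + (4 * k + 4)"
      using k that unfolding b by linarith+
    then show ?thesis unfolding partial_inst_def e d by simp
  qed
  have a: "?g (k + 1) (z + 2 + k) = arr k"
    using k unfolding partial_inst_def by simp
  have n: "z + 2 + k \<noteq> b" "z + 2 + k \<noteq> b + 1" "z + 2 + k \<noteq> b + 2" "z + 2 + k \<noteq> b + 3"
    using k unfolding b by linarith+
  consider "x = z + 2 + k" | "x = b" | "x = b + 1" | "x = b + 2" | "x = b + 3"
    | "x \<noteq> z + 2 + k" "x < b \<or> b + 4 \<le> x" by linarith
  then show "((?g k)(z + 2 + k := arr k, b := q k 0, b + 1 := q k 1, b + 2 := q k 2, b + 3 := q k 3)) x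
    = ?g (k + 1) x"
  proof cases
    case 6
    have e: "4 * (k + 1) = 4 * k + 4" by simp
    have "x < z + 2 + k \<longleftrightarrow> x < z + 2 + (k + 1)"
      "x < z + 2 + m + 4 * k \<longleftrightarrow> x < z + 2 + m + 4 * (k + 1)" using 6 unfolding b e by linarith+
    then have "?g k x = ?g (k + 1) x" unfolding partial_inst_def by simp
    moreover have "x \<noteq> b" "x \<noteq> b + 1" "x \<noteq> b + 2" "x \<noteq> b + 3" using 6 by linarith+
    ultimately show ?thesis using 6 by simp
  qed (use q[of 0] q[of 1] q[of 2] q[of 3] a n in simp_all)
qed

lemma partial_inst_full:
  assumes "0 \<le> m"
  shows "partial_inst m arr q z raw m x = (if z \<le> x \<and> x < z + (2 + 5 * m) then inst m arr q (x - z) else raw x)"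
  using assms by (auto simp: partial_inst_def inst_def)

lemma index_le: "x \<le> B \<Longrightarrow> 16 * B + 16 \<le> W \<Longrightarrow> 16 * x + 16 \<le> (W :: int)"
  by linarith

lemma (in buckets) query_body_correct:
  assumes b: "base \<rho>" "\<rho> rO = z" "\<rho> 20 = s" "\<rho> 21 = s'" "\<rho> 14 = k"
    and z: "0 \<le> z" "z + 5 * m + 2 \<le> B" "16 * B + 16 \<le> W"
    and s: "0 \<le> s" "s + h \<le> n" "0 \<le> s'" "s' + h \<le> n" and k: "0 \<le> k" "k < m"
    and lo: "lo k \<le> P"
    and \<mu>: "\<mu> aItem = item" "\<mu> aX k = cnt (k div n) (lo k)" "\<mu> aY k = cnt (n + k mod n) (lo k)"
      "\<mu> aRaw = partial_inst m (arr s s') (qry s s' lo) z raw k"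
  shows "triple W query_body 290 \<rho> \<mu> (\<lambda>\<rho>' \<mu>'.
    \<mu>' = \<mu>(aRaw := partial_inst m (arr s s') (qry s s' lo) z raw (k + 1)) \<and>
    agree {22, 23, 24, 25, 26, 27} \<rho>' \<rho>)"
proof -
  note Wb = W_bounds m_ge P(2,3) W n
  note hb = hn_bounds
  let ?i = "k div n" and ?j = "k mod n" and ?X = "cnt (k div n) (lo k)" and ?Y = "cnt (n + k mod n) (lo k)"
  have XY: "0 \<le> ?X" "?X \<le> n" "0 \<le> ?Y" "?Y \<le> n" using cnt_nonneg cnt_le[OF lo] by auto
  note ij = pair_bounds[OF k]
  have r: "\<rho> rN = n" "\<rho> rM = m" "\<rho> rH = h" using b(1) by (auto simp: base_def)
  define x where "x = (1 - of_bool (k < h * n)) * ((n + s' - s - h) * n)"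
  define rt :: int where "rt = of_bool (real_query s s' lo k)"
  define u where "u = (?i - s) * n"
  define v where "v = h * n + (?j - s') * n"
  define bs where "bs = z + 2 + m + 4 * k"
  have rt: "(1 - of_bool (?i < s)) * of_bool (?i < s + h) * (1 - of_bool (?j < s')) * of_bool (?j < s' + h) *
    of_bool (0 < ?X) * of_bool (0 < ?Y) = rt"
    by (auto simp: rt_def real_query_def in_block_def)
  have W1: "1 \<le> W" "0 \<le> W" "2 \<le> W" "3 \<le> W" "4 \<le> W" using Wb by linarith+
  have bp: "\<bar>1 - of_bool a :: int\<bar> \<le> W" "\<bar>(1 - of_bool a) * of_bool b :: int\<bar> \<le> W"
    "\<bar>(1 - of_bool a) * of_bool b * (1 - of_bool c) :: int\<bar> \<le> W"
    "\<bar>(1 - of_bool a) * of_bool b * (1 - of_bool c) * of_bool d :: int\<bar> \<le> W"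
    "\<bar>(1 - of_bool a) * of_bool b * (1 - of_bool c) * of_bool d * of_bool e :: int\<bar> \<le> W" for a b c d e
    using W1 by (cases a; cases b; cases c; cases d; cases e; simp)+
  have rtW: "\<bar>rt\<bar> \<le> W" using W1 by (simp add: rt_def)
  have sn: "0 \<le> s * n" "s * n \<le> m" "0 \<le> s' * n" "s' * n \<le> m" "0 \<le> (s + h) * n" "(s + h) * n \<le> m"
    using s n h_bounds unfolding m by (auto intro!: mult_right_mono mult_nonneg_nonneg)
  have in': "0 \<le> ?i * n" "?i * n \<le> m" "0 \<le> ?j * n" "?j * n \<le> m"
  proof -
    have "?i \<le> n" "?j \<le> n" using ij by linarith+
    then show "0 \<le> ?i * n" "?i * n \<le> m" "0 \<le> ?j * n" "?j * n \<le> m"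
      using ij(1,3) n mult_right_mono[of ?i n n] mult_right_mono[of ?j n n] unfolding m by simp_all
  qed
  have u: "\<bar>u\<bar> \<le> m" using sn in' unfolding u_def left_diff_distrib by linarith
  have v: "\<bar>v\<bar> \<le> 2 * m" using sn in' hb unfolding v_def left_diff_distrib by linarith
  have nn: "(n + s' - s - h) * n = m + s' * n - (s + h) * n" by (simp add: m algebra_simps)
  \<comment> \<open>Array cells behind the two blocks may be taken from indices above
    \<open>2 * m\<close>, where \<open>item\<close> is only filler; \<open>4 * m\<close> covers
    these as well.\<close>
  have xb: "0 \<le> k + s * n + x" "k + s * n + x \<le> 4 * m" "\<bar>x\<bar> \<le> 2 * m"
    using k sn hb unfolding x_def nn distrib_right[of s h n] by (auto simp: of_bool_def)
  have e1: "\<bar>z + 2\<bar> \<le> W" "\<bar>z + 2 + k\<bar> \<le> W" "0 \<le> z + 2 + k" "z + 2 + k \<le> B"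
    "\<bar>s * n\<bar> \<le> W" "\<bar>k + s * n\<bar> \<le> W" "\<bar>h * n\<bar> \<le> W" "\<bar>n + s'\<bar> \<le> W" "\<bar>n + s' - s\<bar> \<le> W" "\<bar>n + s' - s - h\<bar> \<le> W"
    "\<bar>k + s * n + x\<bar> \<le> W" "\<bar>x\<bar> \<le> W" "k + s * n + x \<le> 4 * P"
    using z k s sn hb xb Wb h_bounds by linarith+
  have e2: "\<bar>?i\<bar> \<le> W" "\<bar>?j\<bar> \<le> W" "\<bar>s + h\<bar> \<le> W" "\<bar>s' + h\<bar> \<le> W" "\<bar>z + 2 + m\<bar> \<le> W" "\<bar>4 * k\<bar> \<le> W" "\<bar>bs\<bar> \<le> W"
    "0 \<le> bs" "0 \<le> bs + 1" "0 \<le> bs + 2" "0 \<le> bs + 3" "bs \<le> B" "bs + 1 \<le> B" "bs + 2 \<le> B" "bs + 3 \<le> B"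
    "\<bar>bs + 1\<bar> \<le> W" "\<bar>bs + 2\<bar> \<le> W" "\<bar>bs + 3\<bar> \<le> W"
    "\<bar>?i - s\<bar> \<le> W" "\<bar>?j - s'\<bar> \<le> W"
    using z k s ij hb Wb h_bounds unfolding bs_def by linarith+
  have e3: "\<bar>u\<bar> \<le> W" "\<bar>v\<bar> \<le> W" "\<bar>(?j - s') * n\<bar> \<le> W" "\<bar>u + ?X\<bar> \<le> W" "\<bar>u + ?X - 1\<bar> \<le> W" "\<bar>v - 1\<bar> \<le> W"
    "\<bar>v + ?Y\<bar> \<le> W" "\<bar>v + ?Y - 2\<bar> \<le> W" "\<bar>(n + s' - s - h) * n\<bar> \<le> W"
    using u v XY sn in' Wb nn unfolding left_diff_distrib[of ?j s' n] by linarith+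
  have e4: "\<bar>rt * y\<bar> \<le> W" "\<bar>1 + rt * y\<bar> \<le> W" "\<bar>2 + rt * y\<bar> \<le> W" if "\<bar>y\<bar> \<le> W - 2" for y
    using that W1 by (auto simp: rt_def)
  have e5: "\<bar>u\<bar> \<le> W - 2" "\<bar>u + ?X - 1\<bar> \<le> W - 2" "\<bar>v - 1\<bar> \<le> W - 2" "\<bar>v + ?Y - 2\<bar> \<le> W - 2"
    using u v XY Wb by linarith+
  have P4: "16 * (4 * P) + 16 \<le> W" using W by linarith
  note idx = e1(4)[THEN index_le, OF z(3)] e1(13)[THEN index_le, OF P4] e2(12-15)[THEN index_le, OF z(3)]
  have kW: "16 * k + 16 \<le> W" using k Wb by linarith
  have vals: "1 + rt * u = qry s s' lo k 0" "1 + rt * (u + ?X - 1) = qry s s' lo k 1"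
    "2 + rt * (v - 1) = qry s s' lo k 2" "2 + rt * (v + ?Y - 2) = qry s s' lo k 3"
    by (auto simp: rt_def qry_def u_def v_def)
  have item: "item (k + s * n + x) = arr s s' k" by (simp add: arr_def x_def)
  note step = partial_inst_step[OF k bs_def, where arr="arr s s'" and q="qry s s' lo" and raw=raw]
  note vW = e4(2)[OF e5(1)] e4(2)[OF e5(2)] e4(3)[OF e5(3)] e4(3)[OF e5(4)]
  show ?thesis unfolding query_body_def
    by (rule triple_block,
        simp only: machine_simps fun_upd_upd zero_neq_numeral numeral_neq_zero r b(2-5) \<mu>
          x_def[symmetric] rt u_def[symmetric] v_def[symmetric] bs_def[symmetric],
        simp only: machine_simps fun_upd_upd bp rtW e1 e2 e3 e4[OF e5(1)] e4[OF e5(2)] e4[OF e5(3)] e4[OF e5(4)]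
          idx kW k W1 vW[unfolded vals] xb(1) item vals step insert_iff empty_iff de_Morgan_disj,
        use W1 in auto)
qed

section \<open>Parallel binary search\<close>

definition starts_prog :: prog where
  "starts_prog = block [
     Set 20 (Var 12 \<boxslash> Num 3 \<boxtimes> Var rH),
     Set 20 (Var 20 \<boxplus> Lt (Var rN \<boxminus> Var rH) (Var 20) \<boxtimes> (Var rN \<boxminus> Var rH \<boxminus> Var 20)),
     Set 21 (Var 12 \<box>% Num 3 \<boxtimes> Var rH),
     Set 21 (Var 21 \<boxplus> Lt (Var rN \<boxminus> Var rH) (Var 21) \<boxtimes> (Var rN \<boxminus> Var rH \<boxminus> Var 21)),
     Put aRaw (Var rO) (Var rM),
     Put aRaw (Var rO \<boxplus> Num 1) (Var rM)]"

definition query_loop :: prog where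
  "query_loop = For 14 15 (Var rM) query_body"

definition collect_loop :: prog where
  "collect_loop = For 14 15 (Var rM)
     (block [Put aF (Var 14) (Arr aF (Var 14) \<boxtimes> Arr aRaw (Var rO \<boxplus> Var 14))])"

definition call_step :: "nat \<Rightarrow> prog \<Rightarrow> prog" where
  "call_step R p = Seq starts_prog (Seq query_loop (Seq (call R p)
     (Seq collect_loop (block [Set rO (Var rO \<boxplus> Var rD)]))))"

abbreviation (input) call_regs :: "nat set" where
  "call_regs \<equiv> {7, 14, 15, 20, 21, 22, 23, 24, 25, 26, 27}"

text \<open>The minimum pulls the last block back inside, so blocks may overlap. A pair covered more
  than once is harmless, since the answers of the calls are combined by conjunction.\<close>

definition (in sizes) start :: "int \<Rightarrow> int" where
  "start c = min (c * h) (n - h)"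

context sizes
begin

lemma start_bounds: "0 \<le> c \<Longrightarrow> 0 \<le> start c" "start c + h \<le> n" "start c \<le> n"
  using h_bounds n by (auto simp: start_def)

text \<open>For n at least 2 the rounding in \<open>h\<close> still leaves
  \<open>n \<le> 3 * h\<close>. The tight case is n = 3, with three blocks of a single line.\<close>

lemma start_cover:
  assumes "0 \<le> i" "i < n"
  shows "\<exists>c. 0 \<le> c \<and> c < 3 \<and> start c \<le> i \<and> i < start c + h"
proof -
  consider "i < h" | "h \<le> i" "i < 2 * h" | "2 * h \<le> i" by linarith
  then show ?thesis
  proof cases
    case 1
    then show ?thesis using assms h_bounds by (intro exI[of _ 0]) (auto simp: start_def)
  next
    case 2
    then show ?thesis using assms h_bounds by (intro exI[of _ 1]) (auto simp: start_def)
  next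
    case 3
    then show ?thesis using assms h_bounds by (intro exI[of _ 2]) (auto simp: start_def)
  qed
qed

lemma starts_prog_correct:
  assumes b: "base \<rho>" "\<rho> rO = z" "\<rho> 12 = e" "0 \<le> e" "e < 9"
    and z: "0 \<le> z" "z + 1 \<le> B" "16 * B + 16 \<le> W"
  shows "triple W starts_prog 100 \<rho> \<mu> (\<lambda>\<rho>' \<mu>'.
    \<mu>' = \<mu>(aRaw := (\<mu> aRaw)(z := m, z + 1 := m)) \<and> \<rho>' 20 = start (e div 3) \<and> \<rho>' 21 = start (e mod 3) \<and>
    agree {20, 21} \<rho>' \<rho>)"
proof -
  note Wb = W_bounds m_ge P(2,3) W n
  have r: "\<rho> rN = n" "\<rho> rM = m" "\<rho> rH = h" using b(1) by (auto simp: base_def)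
  have c: "0 \<le> e div 3" "e div 3 < 3" "0 \<le> e mod 3" "e mod 3 < 3" using b by auto
  have m3: "x * h \<le> 3 * n" "0 \<le> x * h" if "0 \<le> x" "x < 3" for x
  proof -
    have "x = 0 \<or> x = 1 \<or> x = 2" using that by linarith
    then show "x * h \<le> 3 * n" "0 \<le> x * h" using h_bounds n by auto
  qed
  have st: "x * h + of_bool (n - h < x * h) * (n - h - x * h) = start x" for x
    by (auto simp: start_def)
  note d1 = m3[OF c(1,2)] and d2 = m3[OF c(3,4)]
  have bb: "\<bar>e div 3 * h\<bar> \<le> W" "\<bar>e mod 3 * h\<bar> \<le> W" "\<bar>n - h\<bar> \<le> W" "\<bar>n - h - e div 3 * h\<bar> \<le> W"
    "\<bar>n - h - e mod 3 * h\<bar> \<le> W" "\<bar>e div 3\<bar> \<le> W" "\<bar>e mod 3\<bar> \<le> W" "\<bar>start (e div 3)\<bar> \<le> W"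
    "\<bar>start (e mod 3)\<bar> \<le> W"
    using d1 d2 c W_bounds W n h_bounds m_ge(1) P(2) start_bounds(1)[OF c(1)] start_bounds(1)[OF c(3)]
      start_bounds(3)[of "e div 3"] start_bounds(3)[of "e mod 3"]
    by (simp_all only: abs_le_iff) linarith+
  have ob: "\<bar>of_bool a * x\<bar> \<le> W" if "\<bar>x\<bar> \<le> W" for a and x :: int
    using that by (cases a) auto
  have zb: "\<bar>z + 1\<bar> \<le> W" "0 \<le> z + 1" "16 * z + 16 \<le> W" "1 \<le> W" "3 \<le> W"
    using z Wb by linarith+
  note zb' = index_le[OF z(2,3)]
  show ?thesis unfolding starts_prog_def
    by (rule triple_block,
        simp only: machine_simps fun_upd_upd zero_neq_numeral numeral_neq_zero r b(2-5) st,
        simp only: machine_simps fun_upd_upd bb ob zb zb' z(1) st, use zb in auto)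
qed

end

lemma partial_inst_0:
  assumes "0 \<le> m"
  shows "raw(z := m, z + 1 := m) = partial_inst m arr q z raw 0"
  using assms by (auto simp: partial_inst_def fun_eq_iff)

context buckets
begin

lemma query_loop_correct:
  assumes b: "base \<rho>" "\<rho> rO = z" "\<rho> 20 = s" "\<rho> 21 = s'"
    and z: "0 \<le> z" "z + 5 * m + 2 \<le> B" "16 * B + 16 \<le> W"
    and s: "0 \<le> s" "s + h \<le> n" "0 \<le> s'" "s' + h \<le> n"
    and lo: "\<And>t. 0 \<le> t \<Longrightarrow> t < m \<Longrightarrow> lo t \<le> P"
    and \<mu>: "\<mu> aItem = item" "\<And>t. 0 \<le> t \<Longrightarrow> t < m \<Longrightarrow> \<mu> aX t = cnt (t div n) (lo t) \<and> \<mu> aY t = cnt (n + t mod n) (lo t)"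
      "\<mu> aRaw = partial_inst m (arr s s') (qry s s' lo) z raw 0"
  shows "triple W query_loop (nat m * 296 + 10) \<rho> \<mu> (\<lambda>\<rho>' \<mu>'.
    \<mu>' = \<mu>(aRaw := partial_inst m (arr s s') (qry s s' lo) z raw m) \<and>
    agree {14, 15, 22, 23, 24, 25, 26, 27} \<rho>' \<rho>)"
proof -
  note Wb = W_bounds m_ge P(2,3) W n
  define I where "I k \<rho>' \<mu>' \<longleftrightarrow> \<mu>' = \<mu>(aRaw := partial_inst m (arr s s') (qry s s' lo) z raw k) \<and>
    agree {14, 15, 22, 23, 24, 25, 26, 27} \<rho>' \<rho>" for k :: int and \<rho>' :: "nat \<Rightarrow> int" and \<mu>'
  show ?thesis unfolding query_loop_def
  proof (rule triple_For[where I=I and c="290"])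
    have "\<mu>(aRaw := \<mu> aRaw) = \<mu>" by simp
    then show "I 0 (\<rho>(15 := m, 14 := 0)) \<mu>" using \<mu>(3) by (auto simp: I_def)
  next
    fix k \<rho>' \<mu>' assume k: "0 \<le> k" "k < m" "\<rho>' 14 = k" "\<rho>' 15 = m" "I k \<rho>' \<mu>'"
    then have I: "\<mu>' = \<mu>(aRaw := partial_inst m (arr s s') (qry s s' lo) z raw k)"
      "agree {14, 15, 22, 23, 24, 25, 26, 27} \<rho>' \<rho>" by (auto simp: I_def)
    have b': "base \<rho>'" using b(1) I(2) by (simp add: base_def)
    show "triple W query_body 290 \<rho>' \<mu>' (step_post 14 15 k m I)"
    proof (rule triple_conseq, rule query_body_correct[where lo=lo, OF b' _ _ _ k(3) z s k(1,2) lo[OF k(1,2)]])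
      fix \<rho>'' \<mu>'' assume "\<mu>'' = \<mu>'(aRaw := partial_inst m (arr s s') (qry s s' lo) z raw (k + 1)) \<and>
        agree {22, 23, 24, 25, 26, 27} \<rho>'' \<rho>'"
      then show "\<rho>'' 14 = k \<and> \<rho>'' 15 = m \<and> I (k + 1) (\<rho>''(14 := k + 1)) \<mu>''"
        using I k(3,4) by (simp add: I_def)
    qed (use b I \<mu> k in auto)
  qed (use b Wb in \<open>auto simp: base_def I_def\<close>)
qed

lemma collect_loop_correct:
  assumes b: "base \<rho>" "\<rho> rO = z" and z: "0 \<le> z" "z + m \<le> B" "16 * B + 16 \<le> W"
    and F: "\<And>t. 0 \<le> t \<Longrightarrow> t < m \<Longrightarrow> \<mu> aF t = of_bool (G t) \<and> \<mu> aRaw (z + t) = of_bool (G' t)"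
  shows "triple W collect_loop (nat m * 40 + 10) \<rho> \<mu> (\<lambda>\<rho>' \<mu>'. (\<exists>F. \<mu>' = \<mu>(aF := F) \<and>
    (\<forall>t. 0 \<le> t \<and> t < m \<longrightarrow> F t = of_bool (G t \<and> G' t))) \<and> agree {14, 15} \<rho>' \<rho>)"
proof -
  note Wb = W_bounds m_ge P(2,3) W n
  define I where "I k \<rho>' \<mu>' \<longleftrightarrow> (\<exists>F. \<mu>' = \<mu>(aF := F) \<and>
    (\<forall>t. 0 \<le> t \<and> t < m \<longrightarrow> F t = of_bool (G t \<and> (t < k \<longrightarrow> G' t)))) \<and> agree {14, 15} \<rho>' \<rho>"
    for k :: int and \<rho>' :: "nat \<Rightarrow> int" and \<mu>'
  show ?thesis unfolding collect_loop_def
  proof (rule triple_For[where I=I and c="34"])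
    show "I 0 (\<rho>(15 := m, 14 := 0)) \<mu>" unfolding I_def using F
      by - (rule conjI, rule exI[of _ "\<mu> aF"], auto)
  next
    fix k \<rho>' \<mu>' assume k: "0 \<le> k" "k < m" "\<rho>' 14 = k" "\<rho>' 15 = m" "I k \<rho>' \<mu>'"
    then obtain F' where I: "\<mu>' = \<mu>(aF := F')"
      "\<forall>t. 0 \<le> t \<and> t < m \<longrightarrow> F' t = of_bool (G t \<and> (t < k \<longrightarrow> G' t))"
      "agree {14, 15} \<rho>' \<rho>" by (auto simp: I_def)
    have r: "\<rho>' rO = z" using b I by simp
    have v: "F' k * \<mu> aRaw (z + k) = of_bool (G k \<and> G' k)" using I(2) F k by auto
    have bb: "\<bar>of_bool (G k \<and> G' k) :: int\<bar> \<le> W" "1 \<le> W" "0 \<le> z + k" "16 * k + 16 \<le> W" "\<bar>z + k\<bar> \<le> W" "z + k \<le> B"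
      using k z Wb by auto
    have I': "I (k + 1) (\<rho>'(14 := k + 1)) (\<mu>(aF := F'(k := of_bool (G k \<and> G' k))))"
      unfolding I_def using I(2,3) k
      by - (rule conjI, rule exI[of _ "F'(k := of_bool (G k \<and> G' k))"], auto)
    show "triple W (block [Put aF (Var 14) (Arr aF (Var 14) \<boxtimes> Arr aRaw (Var rO \<boxplus> Var 14))]) 34 \<rho>' \<mu>'
      (step_post 14 15 k m I)"
      by (rule triple_block)
        (simp only: machine_simps fun_upd_upd zero_neq_numeral numeral_neq_zero r k(1,3,4) I(1) v bb
          bb(6)[THEN index_le, OF z(3)] I', use bb in auto)
  qed (use b Wb in \<open>auto simp: base_def I_def\<close>)
qed

text \<open>\<open>G\<close> stands for the outcome of the earlier calls of the round; this call
  adds the condition for its own pair of blocks. Everything from the next window on is handed over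
  still zero.\<close>

lemma call_step_correct:
  assumes p: "solves p V m c" "prog_regs p \<subseteq> {..<R}" "5 * m + 2 \<le> V"
    and b: "base \<rho>" "\<rho> rO = z" "\<rho> rD = D" "\<rho> 12 = e" "0 \<le> e" "e < 9"
    and z: "V \<le> z" "z + D \<le> B" "16 * B + 16 \<le> W" "D = 2 * V + 1"
    and lo: "\<And>t. 0 \<le> t \<Longrightarrow> t < m \<Longrightarrow> lo t \<le> P"
    and \<mu>: "\<mu> aItem = item" "\<And>t. 0 \<le> t \<Longrightarrow> t < m \<Longrightarrow> \<mu> aX t = cnt (t div n) (lo t) \<and> \<mu> aY t = cnt (n + t mod n) (lo t)"
      "\<And>t. 0 \<le> t \<Longrightarrow> t < m \<Longrightarrow> \<mu> aF t = of_bool (G t)"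
      "\<And>x. z - V \<le> x \<Longrightarrow> \<mu> aRaw x = 0"
  shows "triple W (call_step R p) (nat m * 336 + R + 2 * c + 150) \<rho> \<mu> (\<lambda>\<rho>' \<mu>'.
    \<rho>' rO = z + D \<and> agree call_regs \<rho>' \<rho> \<and> (\<forall>a. a \<noteq> aRaw \<and> a \<noteq> aF \<longrightarrow> \<mu>' a = \<mu> a) \<and>
    (\<forall>x. z + D - V \<le> x \<longrightarrow> \<mu>' aRaw x = 0) \<and>
    (\<forall>t. 0 \<le> t \<and> t < m \<longrightarrow> \<mu>' aF t =
      of_bool (G t \<and> \<not> (in_block (start (e div 3)) (start (e mod 3)) t \<and> hit t (lo t)))))"
    (is "triple W _ _ _ _ ?Q")
proof -
  note Wb = W_bounds m_ge P(2,3) W n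
  define s s' where "s = start (e div 3)" and "s' = start (e mod 3)"
  have s: "0 \<le> s" "s + h \<le> n" "0 \<le> s'" "s' + h \<le> n"
    using b start_bounds[of "e div 3"] start_bounds[of "e mod 3"] by (auto simp: s_def s'_def)
  have z': "0 \<le> z" "z + 1 \<le> B" "z + 5 * m + 2 \<le> B" "z + m \<le> B" using z p(3) Wb by linarith+
  let ?q = "qry s s' lo" and ?a = "arr s s'"
  have m0: "0 \<le> m" using Wb by linarith
  have pre: "\<forall>x. 0 \<le> x \<and> x < m \<longrightarrow> 0 \<le> ?a x \<and> ?a x \<le> m"
    "\<forall>t. 0 \<le> t \<and> t < m \<longrightarrow> valid_query (nat m) (query_of ?q t) \<and> (\<forall>i. 0 \<le> ?q t i \<and> ?q t i \<le> m)"
  proof -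
    show "\<forall>x. 0 \<le> x \<and> x < m \<longrightarrow> 0 \<le> ?a x \<and> ?a x \<le> m" using arr_range by simp
    show "\<forall>t. 0 \<le> t \<and> t < m \<longrightarrow> valid_query (nat m) (query_of ?q t) \<and> (\<forall>i. 0 \<le> ?q t i \<and> ?q t i \<le> m)"
    proof (intro allI impI, elim conjE)
      fix t assume t: "0 \<le> t" "t < m"
      show "valid_query (nat m) (query_of ?q t) \<and> (\<forall>i. 0 \<le> ?q t i \<and> ?q t i \<le> m)"
        using qry_bounds[of t lo s s', OF t lo[OF t]] by simp
    qed
  qed
  then obtain t s1 where ex: "exec V p (initial_state (inst_words m ?a ?q)) t s1" "t \<le> c"
    "fits V (initial_state (inst_words m ?a ?q))"
    "\<forall>i. 0 \<le> i \<and> i < m \<longrightarrow> mem s1 i = of_bool (ranges_disjoint (inst_array m ?a) (query_of ?q i))"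
    using p(1) unfolding solves_def by blast
  define G' where "G' i \<longleftrightarrow> \<not> (in_block s s' i \<and> hit i (lo i))" for i
  have out: "mem s1 i = of_bool (G' i)" if "0 \<le> i" "i < m" for i
    using ex(4) that disjoint_iff_not_hit[where lo=lo, OF that lo[OF that] s] by (simp add: G'_def)
  show ?thesis unfolding call_step_def
  proof (rule triple_Seq, rule starts_prog_correct[OF b(1,2,4,5,6) z'(1,2) z(3)])
    fix \<rho>1 \<mu>1 assume 1: "\<mu>1 = \<mu>(aRaw := (\<mu> aRaw)(z := m, z + 1 := m)) \<and>
      \<rho>1 20 = start (e div 3) \<and> \<rho>1 21 = start (e mod 3) \<and> agree {20, 21} \<rho>1 \<rho>"
    have b1: "base \<rho>1" using b(1) 1 by (simp add: base_def)
    show "triple W (Seq query_loop (Seq (call R p) (Seq collect_loop (block [Set rO (Var rO \<boxplus> Var rD)]))))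
      (nat m * 336 + R + 2 * c + 50) \<rho>1 \<mu>1 ?Q"
    proof (rule triple_Seq, rule query_loop_correct[where s=s and s'=s' and lo=lo and z=z and B=B and raw="\<mu> aRaw"])
      show "\<mu>1 aRaw = partial_inst m ?a ?q z (\<mu> aRaw) 0" using 1 partial_inst_0[OF m0] by simp
    next
      fix \<rho>2 \<mu>2 assume 2: "\<mu>2 = \<mu>1(aRaw := partial_inst m ?a ?q z (\<mu> aRaw) m) \<and>
        agree {14, 15, 22, 23, 24, 25, 26, 27} \<rho>2 \<rho>1"
      have \<mu>2: "\<mu>2 = \<mu>(aRaw := partial_inst m ?a ?q z (\<mu> aRaw) m)" using 1 2 by simp
      have r2: "\<rho>2 7 = z" "agree call_regs \<rho>2 \<rho>" using 1 2 b by auto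
      have b2: "base \<rho>2" using b(1) r2(2) by (simp add: base_def)
      show "triple W (Seq (call R p) (Seq collect_loop (block [Set rO (Var rO \<boxplus> Var rD)])))
        (nat m * 40 + R + 2 * c + 40) \<rho>2 \<mu>2 ?Q"
      proof (rule triple_Seq, rule triple_call[where \<rho>="\<rho>2" and z=z, OF ex(1,3) p(2) r2(1) z(1)])
        show "z + V \<le> W" using z p(3) Wb by linarith
        show "\<mu>2 0 (z + a) = mem (initial_state (inst_words m ?a ?q)) a" if a: "\<bar>a\<bar> \<le> V" for a
        proof -
          \<comment> \<open>Where the instance does not reach, the window still shows the zeros of
            an initial memory.\<close>
          have "\<mu> aRaw (z + a) = 0" using \<mu>(4) a by auto
          then show ?thesis using initial_inst[OF m0, of ?q ?a a] pre(2)
            by (auto simp: \<mu>2 partial_inst_full[OF m0])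
        qed
      next
        fix \<rho>3 \<mu>3 assume 3: "\<rho>3 = \<rho>2 \<and> (\<forall>c. c \<noteq> 0 \<longrightarrow> \<mu>3 c = \<mu>2 c) \<and>
          (\<forall>a. V < \<bar>a - z\<bar> \<longrightarrow> \<mu>3 0 a = \<mu>2 0 a) \<and> (\<forall>a. \<bar>a\<bar> \<le> V \<longrightarrow> \<mu>3 0 (z + a) = mem s1 a)"
        \<comment> \<open>With \<open>D = 2 * V + 1\<close> the next window starts at
          \<open>z + V + 1\<close>, just beyond the last cell that this run can have
          touched.\<close>
        have fresh: "\<mu>3 aRaw x = 0" if "z + D - V \<le> x" for x
        proof -
          have x: "V < \<bar>x - z\<bar>" "z - V \<le> x" "z + (2 + 5 * m) \<le> x"
            using that z p(3) m0 unfolding z(4) by linarith+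
          then have "\<mu>3 aRaw x = \<mu>2 aRaw x" using 3 by blast
          also have "\<dots> = 0" using x(3) \<mu>(4)[OF x(2)] by (simp add: \<mu>2 partial_inst_full[OF m0])
          finally show ?thesis .
        qed
        have F3: "\<mu>3 aF t = of_bool (G t) \<and> \<mu>3 aRaw (z + t) = of_bool (G' t)" if "0 \<le> t" "t < m" for t
          using 3 \<mu>(3)[OF that] out[OF that] that p(3) by (auto simp: \<mu>2)
        show "triple W (Seq collect_loop (block [Set rO (Var rO \<boxplus> Var rD)])) (nat m * 40 + 20) \<rho>3 \<mu>3 ?Q"
        proof (rule triple_Seq, rule collect_loop_correct[where z=z and B=B and G=G and G'=G'])
          fix \<rho>4 \<mu>4 assume 4: "(\<exists>F. \<mu>4 = \<mu>3(aF := F) \<and> (\<forall>t. 0 \<le> t \<and> t < m \<longrightarrow> F t = of_bool (G t \<and> G' t))) \<and>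
            agree {14, 15} \<rho>4 \<rho>3"
          then obtain F where F: "\<mu>4 = \<mu>3(aF := F)" "\<forall>t. 0 \<le> t \<and> t < m \<longrightarrow> F t = of_bool (G t \<and> G' t)" by blast
          have r4: "\<rho>4 7 = z" "\<rho>4 8 = D" "agree call_regs \<rho>4 \<rho>" using 4 3 r2 b(3) by auto
          have "\<bar>z + D\<bar> \<le> W" "1 \<le> W" using z z' Wb p(3) by linarith+
          moreover have "\<mu>4 a = \<mu> a" if "a \<noteq> aRaw" "a \<noteq> aF" for a using that F(1) 3 by (simp add: \<mu>2)
          ultimately show "triple W (block [Set rO (Var rO \<boxplus> Var rD)]) 5 \<rho>4 \<mu>4 ?Q"
            by (intro triple_block) (use r4 fresh F in \<open>auto simp: G'_def s_def s'_def\<close>)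
        qed (use b2 r2 3 z' z F3 in auto)
      qed (use ex(2) in auto)
    qed (use b1 1 b z z' s lo \<mu> in \<open>auto simp: s_def s'_def\<close>)
  qed auto
qed

end

section \<open>One round of the search, and all rounds together\<close>

definition update_loop :: prog where
  "update_loop = For 12 13 (Var rM)
     (block [Put aLow (Var 12) (Arr aLow (Var 12) \<boxplus> Arr aF (Var 12) \<boxtimes> Var rS)])"

definition round_body :: "nat \<Rightarrow> prog \<Rightarrow> prog" where
  "round_body R p = Seq (block [Set rS (Var rS \<boxslash> Num 2)])
     (Seq prep_prog (Seq (For 12 13 (Num 9) (call_step R p)) update_loop))"

definition search_loop :: "nat \<Rightarrow> prog \<Rightarrow> prog" where
  "search_loop R p = For 10 11 (Var rL) (round_body R p)"

abbreviation (input) round_regs :: "nat set" where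
  "round_regs \<equiv> {7, 9, 12, 13, 14, 15, 20, 21, 22, 23, 24, 25, 26, 27}"

context buckets
begin

lemma update_loop_correct:
  assumes b: "base \<rho>" "\<rho> rS = S" "1 \<le> S" "S \<le> P"
    and \<mu>: "\<And>t. 0 \<le> t \<Longrightarrow> t < m \<Longrightarrow> \<mu> aF t = of_bool (G t) \<and> 0 \<le> \<mu> aLow t \<and> \<mu> aLow t \<le> P"
  shows "triple W update_loop (nat m * 40 + 10) \<rho> \<mu> (\<lambda>\<rho>' \<mu>'. (\<exists>lo'. \<mu>' = \<mu>(aLow := lo') \<and>
    (\<forall>t. 0 \<le> t \<and> t < m \<longrightarrow> lo' t = \<mu> aLow t + of_bool (G t) * S)) \<and> agree {12, 13} \<rho>' \<rho>)"
proof -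
  note Wb = W_bounds m_ge P(2,3) W n
  define I where "I k \<rho>' \<mu>' \<longleftrightarrow> (\<exists>lo'. \<mu>' = \<mu>(aLow := lo') \<and>
    (\<forall>t. 0 \<le> t \<and> t < m \<longrightarrow> lo' t = \<mu> aLow t + of_bool (t < k \<and> G t) * S)) \<and> agree {12, 13} \<rho>' \<rho>"
    for k :: int and \<rho>' :: "nat \<Rightarrow> int" and \<mu>'
  show ?thesis unfolding update_loop_def
  proof (rule triple_For[where I=I and c="34"])
    show "I 0 (\<rho>(13 := m, 12 := 0)) \<mu>" unfolding I_def
      by - (rule conjI, rule exI[of _ "\<mu> aLow"], auto)
  next
    fix k \<rho>' \<mu>' assume k: "0 \<le> k" "k < m" "\<rho>' 12 = k" "\<rho>' 13 = m" "I k \<rho>' \<mu>'"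
    then obtain lo' where I: "\<mu>' = \<mu>(aLow := lo')"
      "\<forall>t. 0 \<le> t \<and> t < m \<longrightarrow> lo' t = \<mu> aLow t + of_bool (t < k \<and> G t) * S"
      "agree {12, 13} \<rho>' \<rho>" by (auto simp: I_def)
    have r: "\<rho>' rS = S" using b I by simp
    have l: "lo' k = \<mu> aLow k" "\<mu> aF k = of_bool (G k)" using I(2) k \<mu>[OF k(1,2)] by auto
    let ?v = "\<mu> aLow k + of_bool (G k) * S"
    have bb: "\<bar>?v\<bar> \<le> W" "\<bar>of_bool (G k) * S\<bar> \<le> W" "1 \<le> W" "16 * k + 16 \<le> W"
      using k b(3,4) \<mu>[OF k(1,2)] Wb by auto
    have I': "I (k + 1) (\<rho>'(12 := k + 1)) (\<mu>(aLow := lo'(k := ?v)))"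
      unfolding I_def using I(2,3) k
      by - (rule conjI, rule exI[of _ "lo'(k := ?v)"], auto)
    show "triple W (block [Put aLow (Var 12) (Arr aLow (Var 12) \<boxplus> Arr aF (Var 12) \<boxtimes> Var rS)]) 34 \<rho>' \<mu>'
      (step_post 12 13 k m I)"
      by (rule triple_block)
        (simp only: machine_simps fun_upd_upd r k(1,3,4) I(1) l bb I', use bb in auto)
  qed (use b Wb in \<open>auto simp: base_def I_def\<close>)
qed

text \<open>Each pair lies in some pair of blocks, and the calls for other blocks report it as
  disjoint. After all nine calls its flag is the negation of \<open>hit\<close>, that is, the
  comparison of \<open>lo t\<close> with the answer.\<close>

lemma calls_correct:
  assumes p: "solves p V m c" "prog_regs p \<subseteq> {..<R}" "5 * m + 2 \<le> V"
    and b: "base \<rho>" "\<rho> rO = z" "\<rho> rD = D"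
    and z: "V \<le> z" "z + 9 * D \<le> B" "16 * B + 16 \<le> W" "D = 2 * V + 1"
    and lo: "\<And>t. 0 \<le> t \<Longrightarrow> t < m \<Longrightarrow> lo t \<le> P"
    and \<mu>: "\<mu> aItem = item" "\<And>t. 0 \<le> t \<Longrightarrow> t < m \<Longrightarrow> \<mu> aX t = cnt (t div n) (lo t) \<and> \<mu> aY t = cnt (n + t mod n) (lo t)"
      "\<And>t. 0 \<le> t \<Longrightarrow> t < m \<Longrightarrow> \<mu> aF t = 1"
      "\<And>x. z - V \<le> x \<Longrightarrow> \<mu> aRaw x = 0"
  shows "triple W (For 12 13 (Num 9) (call_step R p)) (9 * (nat m * 336 + R + 2 * c + 156) + 10) \<rho> \<mu> (\<lambda>\<rho>' \<mu>'.
    \<rho>' rO = z + 9 * D \<and> agree ({12, 13} \<union> call_regs) \<rho>' \<rho> \<and>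
    (\<forall>a. a \<noteq> aRaw \<and> a \<noteq> aF \<longrightarrow> \<mu>' a = \<mu> a) \<and> (\<forall>x. z + 9 * D - V \<le> x \<longrightarrow> \<mu>' aRaw x = 0) \<and>
    (\<forall>t. 0 \<le> t \<and> t < m \<longrightarrow> \<mu>' aF t = of_bool (lo t \<le> answer t)))"
    (is "triple W _ _ _ _ ?Q")
proof -
  note Wb = W_bounds m_ge P(2,3) W n
  have V0: "0 \<le> V" using p(3) Wb by linarith
  define H where "H e t \<longleftrightarrow> in_block (start (e div 3)) (start (e mod 3)) t \<and> hit t (lo t)" for e t
  define I where "I e \<rho>' \<mu>' \<longleftrightarrow> \<rho>' rO = z + e * D \<and> agree ({12, 13} \<union> call_regs) \<rho>' \<rho> \<and>
    (\<forall>a. a \<noteq> aRaw \<and> a \<noteq> aF \<longrightarrow> \<mu>' a = \<mu> a) \<and> (\<forall>x. z + e * D - V \<le> x \<longrightarrow> \<mu>' aRaw x = 0) \<and>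
    (\<forall>t. 0 \<le> t \<and> t < m \<longrightarrow> \<mu>' aF t = of_bool (\<forall>e'. 0 \<le> e' \<and> e' < e \<longrightarrow> \<not> H e' t))"
    for e :: int and \<rho>' :: "nat \<Rightarrow> int" and \<mu>' :: "nat \<Rightarrow> int \<Rightarrow> int"
  show ?thesis
  proof (rule triple_For[where I=I and N=9 and c="nat m * 336 + R + 2 * c + 150"])
    show "I 0 (\<rho>(13 := 9, 12 := 0)) \<mu>" using b \<mu> by (auto simp: I_def)
  next
    fix e \<rho>' \<mu>' assume e: "0 \<le> e" "e < 9" "\<rho>' 12 = e" "\<rho>' 13 = 9" "I e \<rho>' \<mu>'"
    then have I: "\<rho>' rO = z + e * D" "agree ({12, 13} \<union> call_regs) \<rho>' \<rho>"
      "\<forall>a. a \<noteq> aRaw \<and> a \<noteq> aF \<longrightarrow> \<mu>' a = \<mu> a" "\<And>x. z + e * D - V \<le> x \<Longrightarrow> \<mu>' aRaw x = 0"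
      "\<And>t. 0 \<le> t \<Longrightarrow> t < m \<Longrightarrow> \<mu>' aF t = of_bool (\<forall>e'. 0 \<le> e' \<and> e' < e \<longrightarrow> \<not> H e' t)"
      by (auto simp: I_def)
    have b': "base \<rho>'" "\<rho>' rD = D" using b I(2) by (simp_all add: base_def)
    have D0: "0 \<le> D" using z(4) V0 by simp
    have "(e + 1) * D \<le> 9 * D" using e D0 by (intro mult_right_mono) auto
    then have "e * D + D \<le> 9 * D" unfolding distrib_right by simp
    moreover have "0 \<le> e * D" using e D0 by simp
    ultimately have zD: "V \<le> z + e * D" "z + e * D + D \<le> B" using z(1,2) by linarith+
    show "triple W (call_step R p) (nat m * 336 + R + 2 * c + 150) \<rho>' \<mu>'
      (step_post 12 13 e 9 I)"
    proof (rule triple_conseq, rule call_step_correct[where lo=lo and z="z + e * D" and D=D and B=B and e=e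
        and G="\<lambda>t. \<forall>e'. 0 \<le> e' \<and> e' < e \<longrightarrow> \<not> H e' t", OF p b'(1) I(1) b'(2) e(3,1,2) zD z(3,4) lo])
      fix \<rho>'' \<mu>'' assume 1: "\<rho>'' rO = z + e * D + D \<and> agree call_regs \<rho>'' \<rho>' \<and>
        (\<forall>a. a \<noteq> aRaw \<and> a \<noteq> aF \<longrightarrow> \<mu>'' a = \<mu>' a) \<and> (\<forall>x. z + e * D + D - V \<le> x \<longrightarrow> \<mu>'' aRaw x = 0) \<and>
        (\<forall>t. 0 \<le> t \<and> t < m \<longrightarrow> \<mu>'' aF t = of_bool ((\<forall>e'. 0 \<le> e' \<and> e' < e \<longrightarrow> \<not> H e' t) \<and>
          \<not> (in_block (start (e div 3)) (start (e mod 3)) t \<and> hit t (lo t))))"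
      have eq: "z + e * D + D = z + (e + 1) * D" by (simp add: algebra_simps)
      have less: "(\<forall>e'. 0 \<le> e' \<and> e' < e + 1 \<longrightarrow> \<not> H e' t) \<longleftrightarrow> (\<forall>e'. 0 \<le> e' \<and> e' < e \<longrightarrow> \<not> H e' t) \<and> \<not> H e t" for t
        using e(1) by (metis zless_add1_eq)
      show "\<rho>'' 12 = e \<and> \<rho>'' 13 = 9 \<and> I (e + 1) (\<rho>''(12 := e + 1)) \<mu>''"
        unfolding I_def less eq[symmetric] using 1 I(2,3) e(3,4) unfolding H_def[symmetric] by simp
    qed (use \<mu> I in auto)
  next
    fix \<rho>' \<mu>' assume I9: "I 9 \<rho>' \<mu>'"
    have "(\<forall>e'. 0 \<le> e' \<and> e' < 9 \<longrightarrow> \<not> H e' t) \<longleftrightarrow> lo t \<le> answer t" if t: "0 \<le> t" "t < m" for t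
    proof -
      note tb = pair_bounds[OF t]
      obtain c1 where c1: "0 \<le> c1" "c1 < 3" "start c1 \<le> t div n" "t div n < start c1 + h"
        using start_cover[OF tb(1,2)] by blast
      obtain c2 where c2: "0 \<le> c2" "c2 < 3" "start c2 \<le> t mod n" "t mod n < start c2 + h"
        using start_cover[OF tb(3,4)] by blast
      \<comment> \<open>Block numbers are the two digits of the call number in base 3; this is a
        call responsible for \<open>t\<close>.\<close>
      have e: "(3 * c1 + c2) div 3 = c1" "(3 * c1 + c2) mod 3 = c2" "0 \<le> 3 * c1 + c2" "3 * c1 + c2 < 9"
        using c1(1,2) c2(1,2) by simp_all
      have "in_block (start c1) (start c2) t" using c1 c2 by (simp add: in_block_def)
      then have "H (3 * c1 + c2) t \<longleftrightarrow> hit t (lo t)" unfolding H_def e by simp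
      then have "(\<forall>e'. 0 \<le> e' \<and> e' < 9 \<longrightarrow> \<not> H e' t) \<longleftrightarrow> \<not> hit t (lo t)"
        using e(3,4) unfolding H_def by blast
      then show ?thesis by (simp add: hit_iff not_less)
    qed
    then show "?Q \<rho>' \<mu>'" using I9 unfolding I_def by auto
  qed (use Wb in auto)
qed

definition round_cost :: "nat \<Rightarrow> nat \<Rightarrow> nat" where
  "round_cost R c = nat m * (L * 140 + 3200) + 9 * R + 18 * c + 1500"

lemma round_body_correct:
  assumes p: "solves p V m c" "prog_regs p \<subseteq> {..<R}" "5 * m + 2 \<le> V"
    and b: "base \<rho>" "\<rho> rO = z" "\<rho> rD = D" "\<rho> rS = 2 * S" "1 \<le> S" "P = T * (2 * S)"
    and z: "V \<le> z" "z + 9 * D \<le> B" "16 * B + 16 \<le> W" "D = 2 * V + 1"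
    and \<mu>: "\<mu> aItem = item" "\<mu> aRank = rk" "\<And>x. z - V \<le> x \<Longrightarrow> \<mu> aRaw x = 0"
      "\<And>t. 0 \<le> t \<Longrightarrow> t < m \<Longrightarrow> \<mu> aLow t = answer t div (2 * S) * (2 * S)"
  shows "triple W (round_body R p) (round_cost R c) \<rho> \<mu> (\<lambda>\<rho>' \<mu>'.
    \<rho>' rO = z + 9 * D \<and> \<rho>' rS = S \<and> agree round_regs \<rho>' \<rho> \<and>
    (\<forall>a. a \<notin> {aRaw, aX, aY, aF, aLow} \<longrightarrow> \<mu>' a = \<mu> a) \<and> (\<forall>x. z + 9 * D - V \<le> x \<longrightarrow> \<mu>' aRaw x = 0) \<and>
    (\<forall>t. 0 \<le> t \<and> t < m \<longrightarrow> \<mu>' aLow t = answer t div S * S))" (is "triple W _ _ _ _ ?Q")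
proof -
  note Wb = W_bounds m_ge P(2,3) W n
  define lo where "lo t = answer t div (2 * S) * (2 * S) + S" for t
  \<comment> \<open>As \<open>P\<close> is a multiple of \<open>2 * S\<close>, the interval of
    length \<open>2 * S\<close> that contains the answer does not cross \<open>P\<close>. Its
    midpoint is thus a legal threshold, as required for the bounds on prefix lengths.\<close>
  have lo: "0 \<le> answer t div (2 * S) * (2 * S)" "lo t \<le> P" if "0 \<le> t" "t < m" for t
  proof -
    note a = answer_bounds(1,2)[OF that]
    have "answer t div (2 * S) * (2 * S) \<le> answer t"
      using div_mult_mod_eq[of "answer t" "2 * S"] pos_mod_sign[of "2 * S" "answer t"] b(5) by linarith
    then have "answer t div (2 * S) * (2 * S) < T * (2 * S)" using a b(6) by linarith
    then have "answer t div (2 * S) < T" using b(5) by (simp add: mult_less_cancel_right)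
    then have "(answer t div (2 * S) + 1) * (2 * S) \<le> T * (2 * S)" using b(5) by (intro mult_right_mono) auto
    then show "lo t \<le> P" using b(5,6) unfolding lo_def distrib_right by linarith
    show "0 \<le> answer t div (2 * S) * (2 * S)" using a b(5) by (simp add: pos_imp_zdiv_nonneg_iff)
  qed
  have T: "1 \<le> T"
  proof (rule ccontr)
    assume "\<not> 1 \<le> T"
    then have "T * (2 * S) \<le> 0" using b(5) by (intro mult_nonpos_nonneg) auto
    then show False using b(6) Wb by linarith
  qed
  have "1 * (2 * S) \<le> P" unfolding b(6) using T b(5) by (intro mult_right_mono) auto
  then have SP: "2 * S \<le> P" by simp
  show ?thesis unfolding round_body_def
  proof (rule triple_Seq)
    show "triple W (block [Set rS (Var rS \<boxslash> Num 2)]) 10 \<rho> \<mu> (\<lambda>\<rho>' \<mu>'. \<rho>' = \<rho>(rS := S) \<and> \<mu>' = \<mu>)"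
    proof (rule triple_block)
      have "\<bar>S\<bar> \<le> W" "2 \<le> W" "1 \<le> W" using SP b(5) Wb by linarith+
      then show "wp W [Set rS (Var rS \<boxslash> Num 2)] \<rho> \<mu> (\<lambda>\<rho>' \<mu>'. \<rho>' = \<rho>(rS := S) \<and> \<mu>' = \<mu>)" using b(4) by simp
    qed (use Wb in auto)
  next
    fix \<rho>1 \<mu>1 assume 1: "\<rho>1 = \<rho>(rS := S) \<and> \<mu>1 = \<mu>"
    show "triple W (Seq prep_prog (Seq (For 12 13 (Num 9) (call_step R p)) update_loop))
      (nat m * (L * 140 + 3200) + 9 * R + 18 * c + 1490) \<rho>1 \<mu>1 ?Q"
    proof (rule triple_Seq, rule prep_prog_correct[where S=S and lo=lo])
      show "base \<rho>1" using b(1) 1 by (simp add: base_def)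
      show "lo t = \<mu>1 aLow t + S \<and> 0 \<le> lo t \<and> lo t \<le> P" if "0 \<le> t" "t < m" for t
        using lo[OF that] \<mu>(4)[OF that] 1 b(5) by (simp add: lo_def)
    next
      fix \<rho>2 \<mu>2 assume 2: "(\<exists>X Y F. \<mu>2 = \<mu>1(aX := X, aY := Y, aF := F) \<and>
        (\<forall>t. 0 \<le> t \<and> t < m \<longrightarrow> X t = cnt (t div n) (lo t) \<and> Y t = cnt (n + t mod n) (lo t) \<and> F t = 1)) \<and>
        agree prep_regs \<rho>2 \<rho>1"
      then have \<mu>2: "\<forall>a. a \<notin> {aX, aY, aF} \<longrightarrow> \<mu>2 a = \<mu> a"
        "\<And>t. 0 \<le> t \<Longrightarrow> t < m \<Longrightarrow> \<mu>2 aX t = cnt (t div n) (lo t) \<and> \<mu>2 aY t = cnt (n + t mod n) (lo t)"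
        "\<And>t. 0 \<le> t \<Longrightarrow> t < m \<Longrightarrow> \<mu>2 aF t = 1" using 1 by auto
      have r2: "agree (insert 9 prep_regs) \<rho>2 \<rho>" "\<rho>2 9 = S" using 1 2 by auto
      have b2: "base \<rho>2" "\<rho>2 rO = z" "\<rho>2 rD = D" using b(1-3) r2(1) by (simp_all add: base_def)
      show "triple W (Seq (For 12 13 (Num 9) (call_step R p)) update_loop)
        (9 * (nat m * 336 + R + 2 * c + 156) + 10 + (nat m * 40 + 10)) \<rho>2 \<mu>2 ?Q"
      proof (rule triple_Seq, rule calls_correct[where lo=lo and z=z and D=D, OF p b2 z lo(2) _ \<mu>2(2,3)])
        fix \<rho>3 \<mu>3 assume 3: "\<rho>3 rO = z + 9 * D \<and> agree ({12, 13} \<union> call_regs) \<rho>3 \<rho>2 \<and>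
          (\<forall>a. a \<noteq> aRaw \<and> a \<noteq> aF \<longrightarrow> \<mu>3 a = \<mu>2 a) \<and> (\<forall>x. z + 9 * D - V \<le> x \<longrightarrow> \<mu>3 aRaw x = 0) \<and>
          (\<forall>t. 0 \<le> t \<and> t < m \<longrightarrow> \<mu>3 aF t = of_bool (lo t \<le> answer t))"
        have r3: "\<rho>3 9 = S" "agree round_regs \<rho>3 \<rho>" using 3 r2 by auto
        have b3: "base \<rho>3" using b(1) r3(2) by (simp add: base_def)
        have \<mu>3: "\<mu>3 aLow = \<mu> aLow" "\<forall>a. a \<notin> {aRaw, aX, aY, aF} \<longrightarrow> \<mu>3 a = \<mu> a" using 3 \<mu>2(1) by auto
        show "triple W update_loop (nat m * 40 + 10) \<rho>3 \<mu>3 ?Q"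
        proof (rule triple_conseq, rule update_loop_correct[where S=S and G="\<lambda>t. lo t \<le> answer t"])
          show "base \<rho>3" by (rule b3)
          show "\<mu>3 aF t = of_bool (lo t \<le> answer t) \<and> 0 \<le> \<mu>3 aLow t \<and> \<mu>3 aLow t \<le> P" if "0 \<le> t" "t < m" for t
            using 3 that lo[OF that] \<mu>(4)[OF that] b(5) by (auto simp: \<mu>3(1) lo_def)
        next
          fix \<rho>4 \<mu>4 assume 4: "(\<exists>lo'. \<mu>4 = \<mu>3(aLow := lo') \<and>
            (\<forall>t. 0 \<le> t \<and> t < m \<longrightarrow> lo' t = \<mu>3 aLow t + of_bool (lo t \<le> answer t) * S)) \<and>
            agree {12, 13} \<rho>4 \<rho>3"
          then obtain lo' where lo': "\<mu>4 = \<mu>3(aLow := lo')"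
            "\<And>t. 0 \<le> t \<Longrightarrow> t < m \<Longrightarrow> lo' t = \<mu>3 aLow t + of_bool (lo t \<le> answer t) * S" by blast
          have "lo' t = answer t div S * S" if "0 \<le> t" "t < m" for t
            using lo'(2)[OF that] binary_step[OF b(5), of "answer t"] \<mu>(4)[OF that] by (simp add: \<mu>3(1) lo_def)
          then show "?Q \<rho>4 \<mu>4" using lo'(1) 3 4 r3 \<mu>3(2) by auto
        qed (use r3 b(5) SP in auto)
      qed (use \<mu>2(1) \<mu>(1,3) in auto)
    qed (use 1 \<mu> in \<open>auto simp: distrib_left\<close>)
  qed (simp add: round_cost_def)
qed

text \<open>The \<open>9 * L\<close> calls get room for \<open>9 * P\<close> windows, by the crude
  bound of \<open>L\<close> by \<open>P\<close>. Reserved but unvisited windows cost address space,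
  not time.\<close>

lemma search_loop_correct:
  assumes p: "solves p V m c" "prog_regs p \<subseteq> {..<R}" "5 * m + 2 \<le> V"
    and b: "base \<rho>" "\<rho> rO = z" "\<rho> rD = D" "\<rho> rS = P"
    and z: "V \<le> z" "z + 9 * P * D \<le> B" "16 * B + 16 \<le> W" "D = 2 * V + 1"
    and \<mu>: "\<mu> aItem = item" "\<mu> aRank = rk" "\<And>x. z - V \<le> x \<Longrightarrow> \<mu> aRaw x = 0" "\<mu> aLow = (\<lambda>_. 0)"
  shows "triple W (search_loop R p) (L * (round_cost R c + 6) + 10) \<rho> \<mu> (\<lambda>\<rho>' \<mu>'. base \<rho>' \<and>
    \<mu>' aKey = \<mu> aKey \<and> \<mu>' aSrc = \<mu> aSrc \<and> (\<forall>t. 0 \<le> t \<and> t < m \<longrightarrow> \<mu>' aLow t = answer t))"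
    (is "triple W _ _ _ _ ?Q")
proof -
  note Wb = W_bounds m_ge P(2,3) W n
  define S where "S k = P div 2 ^ nat k" for k
  have D0: "0 \<le> D" using z(4) p(3) Wb by linarith
  define I where "I k \<rho>' \<mu>' \<longleftrightarrow> \<rho>' rO = z + 9 * k * D \<and> \<rho>' rS = S k \<and>
    agree ({10, 11} \<union> round_regs) \<rho>' \<rho> \<and>
    (\<forall>a. a \<notin> {aRaw, aX, aY, aF, aLow} \<longrightarrow> \<mu>' a = \<mu> a) \<and> (\<forall>x. z + 9 * k * D - V \<le> x \<longrightarrow> \<mu>' aRaw x = 0) \<and>
    (\<forall>t. 0 \<le> t \<and> t < m \<longrightarrow> \<mu>' aLow t = answer t div S k * S k)"
    for k :: int and \<rho>' :: "nat \<Rightarrow> int" and \<mu>' :: "nat \<Rightarrow> int \<Rightarrow> int"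
  show ?thesis unfolding search_loop_def
  proof (rule triple_For[where I=I and N="int L" and c="round_cost R c"])
    show "I 0 (\<rho>(11 := int L, 10 := 0)) \<mu>" using b \<mu> answer_bounds by (simp add: I_def S_def)
  next
    fix k \<rho>' \<mu>' assume k: "0 \<le> k" "k < int L" "\<rho>' 10 = k" "\<rho>' 11 = int L" "I k \<rho>' \<mu>'"
    then have I: "\<rho>' rO = z + 9 * k * D" "\<rho>' rS = S k" "agree ({10, 11} \<union> round_regs) \<rho>' \<rho>"
      "\<forall>a. a \<notin> {aRaw, aX, aY, aF, aLow} \<longrightarrow> \<mu>' a = \<mu> a" "\<And>x. z + 9 * k * D - V \<le> x \<Longrightarrow> \<mu>' aRaw x = 0"
      "\<And>t. 0 \<le> t \<Longrightarrow> t < m \<Longrightarrow> \<mu>' aLow t = answer t div S k * S k" by (auto simp: I_def)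
    note PS = P_div_step[OF k(1,2), folded S_def]
    have b': "base \<rho>'" "\<rho>' rD = D" using b I(3) by (simp_all add: base_def)
    have "(k + 1) * D \<le> P * D" using k L D0 by (intro mult_right_mono) auto
    then have kD: "9 * k * D + 9 * D \<le> 9 * P * D" by (simp add: algebra_simps)
    have kD0: "0 \<le> 9 * k * D" using k D0 by simp
    have zz: "V \<le> z + 9 * k * D" "z + 9 * k * D + 9 * D \<le> B" using z kD kD0 by linarith+
    have "L = nat k + (L - nat k)" using k by linarith
    then have "P = 2 ^ nat k * 2 ^ (L - nat k)" using P(1) by (metis power_add)
    moreover from this have "S k = 2 ^ (L - nat k)" unfolding S_def by simp
    ultimately have PT: "P = 2 ^ nat k * (2 * S (k + 1))" unfolding PS(3)[symmetric] by simp
    show "triple W (round_body R p) (round_cost R c) \<rho>' \<mu>'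
      (step_post 10 11 k (int L) I)"
    proof (rule triple_conseq, rule round_body_correct[where z="z + 9 * k * D" and D=D and S="S (k + 1)" and T="2 ^ nat k" and B=B,
        OF p b'(1) I(1) b'(2) _ PS(2) PT zz z(3,4)])
      fix \<rho>'' \<mu>'' assume 1: "\<rho>'' rO = z + 9 * k * D + 9 * D \<and> \<rho>'' rS = S (k + 1) \<and>
        agree round_regs \<rho>'' \<rho>' \<and>
        (\<forall>a. a \<notin> {aRaw, aX, aY, aF, aLow} \<longrightarrow> \<mu>'' a = \<mu>' a) \<and>
        (\<forall>x. z + 9 * k * D + 9 * D - V \<le> x \<longrightarrow> \<mu>'' aRaw x = 0) \<and>
        (\<forall>t. 0 \<le> t \<and> t < m \<longrightarrow> \<mu>'' aLow t = answer t div S (k + 1) * S (k + 1))"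
      have eq: "z + 9 * k * D + 9 * D = z + 9 * (k + 1) * D" by (simp add: algebra_simps)
      show "\<rho>'' 10 = k \<and> \<rho>'' 11 = int L \<and> I (k + 1) (\<rho>''(10 := k + 1)) \<mu>''"
        unfolding I_def eq[symmetric] using 1 I(3,4) k(3,4) by simp
    qed (use \<mu> I PS in auto)
  next
    fix \<rho>' \<mu>' assume "I (int L) \<rho>' \<mu>'"
    moreover have "S (int L) = 1" using P(1) by (simp add: S_def)
    ultimately show "?Q \<rho>' \<mu>'" using b(1) unfolding I_def base_def by simp
  qed (use b Wb in \<open>auto simp: base_def\<close>)
qed

end


section \<open>The complete program\<close>

text \<open>The program computes the solver's word bound itself, \<open>d\<close> being a constant
  of the program. The first centre lies \<open>V\<close> beyond the \<open>1 + 2 * m\<close> input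
  words, so the first window starts on zeros right behind the input.\<close>

definition window_prog :: "nat \<Rightarrow> prog" where
  "window_prog d = Seq (block [Set 20 (Num 4 \<boxplus> Num 6 \<boxtimes> Var rM), Set 21 (Num 1)])
     (Seq (For 10 11 (Num (int d)) (block [Set 21 (Var 21 \<boxtimes> Var 20)]))
       (block [Set rO (Num 1 \<boxplus> Var rM \<boxplus> Var rM \<boxplus> Var 21), Set rD (Var 21 \<boxplus> Var 21 \<boxplus> Num 1), Set rS (Var rP)]))"

lemma (in sizes) window_prog_correct:
  assumes b: "base \<rho>" and V: "V = (4 + 6 * m) ^ d" "1 + 2 * m + 2 * V \<le> W" "4 + 6 * m \<le> W" "int d \<le> W"
  shows "triple W (window_prog d) (d * 20 + 60) \<rho> \<mu> (\<lambda>\<rho>' \<mu>'. \<mu>' = \<mu> \<and> base \<rho>' \<and>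
    \<rho>' rO = 1 + 2 * m + V \<and> \<rho>' rD = 2 * V + 1 \<and> \<rho>' rS = P)"
    (is "triple W _ _ _ _ ?Q")
proof -
  note Wb = W_bounds m_ge P(2,3) W n
  let ?a = "4 + 6 * m"
  have a: "1 \<le> ?a" using Wb by linarith
  have V0: "1 \<le> V" unfolding V(1) using a by (rule one_le_power)
  define I where "I k \<rho>' \<mu>' \<longleftrightarrow> \<mu>' = \<mu> \<and> \<rho>' 20 = ?a \<and> \<rho>' 21 = ?a ^ nat k \<and> base \<rho>'"
    for k :: int and \<rho>' :: "nat \<Rightarrow> int" and \<mu>' :: "nat \<Rightarrow> int \<Rightarrow> int"
  show ?thesis unfolding window_prog_def
  proof (rule triple_Seq)
    show "triple W (block [Set 20 (Num 4 \<boxplus> Num 6 \<boxtimes> Var rM), Set 21 (Num 1)]) 20 \<rho> \<mu>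
      (\<lambda>\<rho>' \<mu>'. \<rho>' = \<rho>(20 := ?a, 21 := 1) \<and> \<mu>' = \<mu>)"
      by (rule triple_block) (use b V Wb in \<open>auto simp: base_def\<close>)
  next
    fix \<rho>1 \<mu>1 assume 1: "\<rho>1 = \<rho>(20 := ?a, 21 := 1) \<and> \<mu>1 = \<mu>"
    show "triple W (Seq (For 10 11 (Num (int d)) (block [Set 21 (Var 21 \<boxtimes> Var 20)]))
       (block [Set rO (Num 1 \<boxplus> Var rM \<boxplus> Var rM \<boxplus> Var 21), Set rD (Var 21 \<boxplus> Var 21 \<boxplus> Num 1), Set rS (Var rP)]))
       (d * 20 + 40) \<rho>1 \<mu>1 ?Q"
    proof (rule triple_Seq)
      show "triple W (For 10 11 (Num (int d)) (block [Set 21 (Var 21 \<boxtimes> Var 20)]))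
        (nat (int d) * (14 + 6) + cost (Num (int d)) + 5) \<rho>1 \<mu>1 (\<lambda>\<rho>' \<mu>'. I (int d) \<rho>' \<mu>')"
      proof (rule triple_For[where I=I])
        show "I 0 (\<rho>1(11 := int d, 10 := 0)) \<mu>1" using 1 b by (simp add: I_def base_def)
      next
        fix k \<rho>' \<mu>' assume k: "0 \<le> k" "k < int d" "\<rho>' 10 = k" "\<rho>' 11 = int d" "I k \<rho>' \<mu>'"
        then have I: "\<mu>' = \<mu>" "\<rho>' 20 = ?a" "\<rho>' 21 = ?a ^ nat k" "base \<rho>'" by (auto simp: I_def)
        have s: "nat (k + 1) = Suc (nat k)" using k by simp
        have new: "?a ^ nat k * ?a = ?a ^ nat (k + 1)" unfolding s by simp
        have "?a ^ nat (k + 1) \<le> V" unfolding V(1) using k a by (intro power_increasing) auto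
        moreover have "0 \<le> ?a ^ nat (k + 1)" using a by simp
        ultimately have bb: "\<bar>?a ^ nat (k + 1)\<bar> \<le> W" "1 \<le> W" using V V0 Wb by linarith+
        have I': "I (k + 1) (\<rho>'(21 := ?a ^ nat (k + 1), 10 := k + 1)) \<mu>"
          using I by (simp add: I_def base_def)
        show "triple W (block [Set 21 (Var 21 \<boxtimes> Var 20)]) 14 \<rho>' \<mu>'
          (step_post 10 11 k (int d) I)"
          by (rule triple_block) (simp only: machine_simps I(1-3) new bb k(3,4) I', use bb in auto)
      qed (use Wb V in auto)
    next
      fix \<rho>2 \<mu>2 assume "I (int d) \<rho>2 \<mu>2"
      then have 2: "\<mu>2 = \<mu>" "\<rho>2 21 = V" "base \<rho>2" by (auto simp: I_def V(1))
      then have r2: "\<rho>2 rM = m" "\<rho>2 rP = P" by (auto simp: base_def)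
      show "triple W (block [Set rO (Num 1 \<boxplus> Var rM \<boxplus> Var rM \<boxplus> Var 21), Set rD (Var 21 \<boxplus> Var 21 \<boxplus> Num 1), Set rS (Var rP)])
        30 \<rho>2 \<mu>2 ?Q"
        by (rule triple_block) (use 2 r2 V0 V(2) Wb in \<open>auto simp: base_def\<close>)
    qed auto
  qed auto
qed

definition output_loop :: prog where
  "output_loop = For 10 11 (Var rM) (block [Put aRaw (Var 10) (Arr aKey (Arr aSrc (Arr aLow (Var 10))))])"

lemma (in buckets) output_loop_correct:
  assumes b: "base \<rho>" and \<mu>: "\<mu> aSrc = \<sigma>" "\<And>t. 0 \<le> t \<Longrightarrow> t < m \<Longrightarrow> \<mu> aLow t = answer t"
  shows "triple W output_loop (nat m * 40 + 10) \<rho> \<mu> (\<lambda>\<rho>' \<mu>'.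
    \<forall>t. 0 \<le> t \<and> t < m \<longrightarrow> \<mu>' aRaw t = \<mu> aKey (\<sigma> (answer t)))"
proof -
  note Wb = W_bounds m_ge P(2,3) W n
  define I where "I k \<rho>' \<mu>' \<longleftrightarrow> (\<exists>f. \<mu>' = \<mu>(aRaw := f) \<and>
    (\<forall>t. 0 \<le> t \<and> t < k \<longrightarrow> f t = \<mu> aKey (\<sigma> (answer t))))"
    for k :: int and \<rho>' :: "nat \<Rightarrow> int" and \<mu>' :: "nat \<Rightarrow> int \<Rightarrow> int"
  show ?thesis unfolding output_loop_def
  proof (rule triple_For[where I=I and c="34"])
    show "I 0 (\<rho>(11 := m, 10 := 0)) \<mu>" by (auto simp: I_def intro!: exI[of _ "\<mu> aRaw"])
  next
    fix k \<rho>' \<mu>' assume k: "0 \<le> k" "k < m" "\<rho>' 10 = k" "\<rho>' 11 = m" "I k \<rho>' \<mu>'"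
    then obtain f where f: "\<mu>' = \<mu>(aRaw := f)" "\<forall>t. 0 \<le> t \<and> t < k \<longrightarrow> f t = \<mu> aKey (\<sigma> (answer t))"
      by (auto simp: I_def)
    note a = answer_bounds(1,2)[OF k(1,2)]
    note s = \<sigma>_range[OF a]
    have bb: "16 * k + 16 \<le> W" "0 \<le> answer k" "16 * answer k + 16 \<le> W" "0 \<le> \<sigma> (answer k)" "16 * \<sigma> (answer k) + 16 \<le> W"
      "1 \<le> W" using k a s Wb by linarith+
    have I': "I (k + 1) r (\<mu>(aRaw := f(k := \<mu> aKey (\<sigma> (answer k)))))" for r
      unfolding I_def using f(2) by (intro exI[of _ "f(k := \<mu> aKey (\<sigma> (answer k)))"]) auto
    show "triple W (block [Put aRaw (Var 10) (Arr aKey (Arr aSrc (Arr aLow (Var 10))))]) 34 \<rho>' \<mu>'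
      (step_post 10 11 k m I)"
      by (rule triple_block)
        (simp only: machine_simps fun_upd_upd zero_neq_numeral numeral_neq_zero f(1) k(1,3,4) \<mu>(1) \<mu>(2)[OF k(1,2)] bb I',
          use bb in auto)
  qed (use b Wb in \<open>auto simp: base_def I_def\<close>)
qed

definition main_prog :: "nat \<Rightarrow> prog \<Rightarrow> nat \<Rightarrow> prog" where
  "main_prog R p d = Seq setup_prog (Seq keys_prog (Seq sort_prog (Seq bucket_prog
     (Seq (window_prog d) (Seq (search_loop R p) output_loop)))))"

text \<open>\<open>M\<close> stands for the square of n, \<open>l\<close> for a bound on the number
  of rounds and \<open>c\<close> for the time of one solver call. The 18 is nine calls per round
  times the factor 2 of the relocation.\<close>

definition main_cost :: "nat \<Rightarrow> nat \<Rightarrow> nat \<Rightarrow> nat \<Rightarrow> nat \<Rightarrow> nat" where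
  "main_cost d R M l c = M * 1000 + l * (M * 1200) + l * (M * (l * 140 + 3200) + 9 * R + 18 * c + 1506) + d * 20 + 300"

lemma main_prog_correct:
  fixes n m V W B :: int
  assumes n: "2 \<le> n" and m: "m = n * n" and r: "\<rho> rN = n"
    and p: "solves p V m c" "prog_regs p \<subseteq> {..<R}" "5 * m + 2 \<le> V" "V = (4 + 6 * m) ^ d"
    and Wa: "64 * (4 * m) + 64 \<le> W" "B = 1 + 2 * m + V + 36 * m * (2 * V + 1)" "16 * B + 16 \<le> W" "int d \<le> W"
    and l: "4 * m \<le> 2 ^ l"
    and \<mu>: "\<And>c. c \<noteq> 0 \<Longrightarrow> \<mu> c = (\<lambda>_. 0)" "\<And>x. 1 + 2 * m \<le> x \<Longrightarrow> \<mu> 0 x = 0"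
  shows "triple W (main_prog R p d) (main_cost d R (nat m) l c) \<rho> \<mu> (\<lambda>\<rho>' \<mu>'. \<forall>t. 0 \<le> t \<and> t < m \<longrightarrow>
    \<mu>' 0 t = Min ((\<lambda>k. max (\<mu> 0 (1 + t div n * n + k)) (\<mu> 0 (1 + m + k * n + t mod n))) ` {0..<n}))"
    (is "triple W _ _ _ _ ?Q")
  unfolding main_prog_def
proof (rule triple_Seq, rule setup_prog_correct[where \<rho>="\<rho>" and n=n, OF n m Wa(1) r])
  fix \<rho>1 \<mu>1 assume "\<mu>1 = \<mu> \<and> (\<exists>L. sizes n m (n div 2) (2 ^ L) W L \<and> \<rho>1 rN = n \<and> \<rho>1 rM = m \<and>
    \<rho>1 rH = n div 2 \<and> \<rho>1 rP = 2 ^ L \<and> \<rho>1 rL = int L)"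
  then obtain L where 1: "\<mu>1 = \<mu>" and sz: "sizes n m (n div 2) (2 ^ L) W L"
    and r1: "\<rho>1 rN = n" "\<rho>1 rM = m" "\<rho>1 rH = n div 2" "\<rho>1 rP = 2 ^ L" "\<rho>1 rL = int L" by blast
  define P :: int where "P = 2 ^ L"
  interpret sizes n m "n div 2" P W L using sz unfolding P_def .
  have b1: "base \<rho>1" using r1 unfolding base_def P_def[symmetric] by simp
  note Wb = W_bounds m_ge P(2,3) sizes.W[OF sz, folded P_def] n
  have V0: "1 \<le> V" using p(3) Wb by linarith
  \<comment> \<open>\<open>L\<close> is found by the program at run time, whereas \<open>l\<close>
    is fixed in advance and enters the time bound; \<open>P < 4 * m\<close> relates the two.\<close>
  have "(2::int) ^ L < 2 ^ l" using P l unfolding P_def by linarith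
  then have Ll: "L \<le> l" by (simp add: power_strict_increasing_iff)
  have P4: "nat P \<le> 4 * nat m" using Wb by linarith
  have PD: "9 * P * (2 * V + 1) \<le> 36 * m * (2 * V + 1)" using Wb V0 by (intro mult_right_mono) auto
  have mV: "0 \<le> 36 * m * (2 * V + 1)" using Wb V0 by (intro mult_nonneg_nonneg) auto
  show "triple W (Seq keys_prog (Seq sort_prog (Seq bucket_prog (Seq (window_prog d) (Seq (search_loop R p) output_loop)))))
    (nat m * 900 + l * (nat m * 1200) + l * (nat m * (l * 140 + 3200) + 9 * R + 18 * c + 1506) + d * 20 + 240) \<rho>1 \<mu>1 ?Q"
  proof (rule triple_Seq, rule keys_prog_correct[OF b1])
    fix \<rho>2 \<mu>2 assume "(\<exists>K. \<mu>2 = \<mu>1(aKey := K) \<and> (\<forall>x. 0 \<le> x \<and> x < m \<longrightarrow> K x = \<mu>1 aRaw (1 + x) \<and>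
      K (m + x) = \<mu>1 aRaw (1 + m + x mod n * n + x div n))) \<and> agree {10, 11} \<rho>2 \<rho>1"
    then obtain K where 2: "\<mu>2 = \<mu>(aKey := K)" "\<And>x. 0 \<le> x \<Longrightarrow> x < m \<Longrightarrow> K x = \<mu> aRaw (1 + x) \<and>
      K (m + x) = \<mu> aRaw (1 + m + x mod n * n + x div n)" and "agree {10, 11} \<rho>2 \<rho>1" using 1 by blast
    then have b2: "base \<rho>2" using b1 by (simp add: base_def)
    then have r2: "\<rho>2 rP = P" "\<rho>2 rL = int L" by (auto simp: base_def)
    show "triple W (Seq sort_prog (Seq bucket_prog (Seq (window_prog d) (Seq (search_loop R p) output_loop))))
      (nat m * 740 + l * (nat m * 1200) + l * (nat m * (l * 140 + 3200) + 9 * R + 18 * c + 1506) + d * 20 + 220) \<rho>2 \<mu>2 ?Q"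
    proof (rule triple_Seq, rule sort_prog_correct[where K=K and P=P and L=L])
      fix \<rho>3 \<mu>3 assume "\<exists>f g. \<mu>3 = \<mu>2(aSrc := f, aDst := g) \<and> (\<forall>x. 0 \<le> f x \<and> f x < P) \<and>
        mset (chunk f 0 P) = mset [0..P - 1] \<and> sorted (map K (chunk f 0 P)) \<and>
        agree sort_regs \<rho>3 \<rho>2"
      then obtain \<sigma> g where 3: "\<mu>3 = \<mu>2(aSrc := \<sigma>, aDst := g)" "mset (chunk \<sigma> 0 P) = mset [0..P - 1]"
        "sorted (map K (chunk \<sigma> 0 P))" "agree sort_regs \<rho>3 \<rho>2" by blast
      then have b3: "base \<rho>3" using b2 by (simp add: base_def sort_regs_def pass_regs_def)
      interpret sorting n m "n div 2" P W L K \<sigma> using 3 by unfold_locales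
      show "triple W (Seq bucket_prog (Seq (window_prog d) (Seq (search_loop R p) output_loop)))
        (nat m * 600 + l * (nat m * (l * 140 + 3200) + 9 * R + 18 * c + 1506) + d * 20 + 150) \<rho>3 \<mu>3 ?Q"
      proof (rule triple_Seq, rule bucket_prog_correct[OF b3])
        fix \<rho>4 \<mu>4 assume "(\<exists>item rk fill. \<mu>4 = \<mu>3(aItem := item, aRank := rk, aFill := fill) \<and>
          buckets n m (n div 2) P W L K \<sigma> item rk) \<and> agree {10, 11, 20, 21, 22} \<rho>4 \<rho>3"
        then obtain item rk fill where 4: "\<mu>4 = \<mu>3(aItem := item, aRank := rk, aFill := fill)"
          and bk: "buckets n m (n div 2) P W L K \<sigma> item rk" and "agree {10, 11, 20, 21, 22} \<rho>4 \<rho>3"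
          by blast
        then have b4: "base \<rho>4" using b3 by (simp add: base_def)
        interpret buckets n m "n div 2" P W L K \<sigma> item rk by (rule bk)
        have \<mu>4: "\<mu>4 aKey = K" "\<mu>4 aSrc = \<sigma>" "\<mu>4 aItem = item" "\<mu>4 aRank = rk" "\<mu>4 aLow = (\<lambda>_. 0)"
          "\<mu>4 aRaw = \<mu> aRaw" using 4 3(1) 2(1) \<mu>(1) by simp_all
        show "triple W (Seq (window_prog d) (Seq (search_loop R p) output_loop))
          (nat m * 100 + l * (nat m * (l * 140 + 3200) + 9 * R + 18 * c + 1506) + d * 20 + 120) \<rho>4 \<mu>4 ?Q"
        proof (rule triple_Seq, rule window_prog_correct[OF b4 p(4)])
          fix \<rho>5 \<mu>5 assume 5: "\<mu>5 = \<mu>4 \<and> base \<rho>5 \<and> \<rho>5 rO = 1 + 2 * m + V \<and> \<rho>5 rD = 2 * V + 1 \<and> \<rho>5 rS = P"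
          show "triple W (Seq (search_loop R p) output_loop)
            (nat m * 100 + l * (nat m * (l * 140 + 3200) + 9 * R + 18 * c + 1506) + 50) \<rho>5 \<mu>5 ?Q"
          proof (rule triple_Seq, rule search_loop_correct[where z="1 + 2 * m + V" and D="2 * V + 1" and B=B, OF p(1-3)])
            fix \<rho>6 \<mu>6 assume 6: "base \<rho>6 \<and> \<mu>6 aKey = \<mu>5 aKey \<and> \<mu>6 aSrc = \<mu>5 aSrc \<and>
              (\<forall>t. 0 \<le> t \<and> t < m \<longrightarrow> \<mu>6 aLow t = answer t)"
            show "triple W output_loop (nat m * 40 + 10) \<rho>6 \<mu>6 ?Q"
            proof (rule triple_conseq, rule output_loop_correct)
              fix \<rho>7 \<mu>7 assume 7: "\<forall>t. 0 \<le> t \<and> t < m \<longrightarrow> \<mu>7 aRaw t = \<mu>6 aKey (\<sigma> (answer t))"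
              show "?Q \<rho>7 \<mu>7"
              proof (intro allI impI, elim conjE)
                fix t assume t: "0 \<le> t" "t < m"
                note tb = pair_bounds[OF t]
                have "K (t div n * n + k) = \<mu> 0 (1 + t div n * n + k) \<and>
                  K ((n + t mod n) * n + k) = \<mu> 0 (1 + m + k * n + t mod n)" if k: "0 \<le> k" "k < n" for k
                proof -
                  have "(t div n + 1) * n \<le> n * n" "(t mod n + 1) * n \<le> n * n"
                    using tb n by (intro mult_right_mono; linarith)+
                  then have x: "0 \<le> t div n * n + k" "t div n * n + k < m" "0 \<le> t mod n * n + k" "t mod n * n + k < m"
                    using k tb n unfolding m by (auto simp: distrib_right)
                  have "(t mod n * n + k) mod n = k" "(t mod n * n + k) div n = t mod n" using k n by simp_all
                  then show ?thesis using 2(2)[OF x(1,2)] 2(2)[OF x(3,4)]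
                    by (simp add: m algebra_simps)
                qed
                then have "(\<lambda>k. max (K (t div n * n + k)) (K ((n + t mod n) * n + k))) ` {0..<n} =
                  (\<lambda>k. max (\<mu> 0 (1 + t div n * n + k)) (\<mu> 0 (1 + m + k * n + t mod n))) ` {0..<n}"
                  by (intro image_cong) auto
                then show "\<mu>7 0 t = Min ((\<lambda>k. max (\<mu> 0 (1 + t div n * n + k)) (\<mu> 0 (1 + m + k * n + t mod n))) ` {0..<n})"
                  using 7 t answer_bounds(3)[OF t] 6 5 \<mu>4(1) by simp
              qed
            qed (use 6 5 \<mu>4 in auto)
          next
            show "\<mu>5 aRaw x = 0" if "1 + 2 * m + V - V \<le> x" for x using 5 \<mu>4(6) \<mu>(2) that by simp
            show "1 + 2 * m + V + 9 * P * (2 * V + 1) \<le> B" using PD Wa(2) by linarith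
            have "L * (round_cost R c + 6) \<le> l * (nat m * (l * 140 + 3200) + 9 * R + 18 * c + 1506)"
              unfolding round_cost_def using Ll by (intro mult_mono) auto
            then show "L * (round_cost R c + 6) + 10 + (nat m * 40 + 10) \<le>
              nat m * 100 + l * (nat m * (l * 140 + 3200) + 9 * R + 18 * c + 1506) + 50" by linarith
          qed (use 5 \<mu>4 V0 Wb Wa in auto)
        qed (use Wa mV Wb V0 in linarith)+
      qed (use 3 2 \<mu> P4 in auto)
    next
      have "nat P * 300 \<le> nat m * 1200" using P4 by linarith
      with Ll have "L * (nat P * 300) \<le> l * (nat m * 1200)" by (rule mult_le_mono)
      then show "L * (nat P * 300) + nat P * 30 + 50 + (nat m * 600 + l * (nat m * (l * 140 + 3200) + 9 * R + 18 * c + 1506) + d * 20 + 150)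
        \<le> nat m * 740 + l * (nat m * 1200) + l * (nat m * (l * 140 + 3200) + 9 * R + 18 * c + 1506) + d * 20 + 220"
        using P4 by linarith
    qed (use P(1) L r2 2 \<mu> Wb in auto)
  qed auto
qed (auto simp: main_cost_def)

section \<open>The reduction\<close>

text \<open>For n = 1 the block size \<open>h\<close> would be 0, and an array of length 1 admits no
  valid query at all. The product is then the maximum of the two entries.\<close>

definition tiny_prog :: prog where
  "tiny_prog = IfLt (Arr aRaw (Num 1)) (Arr aRaw (Num 2)) (block [Put aRaw (Num 0) (Arr aRaw (Num 2))])
     (block [Put aRaw (Num 0) (Arr aRaw (Num 1))])"

definition product_prog :: "nat \<Rightarrow> prog \<Rightarrow> nat \<Rightarrow> prog" where
  "product_prog R p d = Seq (block [Set rN (Arr aRaw (Num 0))])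
     (IfLt (Var rN) (Num 2) tiny_prog (main_prog R p d))"

lemma tiny_prog_correct:
  assumes "48 \<le> W"
  shows "triple W tiny_prog 40 \<rho> \<mu> (\<lambda>\<rho>' \<mu>'. \<mu>' 0 0 = max (\<mu> 0 1) (\<mu> 0 2))"
  unfolding tiny_prog_def
  by (rule triple_conseq, rule triple_IfLt[where k=20])
    (use assms in \<open>auto intro!: triple_block\<close>)

lemma max_abs_le:
  assumes "\<And>x. x \<in> set xs \<Longrightarrow> \<bar>x\<bar> \<le> (M :: int)" "0 \<le> M"
  shows "Max (insert 0 (abs ` set xs)) \<le> M"
  using assms by (subst Max_le_iff) auto

lemma abs_le_word_bound:
  assumes "1 \<le> d" "x \<in> set xs"
  shows "\<bar>x\<bar> \<le> word_bound d xs"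
proof -
  let ?M = "Max (insert 0 (abs ` set xs))"
  have 0: "0 \<le> ?M" by (intro Max_ge) auto
  have "\<bar>x\<bar> \<le> ?M" using assms(2) by (intro Max_ge) auto
  also have "\<dots> \<le> (2 + int (length xs) + ?M) ^ 1" by simp
  also have "\<dots> \<le> (2 + int (length xs) + ?M) ^ d" using assms(1) 0 by (intro power_increasing) auto
  finally show ?thesis by (simp add: word_bound_def)
qed

lemma word_bound_ge:
  "(2 + int (length xs)) ^ d \<le> word_bound d xs"
proof -
  have "0 \<le> Max (insert 0 (abs ` set xs))" by (intro Max_ge) auto
  then show ?thesis unfolding word_bound_def by (intro power_mono) auto
qed

lemma fits_initial:
  assumes "\<And>x. x \<in> set xs \<Longrightarrow> \<bar>x\<bar> \<le> V" "0 \<le> V"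
  shows "fits V (initial_state xs)"
  using assms by (auto simp: fits_def initial_state_def)

section \<open>Guarantees drawn from the given solver\<close>

locale query_solver =
  fixes p :: prog and d :: nat and f :: "nat \<Rightarrow> real"
  assumes solver: "\<forall>(n, xs, ys) \<in> two_range_disjoint_query (\<lambda>n. n). \<exists>t s.
    exec (word_bound d xs) p (initial_state xs) t s \<and> has_output s ys \<and> real t \<le> f n"
begin

text \<open>An instance has \<open>2 + 5 * m\<close> words of absolute value at most
  \<open>m\<close>, so the base of its word bound is at most \<open>4 + 6 * m\<close>. The exponent
  \<open>Suc d\<close> instead of \<open>d\<close> lets the input fit even for
  \<open>d = 0\<close>.\<close>

lemma solves_instances:
  assumes m: "4 \<le> m"
  shows "solves p ((4 + 6 * int m) ^ Suc d) (int m) (nat \<lfloor>f m\<rfloor>)"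
  unfolding solves_def
proof (intro allI impI, elim conjE)
  fix arr q
  assume arr: "\<forall>x. 0 \<le> x \<and> x < int m \<longrightarrow> 0 \<le> arr x \<and> arr x \<le> int m"
    and q: "\<forall>t. 0 \<le> t \<and> t < int m \<longrightarrow>
      valid_query (nat (int m)) (query_of q t) \<and> (\<forall>i. 0 \<le> q t i \<and> q t i \<le> int m)"
  let ?V = "(4 + 6 * int m) ^ Suc d"
  let ?A = "inst_array (int m) arr" and ?Q = "inst_queries (int m) q" and ?xs = "inst_words (int m) arr q"
  let ?ys = "map (\<lambda>x. of_bool (ranges_disjoint ?A x)) ?Q :: int list"
  have qb: "0 \<le> q t i" "q t i \<le> int m" if "0 \<le> t" "t < int m" for t i using q that by auto
  have "(m, ?xs, ?ys) \<in> two_range_disjoint_query (\<lambda>n. n)"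
    unfolding two_range_disjoint_query_def inst_words_def
    using q by (intro CollectI exI[of _ m] exI[of _ ?A] exI[of _ ?Q])
      (auto simp: inst_array_def inst_queries_def)
  with solver obtain t s where ts: "exec (word_bound d ?xs) p (initial_state ?xs) t s" "has_output s ?ys"
    "real t \<le> f m" by fastforce
  have len: "int (length ?xs) = 2 + 5 * int m" using inst_words_nth(1)[of "int m" q arr] qb by simp
  have el: "\<bar>x\<bar> \<le> int m" if x: "x \<in> set ?xs" for x
  proof -
    from x consider "x = int m" | "x \<in> set ?A" | i where "i < m" "x \<in> set (query_words (query_of q (int i)))"
      unfolding inst_words_def inst_queries_def by auto
    then show ?thesis
    proof cases
      case 2
      then show ?thesis using arr by (auto simp: inst_array_def)
    next
      case 3
      then show ?thesis using qb[of "int i"] by (auto simp: query_of_def)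
    qed simp
  qed
  have M: "Max (insert 0 (abs ` set ?xs)) \<le> int m" "0 \<le> Max (insert 0 (abs ` set ?xs))"
    using el by (auto intro: max_abs_le Max_ge)
  have "word_bound d ?xs \<le> (4 + 6 * int m) ^ d"
    unfolding word_bound_def using M len by (intro power_mono) auto
  also have "\<dots> \<le> ?V" by (intro power_increasing) auto
  finally have W: "word_bound d ?xs \<le> ?V" .
  have "int m \<le> (4 + 6 * int m) ^ 1" by simp
  also have "\<dots> \<le> ?V" by (intro power_increasing) auto
  finally have mV: "int m \<le> ?V" .
  have "fits ?V (initial_state ?xs)" by (rule fits_initial) (use el mV in \<open>force+\<close>)
  moreover have "t \<le> nat \<lfloor>f m\<rfloor>" using ts(3) by (simp add: le_nat_floor)
  moreover have "mem s i = of_bool (ranges_disjoint ?A (query_of q i))" if "0 \<le> i" "i < int m" for i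
  proof -
    have "mem s (int (nat i)) = ?ys ! nat i"
      by (rule ts(2)[unfolded has_output_def, rule_format]) (use that in \<open>simp add: inst_queries_def nat_less_iff\<close>)
    then show ?thesis using that by (simp add: inst_queries_def nat_less_iff)
  qed
  ultimately show "\<exists>t s. exec ?V p (initial_state ?xs) t s \<and> t \<le> nat \<lfloor>f m\<rfloor> \<and>
      fits ?V (initial_state ?xs) \<and>
      (\<forall>i. 0 \<le> i \<and> i < int m \<longrightarrow> mem s i = of_bool (ranges_disjoint ?A (query_of q i)))"
    using exec_mono[OF ts(1) W] by blast
qed

text \<open>On an array of twos, all of whose answers are 0, the cells \<open>2, \<dots>, m - 1\<close> have to be overwritten.\<close>

lemma time_lower_bound:
  assumes m: "2 \<le> m"
  shows "real m - 2 \<le> f m"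
proof -
  let ?A = "replicate m (2 :: int)" and ?Q = "replicate m ((1, 1), (2, 2)) :: query list"
  let ?xs = "[int m, int m] @ ?A @ concat (map query_words ?Q)"
  let ?ys = "map (\<lambda>x. of_bool (ranges_disjoint ?A x)) ?Q :: int list"
  have "(m, ?xs, ?ys) \<in> two_range_disjoint_query (\<lambda>n. n)"
    unfolding two_range_disjoint_query_def using m
    by (intro CollectI exI[of _ m] exI[of _ ?A] exI[of _ ?Q]) auto
  with solver obtain t s where ts: "exec (word_bound d ?xs) p (initial_state ?xs) t s" "has_output s ?ys"
    "real t \<le> f m" by fastforce
  have nd: "\<not> ranges_disjoint ?A ((1, 1), (2, 2))" using m by (auto intro!: exI[of _ 1] exI[of _ 2])
  have ne: "mem (initial_state ?xs) a \<noteq> mem s a" if a: "2 \<le> a" "a < int m" for a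
  proof -
    have n: "nat a = Suc (Suc (nat (a - 2)))" "nat (a - 2) < m" using a by linarith+
    have "mem (initial_state ?xs) a = ?xs ! nat a" using a by (simp add: initial_state_def)
    also have "\<dots> = 2" unfolding n(1) using n(2) by (simp add: nth_append)
    finally have "mem (initial_state ?xs) a = 2" .
    moreover have "mem s (int (nat a)) = ?ys ! nat a"
      by (rule ts(2)[unfolded has_output_def, rule_format]) (use a in \<open>simp add: nat_less_iff\<close>)
    moreover have "?ys ! nat a = 0" using a nd by (simp del: ranges_disjoint.simps add: nat_less_iff)
    ultimately show ?thesis using a by simp
  qed
  have "card {2..<int m} \<le> card {a. mem (initial_state ?xs) a \<noteq> mem s a}"
  proof (rule card_mono)
    show "finite {a. mem (initial_state ?xs) a \<noteq> mem s a}" using exec_changed[OF ts(1)] by (rule conjunct1)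
    show "{2..<int m} \<subseteq> {a. mem (initial_state ?xs) a \<noteq> mem s a}"
    proof
      fix a assume "a \<in> {2..<int m}"
      then show "a \<in> {a. mem (initial_state ?xs) a \<noteq> mem s a}" using ne[of a] by simp
    qed
  qed
  also have "\<dots> \<le> t" using exec_changed[OF ts(1)] by (rule conjunct2)
  finally have "nat (int m - 2) \<le> t" by simp
  then show ?thesis using ts(3) m by linarith
qed

end

text \<open>An integer upper bound for the binary logarithm of \<open>4 * n ^ 2\<close>, hence for
  the exponent \<open>L\<close> of \<open>P\<close>.\<close>

definition log_bound :: "nat \<Rightarrow> nat" where
  "log_bound n = 2 + 2 * nat \<lceil>log 2 (real n)\<rceil>"

lemma log_bound:
  assumes "1 \<le> n"
  shows "4 * (int n * int n) \<le> 2 ^ log_bound n"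
proof -
  let ?k = "nat \<lceil>log 2 (real n)\<rceil>"
  have "real n = 2 powr log 2 (real n)" using assms by simp
  also have "\<dots> \<le> 2 powr real ?k" by (intro powr_mono) (auto simp: real_nat_ceiling_ge)
  also have "\<dots> = 2 ^ ?k" by (simp add: powr_realpow)
  finally have "real_of_int (int n) \<le> real_of_int (2 ^ ?k)" by simp
  then have k: "int n \<le> 2 ^ ?k" by linarith
  have "4 * (int n * int n) \<le> 4 * (2 ^ ?k * 2 ^ ?k)" using k by (intro mult_left_mono mult_mono) auto
  also have "\<dots> = 2 ^ log_bound n" unfolding log_bound_def power_add mult_2 by simp
  finally show ?thesis .
qed

text \<open>From n = 3 on the natural logarithm is at least 1 and absorbs the additive constants:
  rounding up gives at most \<open>4 + 4 * ln n\<close>.\<close>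

lemma log_bound_le:
  assumes "3 \<le> n"
  shows "1 \<le> ln (real n)" "real (log_bound n) \<le> 8 * ln (real n)"
proof -
  have "exp 1 \<le> (3 :: real)" by (rule exp_le)
  then have "exp 1 \<le> real n" using assms by linarith
  then show l: "1 \<le> ln (real n)" using assms by (subst ln_ge_iff) auto
  have "1 \<le> ln (4 :: real)" using \<open>exp 1 \<le> 3\<close> by (subst ln_ge_iff) auto
  also have "ln (4 :: real) = 2 * ln 2" using ln_mult[of 2 "2 :: real"] by simp
  finally have ln2: "1 / 2 \<le> ln (2 :: real)" by simp
  have "log 2 (real n) = ln (real n) / ln 2" by (simp add: log_def)
  also have "\<dots> \<le> ln (real n) / (1 / 2)" using ln2 l by (intro divide_left_mono) auto
  finally have g: "log 2 (real n) \<le> 2 * ln (real n)" by simp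
  have "real (nat \<lceil>log 2 (real n)\<rceil>) \<le> log 2 (real n) + 1"
    using assms by (simp add: zero_le_log_cancel_iff)
  then show "real (log_bound n) \<le> 8 * ln (real n)" unfolding log_bound_def using g l by simp
qed

lemma concat_mat_to_list:
  assumes "A \<in> carrier_mat n n'" "i < n" "j < n'"
  shows "concat (mat_to_list A) ! (i * n' + j) = A $$ (i, j)"
proof -
  have "mat_to_list A = map (\<lambda>i. map (\<lambda>j. A $$ (i, j)) [0..<n']) [0..<n]"
    using assms(1) by (simp add: mat_to_list_def)
  then show ?thesis using concat_map_const(2)[of n "\<lambda>i. map (\<lambda>j. A $$ (i, j)) [0..<n']" n' i j] assms(2,3) by simp
qed

lemma length_concat_mat_to_list:
  assumes "A \<in> carrier_mat n n'"
  shows "length (concat (mat_to_list A)) = n * n'"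
proof -
  have "mat_to_list A = map (\<lambda>i. map (\<lambda>j. A $$ (i, j)) [0..<n']) [0..<n]"
    using assms(1) by (simp add: mat_to_list_def)
  then show ?thesis using concat_map_const(1)[of n "\<lambda>i. map (\<lambda>j. A $$ (i, j)) [0..<n']" n'] by simp
qed


text \<open>With \<open>X = 3 + 2 * m\<close>, the base \<open>4 + 6 * m\<close> is at most the
  square of \<open>X\<close>, so \<open>V\<close> uses up the exponent \<open>2 * d\<close>. The
  remaining factor \<open>X ^ 6\<close> exceeds \<open>2000 * X\<close>, which pays for
  \<open>36 * m\<close> windows of width \<open>2 * V + 1\<close> and for the interleaving factor
  16.\<close>

lemma word_size:
  fixes m V W :: int
  assumes m: "4 \<le> m" and V: "V = (4 + 6 * m) ^ d" "1 \<le> d" and W: "(3 + 2 * m) ^ (2 * d + 6) \<le> W"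
  shows "64 * (4 * m) + 64 \<le> W" "16 * (1 + 2 * m + V + 36 * m * (2 * V + 1)) + 16 \<le> W" "int d \<le> W" "5 * m + 2 \<le> V"
proof -
  let ?X = "3 + 2 * m"
  have X: "11 \<le> ?X" using m by simp
  have "4 + 6 * m \<le> ?X * ?X" using m by (simp add: algebra_simps)
  then have VX: "V \<le> (?X * ?X) ^ d" unfolding V(1) using m by (intro power_mono) auto
  have "(4 + 6 * m) ^ 1 \<le> V" unfolding V(1) using m V(2) by (intro power_increasing) auto
  then have V1: "4 + 6 * m \<le> V" by simp
  then show "5 * m + 2 \<le> V" using m by linarith
  have "(11 :: int) ^ 5 \<le> ?X ^ 5" using X by (intro power_mono) auto
  then have X5: "2000 \<le> ?X ^ 5" by simp
  have "(2000 * ?X) * V \<le> (?X ^ 5 * ?X) * (?X * ?X) ^ d"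
    using X5 VX X V1 m by (intro mult_mono) auto
  also have "?X ^ 5 * ?X = ?X ^ 6" using power_add[of ?X 5 1] by simp
  also have "(?X * ?X) ^ d = ?X ^ (2 * d)" by (simp only: power_mult power2_eq_square)
  also have "?X ^ 6 * ?X ^ (2 * d) = ?X ^ (2 * d + 6)" by (simp only: power_add mult.commute)
  finally have "2000 * ?X * V \<le> W" using W by (rule order_trans)
  then have big: "2000 * (?X * V) \<le> W" by (simp only: mult.assoc)
  have p1: "11 * V \<le> ?X * V" using X V1 m by (intro mult_right_mono) auto
  have p2: "?X * V = 3 * V + 2 * (m * V)" by (simp add: algebra_simps)
  have mV: "m * 1 \<le> m * V" using m V1 by (intro mult_left_mono) auto
  show "64 * (4 * m) + 64 \<le> W" using big p1 V1 m by linarith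
  have "16 * (1 + 2 * m + V + 36 * m * (2 * V + 1)) + 16 = 32 + 608 * m + 16 * V + 1152 * (m * V)"
    by (simp add: algebra_simps)
  also have "\<dots> \<le> W" using big p1 p2 mV V1 m by linarith
  finally show "16 * (1 + 2 * m + V + 36 * m * (2 * V + 1)) + 16 \<le> W" .
  have "int d < 2 ^ d" by (rule of_nat_less_two_power)
  also have "\<dots> \<le> ?X ^ d" using X by (intro power_mono) auto
  also have "\<dots> \<le> ?X ^ (2 * d + 6)" using X by (intro power_increasing) auto
  finally show "int d \<le> W" using W by simp
qed

lemma (in query_solver) product_prog_correct:
  assumes R: "prog_regs p \<subseteq> {..<R}" and inst: "(n, xs, ys) \<in> min_max_product"
  shows "\<exists>t s. exec (word_bound (2 * Suc d + 6) xs) (product_prog R p (Suc d)) (initial_state xs) t s \<and>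
    has_output s ys \<and> t \<le> main_cost (Suc d) R (n ^ 2) (log_bound n) (nat \<lfloor>f (n ^ 2)\<rfloor>) + 70"
proof -
  define W where "W = word_bound (2 * Suc d + 6) xs"
  define c where "c = nat \<lfloor>f (n ^ 2)\<rfloor>"
  let ?C = "main_cost (Suc d) R (n ^ 2) (log_bound n) c"
  from inst obtain A B where n: "0 < n" and A: "A \<in> carrier_mat n n" and B: "B \<in> carrier_mat n n"
    and xs: "xs = [int n] @ concat (mat_to_list A) @ concat (mat_to_list B)"
    and ys: "ys = concat (mat_to_list (min_max_prod A B))"
    unfolding min_max_product_def by blast
  have lA: "length (concat (mat_to_list A)) = n * n" "length (concat (mat_to_list B)) = n * n"
    using length_concat_mat_to_list A B by blast+
  have prod: "min_max_prod A B \<in> carrier_mat n n" using A B by (auto simp: min_max_prod_def)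
  have ly: "length ys = n * n" unfolding ys by (rule length_concat_mat_to_list[OF prod])
  have lx: "length xs = 1 + 2 * (n * n)" unfolding xs by (simp add: lA)
  let ?m = "int n * int n"
  let ?\<rho> = "rv (initial_state xs)" and ?\<mu> = "av (initial_state xs)"
  have "(3 + 2 * ?m) ^ (2 * Suc d + 6) \<le> W" using word_bound_ge[of xs "2 * Suc d + 6"] unfolding W_def lx
    by (simp add: add.assoc)
  note W = this
  have "1 \<le> ?m" using n by (simp add: int_one_le_iff_zero_less)
  then have "(5::int) ^ 6 \<le> (3 + 2 * ?m) ^ 6" by (intro power_mono) auto
  also have "\<dots> \<le> (3 + 2 * ?m) ^ (2 * Suc d + 6)" by (intro power_increasing) auto
  finally have W48: "48 \<le> W" using W by simp
  have fits: "fits W (initial_state xs)"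
    by (rule fits_initial) (use W48 abs_le_word_bound[of "2 * Suc d + 6" _ xs] in \<open>auto simp: W_def\<close>)
  have \<mu>0: "?\<mu> 0 (int i) = (if i < length xs then xs ! i else 0)" for i
    by (simp add: av_def addr_def initial_state_def)
  have \<mu>c: "?\<mu> a = (\<lambda>_. 0)" if "a \<noteq> 0" for a
    using that by (auto simp: av_def addr_def initial_state_def fun_eq_iff)
  have x0: "?\<mu> 0 0 = int n" using \<mu>0[of 0] by (simp add: xs)
  have xA: "?\<mu> 0 (1 + int i * int n + int k) = A $$ (i, k)"
    and xB: "?\<mu> 0 (1 + ?m + int k * int n + int i) = B $$ (k, i)" if "i < n" "k < n" for i k
  proof -
    have *: "a * n + b < n * n" if "a < n" "b < n" for a b
    proof -
      have "(a + 1) * n \<le> n * n" using that by (intro mult_right_mono) auto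
      then show ?thesis using that by simp
    qed
    have "1 + int i * int n + int k = int (Suc (i * n + k))"
      "1 + ?m + int k * int n + int i = int (Suc (n * n + (k * n + i)))" by simp_all
    then show "?\<mu> 0 (1 + int i * int n + int k) = A $$ (i, k)"
      "?\<mu> 0 (1 + ?m + int k * int n + int i) = B $$ (k, i)"
      using *[of i k] *[of k i] that concat_mat_to_list[OF A that] concat_mat_to_list[OF B that(2,1)]
      by (simp_all only: \<mu>0 lx) (simp_all add: xs nth_append lA)
  qed
  have y: "ys ! \<tau> = Min ((\<lambda>k. max (?\<mu> 0 (1 + int \<tau> div int n * int n + k))
      (?\<mu> 0 (1 + ?m + k * int n + int \<tau> mod int n))) ` {0..<int n})" if "\<tau> < n * n" for \<tau>
  proof -
    let ?i = "\<tau> div n" and ?j = "\<tau> mod n"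
    have ij: "?i < n" "?j < n" "?i * n + ?j = \<tau>" using that n by (simp_all add: less_mult_imp_div_less)
    have "ys ! \<tau> = min_max_prod A B $$ (?i, ?j)"
      using concat_mat_to_list[OF prod ij(1,2)] unfolding ys ij(3) .
    also have "\<dots> = Min ((\<lambda>k. max (A $$ (?i, k)) (B $$ (k, ?j))) ` {..<n})"
      using A B ij by (simp add: min_max_prod_def)
    also have "(\<lambda>k. max (A $$ (?i, k)) (B $$ (k, ?j))) ` {..<n} = (\<lambda>k. max (?\<mu> 0 (1 + int \<tau> div int n * int n + k))
      (?\<mu> 0 (1 + ?m + k * int n + int \<tau> mod int n))) ` (int ` {..<n})"
      unfolding image_image zdiv_int[symmetric] zmod_int[symmetric]
      by (rule image_cong) (use xA[OF ij(1)] xB[OF ij(2)] in auto)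
    also have "int ` {..<n} = {0..<int n}" using image_int_atLeastLessThan[of 0 n] by (simp add: lessThan_atLeast0)
    finally show ?thesis .
  qed
  let ?Q = "\<lambda>(\<rho>' :: nat \<Rightarrow> int) (\<mu>' :: nat \<Rightarrow> int \<Rightarrow> int). \<forall>\<tau> < n * n. \<mu>' 0 (int \<tau>) = ys ! \<tau>"
  have "triple W (product_prog R p (Suc d)) (?C + 70) ?\<rho> ?\<mu> ?Q"
    unfolding product_prog_def
  proof (rule triple_Seq)
    show "triple W (block [Set rN (Arr aRaw (Num 0))]) 10 ?\<rho> ?\<mu> (\<lambda>\<rho>' \<mu>'. \<rho>' = ?\<rho>(rN := int n) \<and> \<mu>' = ?\<mu>)"
      by (rule triple_block) (use W48 x0 in auto)
  next
    fix \<rho>1 \<mu>1 assume 1: "\<rho>1 = ?\<rho>(rN := int n) \<and> \<mu>1 = ?\<mu>"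
    show "triple W (IfLt (Var rN) (Num 2) tiny_prog (main_prog R p (Suc d)))
      ((?C + 40) + cost (Var rN) + cost (Num 2) + 1) \<rho>1 \<mu>1 ?Q"
    proof (rule triple_IfLt)
      assume "ev \<rho>1 \<mu>1 (Var rN) < ev \<rho>1 \<mu>1 (Num 2)"
      then have n1: "n = 1" using 1 n by simp
      show "triple W tiny_prog (?C + 40) \<rho>1 \<mu>1 ?Q"
      proof (rule triple_conseq, rule tiny_prog_correct[OF W48])
        fix \<rho>' :: "nat \<Rightarrow> int" and \<mu>' :: "nat \<Rightarrow> int \<Rightarrow> int"
        assume "\<mu>' 0 0 = max (\<mu>1 0 1) (\<mu>1 0 2)"
        moreover have "ys ! 0 = max (?\<mu> 0 1) (?\<mu> 0 2)"
        proof -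
          have "{0..<int n} = {0}" using n1 by auto
          then show ?thesis using y[of 0] n1 by simp
        qed
        ultimately show "?Q \<rho>' \<mu>'" using 1 n1 by simp
      qed simp
    next
      assume "\<not> ev \<rho>1 \<mu>1 (Var rN) < ev \<rho>1 \<mu>1 (Num 2)"
      then have n2: "2 \<le> n" using 1 by simp
      have "2 * 2 \<le> n * n" using n2 by (intro mult_le_mono) auto
      then have m4: "4 \<le> n ^ 2" by (simp add: power2_eq_square)
      have mi: "int (n ^ 2) = ?m" by (simp add: power2_eq_square)
      have m4': "4 \<le> ?m" using m4 mi by linarith
      let ?V = "(4 + 6 * ?m) ^ Suc d"
      note ws = word_size[OF m4' refl _ W]
      have slv: "solves p ?V ?m c" using solves_instances[OF m4] unfolding mi c_def .
      have C: "main_cost (Suc d) R (nat ?m) (log_bound n) c = ?C" using mi by (metis nat_int)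
      have "triple W (main_prog R p (Suc d)) (main_cost (Suc d) R (nat ?m) (log_bound n) c) \<rho>1 \<mu>1
        (\<lambda>\<rho>' \<mu>'. \<forall>t. 0 \<le> t \<and> t < ?m \<longrightarrow> \<mu>' 0 t = Min ((\<lambda>k. max (\<mu>1 0 (1 + t div int n * int n + k))
          (\<mu>1 0 (1 + ?m + k * int n + t mod int n))) ` {0..<int n}))"
      proof (rule main_prog_correct[where V="?V" and B="1 + 2 * ?m + ?V + 36 * ?m * (2 * ?V + 1)"])
        show "4 * ?m \<le> 2 ^ log_bound n" using log_bound n2 by simp
        show "\<mu>1 0 x = 0" if x: "1 + 2 * ?m \<le> x" for x
        proof -
          have "0 \<le> ?m" "int (length xs) = 1 + 2 * ?m" using lx by simp_all
          then have "\<not> nat x < length xs" "x = int (nat x)" using x by linarith+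
          then show ?thesis using 1 \<mu>0[of "nat x"] by simp
        qed
      qed (use 1 n2 slv R ws \<mu>c in auto)
      then show "triple W (main_prog R p (Suc d)) (?C + 40) \<rho>1 \<mu>1 ?Q"
      proof (rule triple_conseq)
        fix \<rho>' :: "nat \<Rightarrow> int" and \<mu>' :: "nat \<Rightarrow> int \<Rightarrow> int"
        assume *: "\<forall>t. 0 \<le> t \<and> t < ?m \<longrightarrow> \<mu>' 0 t = Min ((\<lambda>k. max (\<mu>1 0 (1 + t div int n * int n + k))
          (\<mu>1 0 (1 + ?m + k * int n + t mod int n))) ` {0..<int n})"
        show "?Q \<rho>' \<mu>'"
        proof (intro allI impI)
          fix \<tau> assume \<tau>: "\<tau> < n * n"
          then have "int \<tau> < ?m" by (metis of_nat_less_iff of_nat_mult)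
          then show "\<mu>' 0 (int \<tau>) = ys ! \<tau>" using * y[OF \<tau>] 1 by simp
        qed
      qed (simp add: C)
    qed (use 1 W48 in auto)
  qed simp
  then obtain t s where t: "exec W (product_prog R p (Suc d)) (initial_state xs) t s" "t \<le> ?C + 70"
    "\<forall>\<tau> < n * n. av s 0 (int \<tau>) = ys ! \<tau>"
    by (rule tripleD) (use fits in auto)
  have "has_output s ys" unfolding has_output_def ly using t(3) by (simp add: av_def addr_def)
  then show ?thesis using t(1,2) unfolding W_def c_def by blast
qed

text \<open>\<open>M \<le> 2 * F\<close> charges all work per pair to the solver's time. The square
  of \<open>lam\<close> comes from the rounds times the inner binary searches for prefix lengths;
  150000 is the sum of the constant coefficients, about 103000, rounded up.\<close>

lemma cost_estimate:
  fixes F lam :: real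
  assumes F: "1 \<le> F" "real M \<le> 2 * F" "real c \<le> F" and lam: "1 \<le> lam" "real l \<le> 8 * lam"
  shows "real (main_cost d R M l c + 70) \<le> (150000 + 72 * real R + 20 * real d) * (F * lam ^ 2)"
proof -
  have l2: "1 \<le> lam ^ 2" "lam \<le> lam ^ 2"
    using lam(1) one_le_power[of lam 2] power_increasing[of 1 2 lam] by simp_all
  have U: "1 \<le> F * lam ^ 2" "F \<le> F * lam ^ 2" "lam \<le> F * lam ^ 2" "F * lam \<le> F * lam ^ 2"
  proof -
    show F2: "F \<le> F * lam ^ 2" using F(1) l2(1) by (simp add: mult_le_cancel_left1)
    show "1 \<le> F * lam ^ 2" using F2 F(1) by linarith
    show "F * lam \<le> F * lam ^ 2" using F(1) l2(2) by (intro mult_left_mono) auto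
    have "1 * lam ^ 2 \<le> F * lam ^ 2" using F(1) by (intro mult_right_mono) auto
    then show "lam \<le> F * lam ^ 2" using l2(2) by linarith
  qed
  have lM: "real l * real M \<le> (8 * lam) * (2 * F)" using F lam by (intro mult_mono) auto
  have "real l * (real l * real M) \<le> (8 * lam) * ((8 * lam) * (2 * F))" using lM F lam by (intro mult_mono) auto
  then have llM: "real l * (real l * real M) \<le> 128 * (F * lam ^ 2)" by (simp add: power2_eq_square algebra_simps)
  have lc: "real l * real c \<le> (8 * lam) * F" using F lam by (intro mult_mono) auto
  have lM': "real l * real M \<le> 16 * (F * lam ^ 2)" and lc': "real l * real c \<le> 8 * (F * lam ^ 2)"
    using lM lc U(4) by (simp_all add: algebra_simps)
  have lb: "real l \<le> 8 * (F * lam ^ 2)" using lam(2) U(3) by linarith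
  have lR: "real l * real R \<le> 8 * (F * lam ^ 2) * real R" using lb by (intro mult_right_mono) auto
  have dU: "real d * 1 \<le> real d * (F * lam ^ 2)" using U(1) by (intro mult_left_mono) auto
  have "real (main_cost d R M l c + 70) = 1000 * real M + 4400 * (real l * real M) + 140 * (real l * (real l * real M)) +
    9 * (real l * real R) + 18 * (real l * real c) + 1506 * real l + 20 * real d + 370"
    by (simp add: main_cost_def algebra_simps)
  also have "\<dots> \<le> 2000 * (F * lam ^ 2) + 4400 * (16 * (F * lam ^ 2)) + 140 * (128 * (F * lam ^ 2)) +
    9 * (8 * (F * lam ^ 2) * real R) + 18 * (8 * (F * lam ^ 2)) + 1506 * (8 * (F * lam ^ 2)) +
    20 * (real d * (F * lam ^ 2)) + 370 * (F * lam ^ 2)"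
    using F(2) U lM' llM lR lc' lb dU by linarith
  also have "\<dots> \<le> (150000 + 72 * real R + 20 * real d) * (F * lam ^ 2)"
    using U(1) by (simp add: algebra_simps)
  finally show ?thesis .
qed

theorem theorem7:
  fixes T :: "nat \<Rightarrow> real"
  assumes "solvable_in_time (two_range_disjoint_query (\<lambda>n. n)) (O(T))"
  shows "solvable_in_time min_max_product (soft_O (\<lambda>n. T (n ^ 2)))"
proof -
  from assms obtain p d f where f: "f \<in> O(T)"
    and solver: "\<forall>(n, xs, ys) \<in> two_range_disjoint_query (\<lambda>n. n). \<exists>t s.
      exec (word_bound d xs) p (initial_state xs) t s \<and> has_output s ys \<and> real t \<le> f n"
    unfolding solvable_in_time_def by blast
  interpret query_solver p d f by unfold_locales (rule solver)
  obtain R where R: "prog_regs p \<subseteq> {..<R}"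
    using finite_prog_regs[of p] unfolding finite_nat_set_iff_bounded by blast
  define g where "g n = real (main_cost (Suc d) R (n ^ 2) (log_bound n) (nat \<lfloor>f (n ^ 2)\<rfloor>) + 70)" for n
  from f obtain C where C: "0 < C" "eventually (\<lambda>m. \<bar>f m\<bar> \<le> C * \<bar>T m\<bar>) at_top"
    by (auto elim: landau_o.bigE)
  then obtain N where N: "\<And>m. N \<le> m \<Longrightarrow> \<bar>f m\<bar> \<le> C * \<bar>T m\<bar>"
    by (auto simp: eventually_at_top_linorder)
  let ?K = "150000 + 72 * real R + 20 * real (Suc d)"
  have "norm (g n) \<le> ?K * C * norm (T (n ^ 2) * ln (real n) ^ 2)" if n: "max 3 N \<le> n" for n
  proof -
    have n3: "3 \<le> n" "N \<le> n" using n by auto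
    have "n \<le> n ^ 2" by (simp add: power2_eq_square)
    then have nn: "N \<le> n ^ 2" using n3(2) by linarith
    have "3 * 3 \<le> n * n" using n3 by (intro mult_le_mono) auto
    then have m9: "9 \<le> n ^ 2" by (simp add: power2_eq_square)
    let ?F = "f (n ^ 2)"
    \<comment> \<open>The solver's own lower bound at length \<open>n ^ 2\<close>: it makes
      \<open>f (n ^ 2)\<close> positive and at least half of \<open>n ^ 2\<close>, as the cost
      estimate demands.\<close>
    have "real (n ^ 2) - 2 \<le> ?F" using m9 by (intro time_lower_bound) auto
    moreover have "9 \<le> real (n ^ 2)" using m9 by (metis of_nat_le_iff of_nat_numeral)
    ultimately have F: "1 \<le> ?F" "real (n ^ 2) \<le> 2 * ?F" by linarith+
    note l = log_bound_le[OF n3(1)]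
    have "g n \<le> ?K * (?F * ln (real n) ^ 2)"
      unfolding g_def using F l by (intro cost_estimate) auto
    \<comment> \<open>The asymptotic bound is used at the single argument \<open>n ^ 2\<close>, the
      length of every call, so values of \<open>T\<close> at different lengths are never
      compared.\<close>
    also have "\<dots> \<le> ?K * ((C * \<bar>T (n ^ 2)\<bar>) * ln (real n) ^ 2)"
      using N[OF nn] F by (intro mult_left_mono mult_right_mono) auto
    finally show ?thesis unfolding g_def by (simp add: abs_mult mult_ac)
  qed
  then have "g \<in> O(\<lambda>n. T (n ^ 2) * ln (real n) ^ 2)"
    by (intro bigoI[of _ "?K * C"] eventually_at_top_linorderI[of "max 3 N"]) auto
  then have "g \<in> soft_O (\<lambda>n. T (n ^ 2))" unfolding soft_O_def by blast
  moreover have "\<exists>t s. exec (word_bound (2 * Suc d + 6) xs) (product_prog R p (Suc d)) (initial_state xs) t s \<and>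
      has_output s ys \<and> real t \<le> g n" if inst: "(n, xs, ys) \<in> min_max_product" for n xs ys
    using product_prog_correct[OF R inst] unfolding g_def of_nat_le_iff .
  ultimately show ?thesis unfolding solvable_in_time_def by blast
qed

end
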